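(* Let $X$ be a compact smooth manifold with corners with embedded boundary hypersurfaces $H_1,\dots,H_N$, and let $g_0$ be a smooth Riemannian metric on $X$. For the product interaction metric $g_\Pi=\bigl(\prod_{i=1}^N\rho_i^{-\alpha_i}\bigr)g_0$, the metric completion $\overline{(X^\circ,d_{g_\Pi})}$ is canonically homeomorphic to $$X_{g_\Pi}^{\mathrm{acc}}=X^\circ\cup\{p\in\partial X: A(p)<2\}.$$ For the sum interaction metric $g_\Sigma=\bigl(\sum_{i=1}^N\rho_i^{-\alpha_i}\bigr)g_0$, the metric completion $\overline{(X^\circ,d_{g_\Sigma})}$ is canonically homeomorphic to $$X_{g_\Sigma}^{\mathrm{acc}}=X^\circ\cup\{p\in\partial X: M(p)<2\}.$$ Here the sets $X_g^{\mathrm{acc}}$ carry the subspace topology inherited from $X$. In each case, the homeomorphism sends a completion class to the unique limit in $X$ (in the background topology) of any Cauchy sequence in $X^\circ$ representing it.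
   Context: The manifold with corners $X$ is locally modelled on $[0,\infty)^k\times\mathbb R^{n-k}$, $0\le k\le n=\dim X$, and $X^\circ=X\setminus\partial X$. For each $i$, $\rho_i:X\to[0,\infty)$ is a smooth boundary-defining function of $H_i$: $H_i=\rho_i^{-1}(0)$, $d\rho_i\neq0$ on $H_i$, and $\rho_i>0$ on $X\setminus H_i$. The weights satisfy $\alpha_1,\dots,\alpha_N\ge0$. The metric $g_0$ is smooth and positive definite up to the boundary; $g_\Pi$ and $g_\Sigma$ are Riemannian metrics on $X^\circ$, and $d_g$ denotes the Riemannian distance of $g$ on $X^\circ$. The background topology is the topology of $X$. For $p\in X$, $I(p)=\{i:p\in H_i\}$; for $p\in\partial X$, $A(p)=\sum_{i\in I(p)}\alpha_i$ and $M(p)=\max_{i\in I(p)}\alpha_i$. For $g\in\{g_\Pi,g_\Sigma\}$, a point $p\in\partial X$ is accessible with respect to $g$ if there is a $d_g$-Cauchy sequence in $X^\circ$ converging to $p$ in the background topology, and $X_g^{\mathrm{acc}}$ is the union of $X^\circ$ with the set of boundary points accessible with respect to $g$. *)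

theory Defs
  imports "HOL-Analysis.Analysis"
begin

section \<open>Smooth maps\<close>

text \<open>\<open>Ck_on k W f\<close> is meant for open \<open>W\<close>: all iterated directional derivatives of order
  \<open>\<le> k\<close> exist and are continuous on \<open>W\<close>.\<close>

fun Ck_on :: "nat \<Rightarrow> 'e::euclidean_space set \<Rightarrow> ('e \<Rightarrow> 'f::real_normed_vector) \<Rightarrow> bool" where
  "Ck_on 0 W f \<longleftrightarrow> continuous_on W f"
| "Ck_on (Suc k) W f \<longleftrightarrow>
     (\<forall>x\<in>W. f differentiable (at x)) \<and> (\<forall>v. Ck_on k W (\<lambda>x. frechet_derivative f (at x) v))"

text \<open>Smoothness on a set that need not be open (relatively open subsets of a model corner, below):
  local extendability to a smooth map on an open subset of the ambient space.\<close>

definition smooth_on :: "'e::euclidean_space set \<Rightarrow> ('e \<Rightarrow> 'f::real_normed_vector) \<Rightarrow> bool" where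
  "smooth_on A f \<longleftrightarrow>
     (\<forall>x\<in>A. \<exists>W F. open W \<and> x \<in> W \<and> (\<forall>k. Ck_on k W F) \<and> (\<forall>y\<in>A \<inter> W. F y = f y))"

section \<open>Manifolds with corners\<close>

text \<open>The Euclidean space of dimension \<open>n\<close> is rendered as \<open>span B\<close> for a set \<open>B\<close> of \<open>n\<close> standard
  basis vectors of the ambient type. Taking \<open>B = Basis\<close> gives the whole type; a type of class
  \<open>euclidean_space\<close> always has positive dimension, and \<open>B = {}\<close> also admits \<open>n = 0\<close>.
  For \<open>S \<subseteq> B\<close> with \<open>card S = k\<close>, \<open>corner B S\<close> is the model \<open>[0,\<infinity>)\<^sup>k \<times> \<real>\<^sup>n\<^sup>-\<^sup>k\<close>, where the
  coordinates restricted to \<open>[0,\<infinity>)\<close> are those in \<open>S\<close>.\<close>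

definition corner :: "'e::euclidean_space set \<Rightarrow> 'e set \<Rightarrow> 'e set" where
  "corner B S = {x \<in> span B. \<forall>b\<in>S. 0 \<le> x \<bullet> b}"

record ('a, 'e) chart =
  cdom :: "'a set"
  cmap :: "'a \<Rightarrow> 'e"
  cfaces :: "'e set"

definition cinv :: "('a, 'e) chart \<Rightarrow> 'e \<Rightarrow> 'a" where
  "cinv c = inv_into (cdom c) (cmap c)"

definition corner_chart :: "'a topology \<Rightarrow> 'e::euclidean_space set \<Rightarrow> ('a, 'e) chart \<Rightarrow> bool" where
  "corner_chart X B c \<longleftrightarrow>
     openin X (cdom c) \<and> cfaces c \<subseteq> B \<and>
     openin (top_of_set (corner B (cfaces c))) (cmap c ` cdom c) \<and>
     homeomorphic_map (subtopology X (cdom c)) (top_of_set (cmap c ` cdom c)) (cmap c)"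

definition manifold_with_corners ::
    "'a topology \<Rightarrow> ('a, 'e::euclidean_space) chart set \<Rightarrow> 'e set \<Rightarrow> bool" where
  "manifold_with_corners X \<A> B \<longleftrightarrow>
     Hausdorff_space X \<and> second_countable X \<and> B \<subseteq> Basis \<and>
     (\<forall>c\<in>\<A>. corner_chart X B c) \<and> (\<Union>c\<in>\<A>. cdom c) = topspace X \<and>
     (\<forall>c\<in>\<A>. \<forall>c'\<in>\<A>. smooth_on (cmap c ` (cdom c \<inter> cdom c')) (cmap c' \<circ> cinv c))"

definition mboundary :: "'a topology \<Rightarrow> ('a, 'e::euclidean_space) chart set \<Rightarrow> 'a set" where
  "mboundary X \<A> =
     {p \<in> topspace X. \<exists>c\<in>\<A>. p \<in> cdom c \<and> (\<exists>b\<in>cfaces c. cmap c p \<bullet> b = 0)}"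

definition minterior :: "'a topology \<Rightarrow> ('a, 'e::euclidean_space) chart set \<Rightarrow> 'a set" where
  "minterior X \<A> = topspace X - mboundary X \<A>"

definition smooth_function :: "('a, 'e::euclidean_space) chart set \<Rightarrow> ('a \<Rightarrow> real) \<Rightarrow> bool" where
  "smooth_function \<A> f \<longleftrightarrow> (\<forall>c\<in>\<A>. smooth_on (cmap c ` cdom c) (f \<circ> cinv c))"

text \<open>Indices \<open>i\<close> with \<open>p \<in> H\<^sub>i\<close>.\<close>

definition hyp_index :: "nat \<Rightarrow> (nat \<Rightarrow> 'a set) \<Rightarrow> 'a \<Rightarrow> nat set" where
  "hyp_index N H p = {i \<in> {1..N}. p \<in> H i}"

text \<open>\<open>H\<^sub>1, \<dots>, H\<^sub>N\<close> are the embedded boundary hypersurfaces: closed sets such that near every point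
  \<open>p\<close> the \<open>H\<^sub>i\<close> through \<open>p\<close> are, without repetition or omission, the coordinate faces through \<open>p\<close>.
  In particular they cover the boundary, and no \<open>H\<^sub>i\<close> meets itself in a corner. An \<open>H\<^sub>i\<close> may
  be connected or a union of disjoint connected hypersurfaces.\<close>

definition boundary_hypersurfaces ::
    "'a topology \<Rightarrow> ('a, 'e::euclidean_space) chart set \<Rightarrow> nat \<Rightarrow> (nat \<Rightarrow> 'a set) \<Rightarrow> bool" where
  "boundary_hypersurfaces X \<A> N H \<longleftrightarrow>
     (\<forall>i\<in>{1..N}. closedin X (H i)) \<and>
     (\<forall>c\<in>\<A>. \<forall>p\<in>cdom c. \<exists>W \<beta>. openin X W \<and> p \<in> W \<and> W \<subseteq> cdom c \<and>
        bij_betw \<beta> (hyp_index N H p) {b \<in> cfaces c. cmap c p \<bullet> b = 0} \<and>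
        (\<forall>i\<in>hyp_index N H p. H i \<inter> W = {q \<in> W. cmap c q \<bullet> \<beta> i = 0}))"

definition boundary_defining_function ::
    "'a topology \<Rightarrow> ('a, 'e::euclidean_space) chart set \<Rightarrow> 'e set \<Rightarrow> 'a set \<Rightarrow> ('a \<Rightarrow> real) \<Rightarrow> bool" where
  "boundary_defining_function X \<A> B K r \<longleftrightarrow>
     smooth_function \<A> r \<and>
     (\<forall>p\<in>topspace X. 0 \<le> r p) \<and> {p \<in> topspace X. r p = 0} = K \<and>
     (\<forall>c\<in>\<A>. \<forall>p\<in>cdom c \<inter> K. \<forall>T.
        ((r \<circ> cinv c) has_derivative T) (at (cmap c p) within cmap c ` cdom c) \<longrightarrow>
        (\<exists>v\<in>span B. T v \<noteq> 0))"

section \<open>Riemannian metrics and distance\<close>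

text \<open>A metric is given by its coordinate expressions: \<open>g c p v w\<close> is the inner product at \<open>p\<close> of the
  tangent vectors with components \<open>v, w \<in> span B\<close> in the chart \<open>c\<close>. Only components in \<open>span B\<close>
  are meaningful; bilinearity on the whole ambient type is a normalisation, since a form on
  \<open>span B\<close> extends by zero in the other coordinates. On \<open>span B\<close> the derivative \<open>T\<close> of the transition map is
  unique, also at boundary points.\<close>

type_synonym ('a, 'e) metric_comp = "('a, 'e) chart \<Rightarrow> 'a \<Rightarrow> 'e \<Rightarrow> 'e \<Rightarrow> real"

definition riemannian_metric ::
    "('a, 'e::euclidean_space) chart set \<Rightarrow> 'e set \<Rightarrow> ('a, 'e) metric_comp \<Rightarrow> bool" where
  "riemannian_metric \<A> B g \<longleftrightarrow>
     (\<forall>c\<in>\<A>. \<forall>p\<in>cdom c. bilinear (g c p) \<and>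
        (\<forall>v\<in>span B. \<forall>w\<in>span B. g c p v w = g c p w v) \<and>
        (\<forall>v\<in>span B. v \<noteq> 0 \<longrightarrow> 0 < g c p v v)) \<and>
     (\<forall>c\<in>\<A>. \<forall>v\<in>span B. \<forall>w\<in>span B. smooth_on (cmap c ` cdom c) (\<lambda>x. g c (cinv c x) v w)) \<and>
     (\<forall>c\<in>\<A>. \<forall>c'\<in>\<A>. \<forall>p\<in>cdom c \<inter> cdom c'. \<forall>T.
        ((cmap c' \<circ> cinv c) has_derivative T) (at (cmap c p) within cmap c ` (cdom c \<inter> cdom c')) \<longrightarrow>
        (\<forall>v\<in>span B. \<forall>w\<in>span B. g c p v w = g c' p (T v) (T w)))"

definition conformal :: "('a \<Rightarrow> real) \<Rightarrow> ('a, 'e) metric_comp \<Rightarrow> ('a, 'e) metric_comp" where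
  "conformal f g = (\<lambda>c p v w. f p * g c p v w)"

definition product_metric ::
    "nat \<Rightarrow> (nat \<Rightarrow> 'a \<Rightarrow> real) \<Rightarrow> (nat \<Rightarrow> real) \<Rightarrow> ('a, 'e) metric_comp \<Rightarrow> ('a, 'e) metric_comp" where
  "product_metric N \<rho> \<alpha> g = conformal (\<lambda>p. \<Prod>i\<in>{1..N}. \<rho> i p powr (- \<alpha> i)) g"

definition sum_metric ::
    "nat \<Rightarrow> (nat \<Rightarrow> 'a \<Rightarrow> real) \<Rightarrow> (nat \<Rightarrow> real) \<Rightarrow> ('a, 'e) metric_comp \<Rightarrow> ('a, 'e) metric_comp" where
  "sum_metric N \<rho> \<alpha> g = conformal (\<lambda>p. \<Sum>i\<in>{1..N}. \<rho> i p powr (- \<alpha> i)) g"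

definition C1_arc :: "('a, 'e::euclidean_space) chart set \<Rightarrow> real \<Rightarrow> real \<Rightarrow> (real \<Rightarrow> 'a) \<Rightarrow> bool" where
  "C1_arc \<A> s t \<gamma> \<longleftrightarrow>
     (\<forall>c\<in>\<A>. \<exists>\<gamma>'. continuous_on {u \<in> {s..t}. \<gamma> u \<in> cdom c} \<gamma>' \<and>
        (\<forall>u\<in>{s..t}. \<gamma> u \<in> cdom c \<longrightarrow>
           ((cmap c \<circ> \<gamma>) has_vector_derivative \<gamma>' u) (at u within {s..t})))"

text \<open>Piecewise \<open>C\<^sup>1\<close> curves in \<open>M\<close>: continuous on \<open>[0,1]\<close>, and \<open>C\<^sup>1\<close> up to the end points on each interval of
  some finite subdivision \<open>F\<close>.\<close>

definition piecewise_C1_curve ::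
    "'a topology \<Rightarrow> ('a, 'e::euclidean_space) chart set \<Rightarrow> 'a set \<Rightarrow> (real \<Rightarrow> 'a) \<Rightarrow> bool" where
  "piecewise_C1_curve X \<A> M \<gamma> \<longleftrightarrow>
     continuous_map (top_of_set {0..1}) (subtopology X M) \<gamma> \<and>
     (\<exists>F. finite F \<and> {0, 1} \<subseteq> F \<and> F \<subseteq> {0..1} \<and>
        (\<forall>s\<in>F. \<forall>t\<in>F. s < t \<and> {s<..<t} \<inter> F = {} \<longrightarrow> C1_arc \<A> s t \<gamma>))"

text \<open>The speed does not depend on the chart chosen, by the transformation law of \<open>g\<close>. Its values at
  the finitely many break points (and at 0 and 1) are irrelevant for the length.\<close>

definition chart_at :: "('a, 'e) chart set \<Rightarrow> 'a \<Rightarrow> ('a, 'e) chart" where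
  "chart_at \<A> p = (SOME c. c \<in> \<A> \<and> p \<in> cdom c)"

definition speed ::
    "('a, 'e::euclidean_space) chart set \<Rightarrow> ('a, 'e) metric_comp \<Rightarrow> (real \<Rightarrow> 'a) \<Rightarrow> real \<Rightarrow> real" where
  "speed \<A> g \<gamma> t =
     (let c = chart_at \<A> (\<gamma> t); v = vector_derivative (cmap c \<circ> \<gamma>) (at t)
      in sqrt (g c (\<gamma> t) v v))"

definition curve_length ::
    "('a, 'e::euclidean_space) chart set \<Rightarrow> ('a, 'e) metric_comp \<Rightarrow> (real \<Rightarrow> 'a) \<Rightarrow> ennreal" where
  "curve_length \<A> g \<gamma> = (\<integral>\<^sup>+ t\<in>{0..1}. ennreal (speed \<A> g \<gamma> t) \<partial>lborel)"

text \<open>For open \<open>M\<close>, the distance is \<open>\<infinity>\<close> exactly between points in different connected components of \<open>M\<close>.\<close>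

definition riemannian_dist ::
    "'a topology \<Rightarrow> ('a, 'e::euclidean_space) chart set \<Rightarrow> 'a set \<Rightarrow> ('a, 'e) metric_comp \<Rightarrow>
     'a \<Rightarrow> 'a \<Rightarrow> ennreal" where
  "riemannian_dist X \<A> M g p q =
     (INF \<gamma>\<in>{\<gamma>. piecewise_C1_curve X \<A> M \<gamma> \<and> \<gamma> 0 = p \<and> \<gamma> 1 = q}. curve_length \<A> g \<gamma>)"

section \<open>Metric completion\<close>

text \<open>The completion of \<open>(M, d)\<close> by equivalence classes of Cauchy sequences. The distance may take the
  value \<open>\<infinity>\<close>; for finite \<open>d\<close> this is the usual completion.\<close>

definition cauchy_seqs :: "'a set \<Rightarrow> ('a \<Rightarrow> 'a \<Rightarrow> ennreal) \<Rightarrow> (nat \<Rightarrow> 'a) set" where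
  "cauchy_seqs M d =
     {\<sigma>. range \<sigma> \<subseteq> M \<and> (\<forall>\<epsilon>>0. \<exists>K. \<forall>m\<ge>K. \<forall>n\<ge>K. d (\<sigma> m) (\<sigma> n) < \<epsilon>)}"

definition cauchy_rel :: "'a set \<Rightarrow> ('a \<Rightarrow> 'a \<Rightarrow> ennreal) \<Rightarrow> ((nat \<Rightarrow> 'a) \<times> (nat \<Rightarrow> 'a)) set" where
  "cauchy_rel M d =
     {(\<sigma>, \<tau>). \<sigma> \<in> cauchy_seqs M d \<and> \<tau> \<in> cauchy_seqs M d \<and> (\<lambda>n. d (\<sigma> n) (\<tau> n)) \<longlonglongrightarrow> 0}"

definition completion :: "'a set \<Rightarrow> ('a \<Rightarrow> 'a \<Rightarrow> ennreal) \<Rightarrow> (nat \<Rightarrow> 'a) set set" where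
  "completion M d = cauchy_seqs M d // cauchy_rel M d"

definition completion_dist ::
    "('a \<Rightarrow> 'a \<Rightarrow> ennreal) \<Rightarrow> (nat \<Rightarrow> 'a) set \<Rightarrow> (nat \<Rightarrow> 'a) set \<Rightarrow> ennreal" where
  "completion_dist d P Q = (THE r. \<forall>\<sigma>\<in>P. \<forall>\<tau>\<in>Q. (\<lambda>n. d (\<sigma> n) (\<tau> n)) \<longlonglongrightarrow> r)"

definition completion_topology :: "'a set \<Rightarrow> ('a \<Rightarrow> 'a \<Rightarrow> ennreal) \<Rightarrow> (nat \<Rightarrow> 'a) set topology" where
  "completion_topology M d = topology (\<lambda>\<U>. \<U> \<subseteq> completion M d \<and>
     (\<forall>P\<in>\<U>. \<exists>\<epsilon>>0. \<forall>Q\<in>completion M d. completion_dist d P Q < \<epsilon> \<longrightarrow> Q \<in> \<U>))"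

lemma openin_completion_topology:
  "openin (completion_topology M d) \<U> \<longleftrightarrow> \<U> \<subseteq> completion M d \<and>
     (\<forall>P\<in>\<U>. \<exists>\<epsilon>>0. \<forall>Q\<in>completion M d. completion_dist d P Q < \<epsilon> \<longrightarrow> Q \<in> \<U>)"
proof -
  let ?L = "\<lambda>\<U>. \<U> \<subseteq> completion M d \<and>
     (\<forall>P\<in>\<U>. \<exists>\<epsilon>>0. \<forall>Q\<in>completion M d. completion_dist d P Q < \<epsilon> \<longrightarrow> Q \<in> \<U>)"
  have "istopology ?L"
    unfolding istopology_def
  proof (intro conjI allI impI)
    fix S T assume S: "?L S" and T: "?L T"
    show "S \<inter> T \<subseteq> completion M d" using S by blast
    show "\<forall>P\<in>S \<inter> T. \<exists>\<epsilon>>0. \<forall>Q\<in>completion M d. completion_dist d P Q < \<epsilon> \<longrightarrow> Q \<in> S \<inter> T"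
    proof
      fix P assume "P \<in> S \<inter> T"
      then obtain e1 e2 where "e1 > 0" "e2 > 0"
        "\<forall>Q\<in>completion M d. completion_dist d P Q < e1 \<longrightarrow> Q \<in> S"
        "\<forall>Q\<in>completion M d. completion_dist d P Q < e2 \<longrightarrow> Q \<in> T"
        using S T by blast
      then show "\<exists>\<epsilon>>0. \<forall>Q\<in>completion M d. completion_dist d P Q < \<epsilon> \<longrightarrow> Q \<in> S \<inter> T"
        by (intro exI[of _ "min e1 e2"]) auto
    qed
  next
    fix \<K> assume K: "\<forall>U\<in>\<K>. ?L U"
    show "\<Union>\<K> \<subseteq> completion M d" using K by blast
    show "\<forall>P\<in>\<Union>\<K>. \<exists>\<epsilon>>0. \<forall>Q\<in>completion M d. completion_dist d P Q < \<epsilon> \<longrightarrow> Q \<in> \<Union>\<K>"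
      using K by (meson UnionE UnionI)
  qed
  then show ?thesis
    unfolding completion_topology_def by (simp add: topology_inverse')
qed

section \<open>Accessible points\<close>

definition accessible ::
    "'a topology \<Rightarrow> ('a, 'e::euclidean_space) chart set \<Rightarrow> ('a \<Rightarrow> 'a \<Rightarrow> ennreal) \<Rightarrow> 'a \<Rightarrow> bool" where
  "accessible X \<A> d p \<longleftrightarrow> p \<in> mboundary X \<A> \<and>
     (\<exists>\<sigma>\<in>cauchy_seqs (minterior X \<A>) d. limitin X \<sigma> p sequentially)"

definition X_acc ::
    "'a topology \<Rightarrow> ('a, 'e::euclidean_space) chart set \<Rightarrow> ('a \<Rightarrow> 'a \<Rightarrow> ennreal) \<Rightarrow> 'a set" where
  "X_acc X \<A> d = minterior X \<A> \<union> {p. accessible X \<A> d p}"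

text \<open>The homeomorphism sends a completion class to the unique limit in \<open>X\<close> of
  every Cauchy sequence representing it.\<close>

definition canonically_homeomorphic ::
    "'a topology \<Rightarrow> 'a set \<Rightarrow> ('a \<Rightarrow> 'a \<Rightarrow> ennreal) \<Rightarrow> 'a set \<Rightarrow> bool" where
  "canonically_homeomorphic X M d Y \<longleftrightarrow>
     (\<exists>h. homeomorphic_map (completion_topology M d) (subtopology X Y) h \<and>
        (\<forall>P\<in>completion M d. \<forall>\<sigma>\<in>P. \<forall>q. limitin X \<sigma> q sequentially \<longleftrightarrow> q = h P))"

definition A_weight :: "nat \<Rightarrow> (nat \<Rightarrow> 'a set) \<Rightarrow> (nat \<Rightarrow> real) \<Rightarrow> 'a \<Rightarrow> real" where
  "A_weight N H \<alpha> p = (\<Sum>i\<in>hyp_index N H p. \<alpha> i)"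

definition M_weight :: "nat \<Rightarrow> (nat \<Rightarrow> 'a set) \<Rightarrow> (nat \<Rightarrow> real) \<Rightarrow> 'a \<Rightarrow> real" where
  "M_weight N H \<alpha> p = Max (\<alpha> ` hyp_index N H p)"

end

theory Submission
  imports Defs
begin

text \<open>Both metrics are conformal to \<open>g\<^sub>0\<close> with a factor \<open>f\<close> that is bounded below, so small distance
  implies closeness in \<open>X\<close>. Near a boundary point where \<open>f\<close> is at most of order \<open>t powr (-s)\<close> with
  \<open>s < 2\<close> as soon as all vanishing face coordinates are at least \<open>t\<close>, moving inwards along the
  diagonal of the faces costs \<open>\<integral> t powr (-s/2) dt < \<infinity>\<close>, so closeness in \<open>X\<close> implies small distance; here
  \<open>s\<close> is \<open>A p\<close> or \<open>M p\<close>. At the remaining boundary points some \<open>\<phi> = \<Sum>i\<in>I. \<rho> i\<close> vanishing there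
  satisfies \<open>f \<ge> const / \<phi>\<^sup>2\<close>, so \<open>ln \<phi>\<close> is Lipschitz for the distance but tends to \<open>-\<infinity>\<close>, and no Cauchy
  sequence converges there.\<close>

section \<open>Completions that embed into a compact space\<close>

text \<open>The completion is identified through local comparisons of \<open>d\<close> with the
  topology of \<open>X\<close>: compactness supplies a cluster point of each Cauchy sequence, and
  the comparison turns it into a limit. That small distance forces closeness is needed at every
  point of \<open>X\<close>, the converse only on the claimed set. Test functions that are Lipschitz
  for \<open>d\<close> give the former, explicit curves the latter. Distances take values in
  \<open>ennreal\<close>, as \<open>X\<close> may be disconnected. Speeds are computed in a chart
  picked by \<open>SOME\<close> at each time and their measurability is not established, so the
  integral estimates are inequalities valid for arbitrary integrands. Along the diagonal all
  vanishing face coordinates grow at the same rate, so that every \<open>\<rho> i\<close> with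
  \<open>p\<close> in \<open>H i\<close> is at least a multiple of the depth \<open>t\<close>. This
  separates geometry from weights: exponents add up for the product, and the largest one dominates
  for the sum. Dually, for the product \<open>I\<close> consists of all hypersurfaces through
  \<open>p\<close>, since \<open>\<rho> i \<le> \<phi>\<close> bounds all factors at once; for the
  sum one hypersurface of maximal weight is enough.\<close>

locale ext_pseudometric =
  fixes M :: "'a set" and d :: "'a \<Rightarrow> 'a \<Rightarrow> ennreal"
  assumes refl: "x \<in> M \<Longrightarrow> d x x = 0"
    and commute: "x \<in> M \<Longrightarrow> y \<in> M \<Longrightarrow> d x y = d y x"
    and triangle: "x \<in> M \<Longrightarrow> y \<in> M \<Longrightarrow> z \<in> M \<Longrightarrow> d x z \<le> d x y + d y z"
begin

lemma cauchy_seqs_mem: "\<sigma> \<in> cauchy_seqs M d \<Longrightarrow> \<sigma> n \<in> M"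
  by (auto simp: cauchy_seqs_def)

lemma cauchy_seqsD:
  "\<sigma> \<in> cauchy_seqs M d \<Longrightarrow> 0 < \<epsilon> \<Longrightarrow> \<exists>K. \<forall>m\<ge>K. \<forall>n\<ge>K. d (\<sigma> m) (\<sigma> n) < \<epsilon>"
  by (auto simp: cauchy_seqs_def)

text \<open>Values may be infinite, so there is no Cauchy argument in the reals; instead limsup
  exceeds liminf by at most any \<open>e\<close>, by the triangle inequality through both tails.
  This is what lets the \<open>THE\<close> in \<open>completion_dist\<close> denote a limit.\<close>

lemma convergent_dist:
  assumes \<sigma>: "\<sigma> \<in> cauchy_seqs M d" and \<tau>: "\<tau> \<in> cauchy_seqs M d"
  shows "\<exists>r. (\<lambda>n. d (\<sigma> n) (\<tau> n)) \<longlonglongrightarrow> r"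
proof -
  let ?a = "\<lambda>n. d (\<sigma> n) (\<tau> n)"
  have "limsup ?a \<le> liminf ?a"
  proof (rule ennreal_le_epsilon)
    fix e :: real assume e: "0 < e"
    obtain K where K: "\<forall>m\<ge>K. \<forall>n\<ge>K. d (\<sigma> m) (\<sigma> n) < ennreal (e/2)"
      using cauchy_seqsD[OF \<sigma>, of "ennreal (e/2)"] e by auto
    obtain L where L: "\<forall>m\<ge>L. \<forall>n\<ge>L. d (\<tau> m) (\<tau> n) < ennreal (e/2)"
      using cauchy_seqsD[OF \<tau>, of "ennreal (e/2)"] e by auto
    have main: "?a n \<le> ?a m + ennreal e" if "n \<ge> max K L" "m \<ge> max K L" for n m
    proof -
      have "?a n \<le> d (\<sigma> n) (\<sigma> m) + (d (\<sigma> m) (\<tau> m) + d (\<tau> m) (\<tau> n))"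
        using triangle cauchy_seqs_mem \<sigma> \<tau>
        by (meson add_left_mono order_trans)
      also have "\<dots> \<le> ennreal (e/2) + (?a m + ennreal (e/2))"
        using K L that by (intro add_mono) (auto intro: less_imp_le)
      also have "\<dots> = ?a m + (ennreal (e/2) + ennreal (e/2))" by (simp add: ac_simps)
      also have "ennreal (e/2) + ennreal (e/2) = ennreal e"
        using e by (subst ennreal_plus[symmetric]) auto
      finally show ?thesis .
    qed
    have sup: "limsup ?a \<le> ?a m + ennreal e" if "m \<ge> max K L" for m
      by (rule Limsup_bounded) (use main that in \<open>auto simp: eventually_sequentially intro!: exI[of _ "max K L"]\<close>)
    \<comment> \<open>The error is moved to the left because \<open>Liminf_bounded\<close> wants a
      constant below the sequence; the truncation of the subtraction is harmless by
      \<open>ennreal_minus_le_iff\<close>.\<close>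
    have "limsup ?a - ennreal e \<le> liminf ?a"
    proof (rule Liminf_bounded)
      show "eventually (\<lambda>n. limsup ?a - ennreal e \<le> ?a n) sequentially"
        unfolding eventually_sequentially
        using sup by (intro exI[of _ "max K L"]) (auto simp: ennreal_minus_le_iff add.commute)
    qed
    then show "limsup ?a \<le> liminf ?a + ennreal e"
      by (simp add: ennreal_minus_le_iff add.commute)
  qed
  then have "liminf ?a = limsup ?a"
    by (simp add: Liminf_le_Limsup order_antisym)
  then show ?thesis
    by (metis tendsto_iff_Liminf_eq_Limsup sequentially_bot)
qed

text \<open>Quadrangle inequality in both directions. Apart from independence of representatives it
  yields transitivity of \<open>cauchy_rel\<close>, by replacing only the second sequence.\<close>

lemma tendsto_dist_equiv:
  assumes "(\<sigma>, \<sigma>') \<in> cauchy_rel M d" "(\<tau>, \<tau>') \<in> cauchy_rel M d"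
    and lim: "(\<lambda>n. d (\<sigma> n) (\<tau> n)) \<longlonglongrightarrow> r"
  shows "(\<lambda>n. d (\<sigma>' n) (\<tau>' n)) \<longlonglongrightarrow> r"
proof -
  have mem: "\<sigma> \<in> cauchy_seqs M d" "\<sigma>' \<in> cauchy_seqs M d" "\<tau> \<in> cauchy_seqs M d" "\<tau>' \<in> cauchy_seqs M d"
    and 0: "(\<lambda>n. d (\<sigma> n) (\<sigma>' n)) \<longlonglongrightarrow> 0" "(\<lambda>n. d (\<tau> n) (\<tau>' n)) \<longlonglongrightarrow> 0"
    using assms by (auto simp: cauchy_rel_def)
  note M = mem[THEN cauchy_seqs_mem]
  obtain r' where r': "(\<lambda>n. d (\<sigma>' n) (\<tau>' n)) \<longlonglongrightarrow> r'"
    using convergent_dist mem by blast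
  have quad: "d x w \<le> d y x + d y z + d z w" if "x \<in> M" "y \<in> M" "z \<in> M" "w \<in> M" for x y z w
  proof -
    have "d x w \<le> d x z + d z w" using triangle that by blast
    also have "d x z \<le> d y x + d y z" using triangle[of x y z] commute[of x y] that by simp
    finally show ?thesis by (simp add: add_right_mono)
  qed
  have le: "d (\<sigma>' n) (\<tau>' n) \<le> d (\<sigma> n) (\<sigma>' n) + d (\<sigma> n) (\<tau> n) + d (\<tau> n) (\<tau>' n)" for n
    using quad M by blast
  have le': "d (\<sigma> n) (\<tau> n) \<le> d (\<sigma> n) (\<sigma>' n) + d (\<sigma>' n) (\<tau>' n) + d (\<tau> n) (\<tau>' n)" for n
    using quad[of "\<sigma> n" "\<sigma>' n" "\<tau>' n" "\<tau> n"] commute M by (metis (no_types))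
  have "(\<lambda>n. d (\<sigma> n) (\<sigma>' n) + d (\<sigma> n) (\<tau> n) + d (\<tau> n) (\<tau>' n)) \<longlonglongrightarrow> 0 + r + 0"
    by (intro tendsto_add 0 lim)
  then have "r' \<le> r"
    using LIMSEQ_le[OF r'] le by simp
  moreover have "(\<lambda>n. d (\<sigma> n) (\<sigma>' n) + d (\<sigma>' n) (\<tau>' n) + d (\<tau> n) (\<tau>' n)) \<longlonglongrightarrow> 0 + r' + 0"
    by (intro tendsto_add 0 r')
  then have "r \<le> r'"
    using LIMSEQ_le[OF lim] le' by simp
  ultimately show ?thesis using r' by simp
qed

lemma equiv_cauchy_rel: "equiv (cauchy_seqs M d) (cauchy_rel M d)"
proof (rule equivI)
  show "cauchy_rel M d \<subseteq> cauchy_seqs M d \<times> cauchy_seqs M d"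
    by (auto simp: cauchy_rel_def)
  show refl': "refl_on (cauchy_seqs M d) (cauchy_rel M d)"
    by (auto simp: refl_on_def cauchy_rel_def refl cauchy_seqs_mem)
  show "sym (cauchy_rel M d)"
    by (auto simp: sym_def cauchy_rel_def commute cauchy_seqs_mem)
  show "trans (cauchy_rel M d)"
  proof (rule transI)
    fix \<sigma> \<tau> \<upsilon> assume *: "(\<sigma>, \<tau>) \<in> cauchy_rel M d" "(\<tau>, \<upsilon>) \<in> cauchy_rel M d"
    then have "(\<sigma>, \<sigma>) \<in> cauchy_rel M d"
      using refl' by (auto simp: refl_on_def cauchy_rel_def)
    from tendsto_dist_equiv[OF this *(2)] * show "(\<sigma>, \<upsilon>) \<in> cauchy_rel M d"
      by (auto simp: cauchy_rel_def)
  qed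
qed

lemma completion_nonempty: "P \<in> completion M d \<Longrightarrow> \<exists>\<sigma>. \<sigma> \<in> P \<and> \<sigma> \<in> cauchy_seqs M d"
  unfolding completion_def
  using equiv_cauchy_rel by (metis equiv_Eps_in in_quotient_imp_subset subsetD)

lemma completion_subset: "P \<in> completion M d \<Longrightarrow> \<sigma> \<in> P \<Longrightarrow> \<sigma> \<in> cauchy_seqs M d"
  unfolding completion_def using equiv_cauchy_rel by (metis in_quotient_imp_subset subsetD)

lemma completion_rel:
  "P \<in> completion M d \<Longrightarrow> \<sigma> \<in> P \<Longrightarrow> \<tau> \<in> P \<Longrightarrow> (\<sigma>, \<tau>) \<in> cauchy_rel M d"
  unfolding completion_def using equiv_cauchy_rel quotient_eq_iff by fastforce

lemma completion_eqI:
  "P \<in> completion M d \<Longrightarrow> Q \<in> completion M d \<Longrightarrow> \<sigma> \<in> P \<Longrightarrow> \<tau> \<in> Q \<Longrightarrow> (\<sigma>, \<tau>) \<in> cauchy_rel M d \<Longrightarrow> P = Q"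
  unfolding completion_def using equiv_cauchy_rel quotient_eqI by metis

lemma completion_ex: "\<sigma> \<in> cauchy_seqs M d \<Longrightarrow> \<exists>P\<in>completion M d. \<sigma> \<in> P"
  unfolding completion_def using equiv_cauchy_rel
  by (metis equiv_class_self quotientI)

lemma completion_dist_tendsto:
  assumes P: "P \<in> completion M d" and Q: "Q \<in> completion M d" and \<sigma>: "\<sigma> \<in> P" and \<tau>: "\<tau> \<in> Q"
  shows "(\<lambda>n. d (\<sigma> n) (\<tau> n)) \<longlonglongrightarrow> completion_dist d P Q"
proof -
  obtain r where r: "(\<lambda>n. d (\<sigma> n) (\<tau> n)) \<longlonglongrightarrow> r"
    using convergent_dist completion_subset assms by meson
  have all: "\<forall>\<sigma>\<in>P. \<forall>\<tau>\<in>Q. (\<lambda>n. d (\<sigma> n) (\<tau> n)) \<longlonglongrightarrow> r"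
    using tendsto_dist_equiv[OF _ _ r] completion_rel assms by blast
  have "completion_dist d P Q = r"
    unfolding completion_dist_def
    by (rule the_equality) (use all \<sigma> \<tau> r LIMSEQ_unique in blast)+
  then show ?thesis using r by simp
qed

end

text \<open>If every point had a neighbourhood that the sequence eventually avoids, finitely many of
  these would cover the space. A cluster point is enough here: for a Cauchy sequence the condition
  \<open>finer\<close> below promotes it to a limit.\<close>

lemma compact_space_cluster_point:
  assumes "compact_space X" and \<sigma>: "range \<sigma> \<subseteq> topspace X"
  shows "\<exists>p\<in>topspace X. \<forall>U. openin X U \<and> p \<in> U \<longrightarrow> (\<forall>K::nat. \<exists>n\<ge>K. \<sigma> n \<in> U)"
proof (rule ccontr)
  assume neg: "\<not> ?thesis"
  define good where "good p U \<longleftrightarrow> openin X U \<and> p \<in> U \<and> (\<exists>K. \<forall>n\<ge>K. \<sigma> n \<notin> U)" for p U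
  have "\<exists>U. good p U" if "p \<in> topspace X" for p
  proof (rule ccontr)
    assume "\<nexists>U. good p U"
    then have "\<forall>U. openin X U \<and> p \<in> U \<longrightarrow> (\<forall>K. \<exists>n\<ge>K. \<sigma> n \<in> U)"
      by (auto simp: good_def)
    then show False by (rule notE[OF neg bexI[OF _ that]])
  qed
  then obtain U where "\<And>p. p \<in> topspace X \<Longrightarrow> good p (U p)" by metis
  then have U: "openin X (U p)" "p \<in> U p" "\<exists>K. \<forall>n\<ge>K. \<sigma> n \<notin> U p" if "p \<in> topspace X" for p
    using that unfolding good_def by blast+
  have "\<forall>V\<in>U ` topspace X. openin X V" "topspace X \<subseteq> \<Union> (U ` topspace X)"
    using U by auto
  then obtain \<F> where \<F>: "finite \<F>" "\<F> \<subseteq> U ` topspace X" "topspace X \<subseteq> \<Union>\<F>"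
    using assms(1) unfolding compact_space_alt by metis
  have "\<forall>V\<in>\<F>. eventually (\<lambda>n. \<sigma> n \<notin> V) sequentially"
    using U \<F>(2) unfolding eventually_sequentially by blast
  then have "eventually (\<lambda>n. \<forall>V\<in>\<F>. \<sigma> n \<notin> V) sequentially"
    using \<F>(1) by (simp add: eventually_ball_finite)
  then obtain n where "\<forall>V\<in>\<F>. \<sigma> n \<notin> V"
    unfolding eventually_sequentially by blast
  then show False using \<F>(3) \<sigma> by blast
qed

text \<open>\<open>finer\<close> says that \<open>d\<close> controls the topology,
  \<open>coarser\<close> that the topology controls \<open>d\<close>. Both use an auxiliary
  neighbourhood \<open>V\<close>, since \<open>p\<close> need not lie in \<open>M\<close>, where
  \<open>d\<close> obeys its axioms. \<open>finer\<close> is required on all of \<open>X\<close>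
  because the limit of a Cauchy sequence is not known in advance to lie in \<open>Y\<close>.\<close>

locale limit_completion = ext_pseudometric M d for M :: "'a set" and d +
  fixes X :: "'a topology" and Y :: "'a set"
  assumes X: "compact_space X" "Hausdorff_space X" and M: "M \<subseteq> Y" and Y: "Y \<subseteq> topspace X"
    and finer: "p \<in> topspace X \<Longrightarrow> openin X W \<Longrightarrow> p \<in> W \<Longrightarrow>
      \<exists>\<epsilon>>0. \<exists>V. openin X V \<and> p \<in> V \<and> (\<forall>x\<in>V \<inter> M. \<forall>y\<in>M. d x y < \<epsilon> \<longrightarrow> y \<in> W)"
    and coarser: "p \<in> Y \<Longrightarrow> 0 < \<epsilon> \<Longrightarrow> \<exists>V. openin X V \<and> p \<in> V \<and> (\<forall>x\<in>V \<inter> M. \<forall>y\<in>V \<inter> M. d x y < \<epsilon>)"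
    and limits_in_Y: "\<sigma> \<in> cauchy_seqs M d \<Longrightarrow> limitin X \<sigma> p sequentially \<Longrightarrow> p \<in> Y"
    and dense: "p \<in> Y \<Longrightarrow> \<exists>\<sigma>. range \<sigma> \<subseteq> M \<and> limitin X \<sigma> p sequentially"
begin

lemma cauchy_converges:
  assumes \<sigma>: "\<sigma> \<in> cauchy_seqs M d"
  shows "\<exists>p\<in>Y. limitin X \<sigma> p sequentially"
proof -
  have "range \<sigma> \<subseteq> topspace X" using \<sigma> M Y by (auto simp: cauchy_seqs_def)
  from compact_space_cluster_point[OF X(1) this] obtain p where p: "p \<in> topspace X"
    and cl: "\<And>U K. openin X U \<Longrightarrow> p \<in> U \<Longrightarrow> \<exists>n\<ge>K. \<sigma> n \<in> U" by blast
  have "limitin X \<sigma> p sequentially"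
    unfolding limitin_sequentially
  proof (intro conjI p allI impI)
    fix W assume "openin X W \<and> p \<in> W"
    then obtain \<epsilon> V where V: "\<epsilon> > 0" "openin X V" "p \<in> V"
      and dW: "\<And>x y. x \<in> V \<Longrightarrow> x \<in> M \<Longrightarrow> y \<in> M \<Longrightarrow> d x y < \<epsilon> \<Longrightarrow> y \<in> W"
      using finer[OF p, of W] by blast
    obtain K where K: "\<forall>m\<ge>K. \<forall>n\<ge>K. d (\<sigma> m) (\<sigma> n) < \<epsilon>"
      using cauchy_seqsD[OF \<sigma> V(1)] by blast
    obtain m where "m \<ge> K" "\<sigma> m \<in> V" using cl[OF V(2,3)] by blast
    then show "\<exists>K. \<forall>n\<ge>K. \<sigma> n \<in> W"
      using K dW cauchy_seqs_mem[OF \<sigma>] by (intro exI[of _ K]) blast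
  qed
  then show ?thesis using limits_in_Y[OF \<sigma>] by blast
qed

lemma cauchy_rel_limit:
  assumes r: "(\<sigma>, \<tau>) \<in> cauchy_rel M d" and p: "limitin X \<sigma> p sequentially"
  shows "limitin X \<tau> p sequentially"
  unfolding limitin_sequentially
proof (intro conjI allI impI)
  show pX: "p \<in> topspace X" using p by (simp add: limitin_def)
  have mem: "\<sigma> n \<in> M" "\<tau> n \<in> M" for n
    using r cauchy_seqs_mem by (auto simp: cauchy_rel_def)
  fix W assume "openin X W \<and> p \<in> W"
  then obtain \<epsilon> V where V: "\<epsilon> > 0" "openin X V" "p \<in> V"
    and dW: "\<And>x y. x \<in> V \<Longrightarrow> x \<in> M \<Longrightarrow> y \<in> M \<Longrightarrow> d x y < \<epsilon> \<Longrightarrow> y \<in> W"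
    using finer[OF pX, of W] by blast
  have "eventually (\<lambda>n. \<sigma> n \<in> V) sequentially"
    using p V by (simp add: limitin_def)
  moreover have "eventually (\<lambda>n. d (\<sigma> n) (\<tau> n) < \<epsilon>) sequentially"
    using r V(1) by (auto simp: cauchy_rel_def intro: order_tendstoD)
  ultimately have "eventually (\<lambda>n. \<tau> n \<in> W) sequentially"
    by eventually_elim (use dW mem in blast)
  then show "\<exists>K. \<forall>n\<ge>K. \<tau> n \<in> W" by (simp add: eventually_sequentially)
qed

text \<open>With both sequences equal this says that a sequence in \<open>M\<close> converging to a
  point of \<open>Y\<close> is Cauchy, which is how completion points and accessible points are
  produced.\<close>

lemma limit_cauchy_rel:
  assumes "range \<sigma> \<subseteq> M" "range \<tau> \<subseteq> M" "limitin X \<sigma> p sequentially" "limitin X \<tau> p sequentially" "p \<in> Y"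
  shows "(\<sigma>, \<tau>) \<in> cauchy_rel M d"
proof -
  \<comment> \<open>Independent indices let one estimate serve twice: with equal sequences for the
    Cauchy property, and with \<open>m = n\<close> for the mutual distance.\<close>
  have *: "\<exists>K. \<forall>m\<ge>K. \<forall>n\<ge>K. d (\<sigma>' m) (\<tau>' n) < \<epsilon>"
    if "range \<sigma>' \<subseteq> M" "range \<tau>' \<subseteq> M" and \<sigma>': "limitin X \<sigma>' p sequentially" "limitin X \<tau>' p sequentially" and "\<epsilon> > 0"
    for \<sigma>' \<tau>' \<epsilon>
  proof -
    obtain V where V: "openin X V" "p \<in> V" "\<forall>x\<in>V \<inter> M. \<forall>y\<in>V \<inter> M. d x y < \<epsilon>"
      using coarser[OF \<open>p \<in> Y\<close> \<open>\<epsilon> > 0\<close>] by blast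
    obtain K L where "\<forall>n\<ge>K. \<sigma>' n \<in> V" "\<forall>n\<ge>L. \<tau>' n \<in> V"
      using V \<sigma>' unfolding limitin_sequentially by metis
    then have "\<forall>m\<ge>max K L. \<forall>n\<ge>max K L. d (\<sigma>' m) (\<tau>' n) < \<epsilon>"
      using V(3) that(1,2) by (simp add: image_subset_iff)
    then show ?thesis by blast
  qed
  have "\<sigma> \<in> cauchy_seqs M d" "\<tau> \<in> cauchy_seqs M d"
    using * assms by (auto simp: cauchy_seqs_def)
  moreover have "(\<lambda>n. d (\<sigma> n) (\<tau> n)) \<longlonglongrightarrow> 0"
    using *[OF assms(1,2,3,4)] by (intro order_tendstoI) (auto simp: eventually_sequentially, metis order.refl)
  ultimately show ?thesis by (simp add: cauchy_rel_def)
qed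

section \<open>The limit map on the completion\<close>

definition lim_of :: "(nat \<Rightarrow> 'a) set \<Rightarrow> 'a" where
  "lim_of P = (THE p. \<forall>\<sigma>\<in>P. limitin X \<sigma> p sequentially)"

lemma limitin_lim_of:
  assumes P: "P \<in> completion M d" and \<sigma>: "\<sigma> \<in> P"
  shows "limitin X \<sigma> q sequentially \<longleftrightarrow> q = lim_of P" and "lim_of P \<in> Y"
proof -
  obtain p where p: "p \<in> Y" "limitin X \<sigma> p sequentially"
    using cauchy_converges completion_subset[OF P \<sigma>] by blast
  have all: "\<forall>\<tau>\<in>P. limitin X \<tau> p sequentially"
    using cauchy_rel_limit[OF completion_rel[OF P \<sigma>] p(2)] by blast
  have uniq: "q = p" if "limitin X \<sigma> q sequentially" for q
    using limitin_Hausdorff_unique[OF that p(2) _ X(2)] by simp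
  have "lim_of P = p"
    unfolding lim_of_def by (rule the_equality) (use all \<sigma> uniq in blast)+
  then show "limitin X \<sigma> q sequentially \<longleftrightarrow> q = lim_of P" "lim_of P \<in> Y"
    using p uniq[of q] by metis+
qed

lemma eventually_near_lim_of:
  "P \<in> completion M d \<Longrightarrow> \<sigma> \<in> P \<Longrightarrow> openin X V \<Longrightarrow> lim_of P \<in> V \<Longrightarrow> eventually (\<lambda>n. \<sigma> n \<in> V) sequentially"
  using limitin_lim_of(1)[of P \<sigma> "lim_of P"] by (simp add: limitin_def)

lemma topspace_completion_topology: "topspace (completion_topology M d) = completion M d"
proof -
  have "openin (completion_topology M d) (completion M d)"
    unfolding openin_completion_topology using zero_less_one by blast
  then show ?thesis
    unfolding topspace_def openin_completion_topology by blast
qed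

lemma inj_on_lim_of: "inj_on lim_of (completion M d)"
proof (rule inj_onI)
  fix P Q assume PQ: "P \<in> completion M d" "Q \<in> completion M d" "lim_of P = lim_of Q"
  obtain \<sigma> \<tau> where s: "\<sigma> \<in> P" "\<tau> \<in> Q" using completion_nonempty PQ by blast
  have "(\<sigma>, \<tau>) \<in> cauchy_rel M d"
    by (rule limit_cauchy_rel[of _ _ "lim_of P"])
      (use s PQ limitin_lim_of completion_subset cauchy_seqs_mem in blast)+
  then show "P = Q" using completion_eqI PQ s by blast
qed

lemma completion_at:
  assumes p: "p \<in> Y" shows "\<exists>P\<in>completion M d. lim_of P = p"
proof -
  obtain \<sigma> where \<sigma>: "range \<sigma> \<subseteq> M" "limitin X \<sigma> p sequentially" using dense p by blast
  then have "\<sigma> \<in> cauchy_seqs M d"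
    using limit_cauchy_rel p by (auto simp: cauchy_rel_def)
  then obtain P where "P \<in> completion M d" "\<sigma> \<in> P" using completion_ex by blast
  then show ?thesis using limitin_lim_of \<sigma> by metis
qed

lemma continuous_lim_of: "continuous_map (completion_topology M d) (subtopology X Y) lim_of"
  unfolding continuous_map_in_subtopology
proof
  show "lim_of \<in> topspace (completion_topology M d) \<rightarrow> Y"
    unfolding topspace_completion_topology using completion_nonempty limitin_lim_of(2) by blast
  show "continuous_map (completion_topology M d) X lim_of"
    unfolding continuous_map topspace_completion_topology
  proof (intro conjI allI impI)
    show "lim_of ` completion M d \<subseteq> topspace X"
      using completion_nonempty limitin_lim_of(2) Y by blast
    fix W assume W: "openin X W"
    show "openin (completion_topology M d) {P \<in> completion M d. lim_of P \<in> W}"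
      unfolding openin_completion_topology
    proof (intro conjI ballI)
      fix P assume "P \<in> {P \<in> completion M d. lim_of P \<in> W}"
      then have P: "P \<in> completion M d" "lim_of P \<in> W" by auto
      obtain \<sigma> where \<sigma>: "\<sigma> \<in> P" using completion_nonempty P by blast
      \<comment> \<open>Eventual membership in an open set passes to the limit only up to closure,
        so a closed neighbourhood is inserted between \<open>W'\<close> and \<open>W\<close>;
        compact Hausdorff spaces are regular.\<close>
      have "neighbourhood_base_of (closedin X) X"
        using X compact_Hausdorff_imp_regular_space neighbourhood_base_of_closedin by blast
      then obtain W' C where W': "openin X W'" "closedin X C" "lim_of P \<in> W'" "W' \<subseteq> C" "C \<subseteq> W"
        unfolding neighbourhood_base_of using W P(2) by meson
      obtain \<epsilon> V where V: "\<epsilon> > 0" "openin X V" "lim_of P \<in> V"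
        and dW: "\<And>x y. x \<in> V \<Longrightarrow> x \<in> M \<Longrightarrow> y \<in> M \<Longrightarrow> d x y < \<epsilon> \<Longrightarrow> y \<in> W'"
        using finer[OF subsetD[OF openin_subset[OF W'(1)] W'(3)] W'(1,3)] by blast
      have "lim_of Q \<in> W" if Q: "Q \<in> completion M d" "completion_dist d P Q < \<epsilon>" for Q
      proof -
        obtain \<tau> where \<tau>: "\<tau> \<in> Q" using completion_nonempty Q by blast
        have "eventually (\<lambda>n. d (\<sigma> n) (\<tau> n) < \<epsilon>) sequentially"
          using completion_dist_tendsto[OF P(1) Q(1) \<sigma> \<tau>] Q(2) by (rule order_tendstoD)
        moreover have "eventually (\<lambda>n. \<sigma> n \<in> V) sequentially"
          using eventually_near_lim_of[OF P(1) \<sigma>] V by blast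
        ultimately have "eventually (\<lambda>n. \<tau> n \<in> W') sequentially"
          by eventually_elim
            (use dW completion_subset[OF P(1) \<sigma>] completion_subset[OF Q(1) \<tau>] cauchy_seqs_mem in blast)
        then have "eventually (\<lambda>n. \<tau> n \<in> C) sequentially"
          by eventually_elim (use W' in blast)
        then have "lim_of Q \<in> C"
          using limitin_closedin[of X \<tau> "lim_of Q" sequentially C] limitin_lim_of(1)[OF Q(1) \<tau>, of "lim_of Q"] W' by simp
        then show ?thesis using W' by blast
      qed
      then show "\<exists>\<epsilon>>0. \<forall>Q\<in>completion M d. completion_dist d P Q < \<epsilon> \<longrightarrow> Q \<in> {P \<in> completion M d. lim_of P \<in> W}"
        using V(1) by blast
    qed auto
  qed
qed

lemma open_lim_of: "open_map (completion_topology M d) (subtopology X Y) lim_of"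
  unfolding open_map_def
proof (intro allI impI)
  fix U assume "openin (completion_topology M d) U"
  then have U: "U \<subseteq> completion M d"
    "\<And>P. P \<in> U \<Longrightarrow> \<exists>\<epsilon>>0. \<forall>Q\<in>completion M d. completion_dist d P Q < \<epsilon> \<longrightarrow> Q \<in> U"
    unfolding openin_completion_topology by auto
  have "\<exists>T. openin (subtopology X Y) T \<and> lim_of P \<in> T \<and> T \<subseteq> lim_of ` U" if P: "P \<in> U" for P
  proof -
    have PM: "P \<in> completion M d" using P U by blast
    obtain \<epsilon> where \<epsilon>: "\<epsilon> > 0" "\<forall>Q\<in>completion M d. completion_dist d P Q < \<epsilon> \<longrightarrow> Q \<in> U"
      using U(2)[OF P] by blast
    \<comment> \<open>A strict bound on the terms weakens to a non-strict one in the limit, hence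
      the smaller radius.\<close>
    obtain \<epsilon>' where \<epsilon>': "0 < \<epsilon>'" "\<epsilon>' < \<epsilon>" using dense_order_class.dense \<epsilon>(1) by blast
    obtain \<sigma> where \<sigma>: "\<sigma> \<in> P" using completion_nonempty PM by blast
    have lP: "lim_of P \<in> Y" using limitin_lim_of PM \<sigma> by blast
    obtain V where V: "openin X V" "lim_of P \<in> V"
      and dV: "\<And>x y. x \<in> V \<Longrightarrow> x \<in> M \<Longrightarrow> y \<in> V \<Longrightarrow> y \<in> M \<Longrightarrow> d x y < \<epsilon>'"
      using coarser[OF lP \<epsilon>'(1)] by blast
    have "q \<in> lim_of ` U" if q: "q \<in> V" "q \<in> Y" for q
    proof -
      obtain Q where Q: "Q \<in> completion M d" "lim_of Q = q" using completion_at q by blast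
      obtain \<tau> where \<tau>: "\<tau> \<in> Q" using completion_nonempty Q by blast
      have "eventually (\<lambda>n. \<tau> n \<in> V) sequentially" "eventually (\<lambda>n. \<sigma> n \<in> V) sequentially"
        using eventually_near_lim_of[OF Q(1) \<tau>] Q(2) eventually_near_lim_of[OF PM \<sigma>] V q by auto
      then have "eventually (\<lambda>n. d (\<sigma> n) (\<tau> n) \<le> \<epsilon>') sequentially"
        by eventually_elim
          (use dV completion_subset[OF PM \<sigma>] completion_subset[OF Q(1) \<tau>] cauchy_seqs_mem less_imp_le in blast)
      then have "completion_dist d P Q \<le> \<epsilon>'"
        using completion_dist_tendsto[OF PM Q(1) \<sigma> \<tau>] tendsto_upperbound by (metis sequentially_bot)
      then show ?thesis using \<epsilon>' \<epsilon>(2) Q by auto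
    qed
    then show ?thesis
      using V lP by (intro exI[of _ "V \<inter> Y"]) (auto simp: openin_subtopology)
  qed
  then show "openin (subtopology X Y) (lim_of ` U)"
    by (subst openin_subopen) blast
qed

theorem canonically_homeomorphic: "canonically_homeomorphic X M d Y"
  unfolding canonically_homeomorphic_def
proof (intro exI conjI ballI allI)
  show "homeomorphic_map (completion_topology M d) (subtopology X Y) lim_of"
  proof (rule bijective_open_imp_homeomorphic_map)
    have "lim_of P \<in> Y" if "P \<in> completion M d" for P
      using that completion_nonempty limitin_lim_of(2) by blast
    then have "lim_of ` completion M d = Y"
      using completion_at by blast
    then show "lim_of ` topspace (completion_topology M d) = topspace (subtopology X Y)"
      using Y by (simp add: topspace_completion_topology Int_absorb1)
    show "inj_on lim_of (topspace (completion_topology M d))"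
      by (simp add: topspace_completion_topology inj_on_lim_of)
  qed (rule continuous_lim_of open_lim_of)+
next
  fix P \<sigma> q assume "P \<in> completion M d" "\<sigma> \<in> P"
  then show "limitin X \<sigma> q sequentially \<longleftrightarrow> q = lim_of P"
    by (rule limitin_lim_of(1))
qed

end

section \<open>The Riemannian distance as an extended pseudometric\<close>

text \<open>The integrand need not be measurable, so the substitution rule is not applicable to it.
  One inequality survives: \<open>nn_integral\<close> is a supremum over simple functions below the
  integrand, and each of these can be transported by the affine map.\<close>

lemma nn_integral_affine_le:
  fixes f :: "real \<Rightarrow> ennreal"
  assumes c: "c \<noteq> 0"
  shows "(\<integral>\<^sup>+x. ennreal \<bar>c\<bar> * f (t + c * x) \<partial>lborel) \<le> (\<integral>\<^sup>+x. f x \<partial>lborel)"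
proof -
  have "integral\<^sup>S lborel g \<le> integral\<^sup>N lborel f"
    if g: "simple_function lborel g" and le: "g \<le> (\<lambda>x. ennreal \<bar>c\<bar> * f (t + c * x))" for g
  proof -
    have meas [measurable]: "g \<in> borel_measurable borel"
      using borel_measurable_simple_function[OF g] by simp
    \<comment> \<open>The transported function: it lies below \<open>f\<close> and has the same
      integral as \<open>g\<close>.\<close>
    define k where "k y = ennreal (1 / \<bar>c\<bar>) * g ((y - t) / c)" for y
    have [measurable]: "k \<in> borel_measurable borel" unfolding k_def by measurable
    have cc: "ennreal (1 / \<bar>c\<bar>) * ennreal \<bar>c\<bar> = 1"
      using c by (simp flip: ennreal_mult)
    have "k y \<le> f y" for y
    proof -
      have "k y \<le> ennreal (1 / \<bar>c\<bar>) * (ennreal \<bar>c\<bar> * f (t + c * ((y - t) / c)))"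
        unfolding k_def using le_funD[OF le, of "(y - t) / c"] by (rule mult_left_mono) simp
      also have "\<dots> = f y" using c cc by (simp flip: mult.assoc)
      finally show ?thesis .
    qed
    moreover have "integral\<^sup>S lborel g = integral\<^sup>N lborel k"
    proof -
      have "integral\<^sup>N lborel k = \<bar>c\<bar> * (\<integral>\<^sup>+x. ennreal (1 / \<bar>c\<bar>) * g x \<partial>lborel)"
        using c by (subst nn_integral_real_affine[of _ c t]) (auto simp: k_def)
      also have "\<dots> = ennreal \<bar>c\<bar> * (ennreal (1 / \<bar>c\<bar>) * integral\<^sup>N lborel g)"
        by (simp add: nn_integral_cmult)
      also have "\<dots> = integral\<^sup>N lborel g"
        using cc by (simp add: mult.commute flip: mult.assoc)
      finally show ?thesis using nn_integral_eq_simple_integral[OF g] by simp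
    qed
    ultimately show ?thesis by (auto intro: nn_integral_mono)
  qed
  then show ?thesis
    by (subst nn_integral_def) (auto intro: SUP_least)
qed

text \<open>Again \<open>f\<close> may be non-measurable: a simple function below the integrand is
  at most the sum of its restrictions to \<open>A\<close> and \<open>C\<close>, which may
  overlap.\<close>

lemma nn_integral_Un_le:
  assumes [measurable]: "A \<in> sets M" "C \<in> sets M"
  shows "(\<integral>\<^sup>+x\<in>A \<union> C. f x \<partial>M) \<le> (\<integral>\<^sup>+x\<in>A. f x \<partial>M) + (\<integral>\<^sup>+x\<in>C. f x \<partial>M)"
proof -
  have "integral\<^sup>S M g \<le> (\<integral>\<^sup>+x\<in>A. f x \<partial>M) + (\<integral>\<^sup>+x\<in>C. f x \<partial>M)"
    if g: "simple_function M g" and le: "g \<le> (\<lambda>x. f x * indicator (A \<union> C) x)" for g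
  proof -
    have [measurable]: "g \<in> borel_measurable M" using borel_measurable_simple_function[OF g] .
    have gx: "g x \<le> f x * indicator (A \<union> C) x" for x
      using le by (simp add: le_fun_def)
    have "integral\<^sup>S M g = integral\<^sup>N M g" using nn_integral_eq_simple_integral[OF g] by simp
    also have "\<dots> \<le> (\<integral>\<^sup>+x. g x * indicator A x + g x * indicator C x \<partial>M)"
    proof (rule nn_integral_mono)
      fix x show "g x \<le> g x * indicator A x + g x * indicator C x"
        using gx[of x] by (auto simp: indicator_def split: if_splits)
    qed
    also have "\<dots> = (\<integral>\<^sup>+x\<in>A. g x \<partial>M) + (\<integral>\<^sup>+x\<in>C. g x \<partial>M)"
      by (rule nn_integral_add) auto
    also have "\<dots> \<le> (\<integral>\<^sup>+x\<in>A. f x \<partial>M) + (\<integral>\<^sup>+x\<in>C. f x \<partial>M)"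
    proof (intro add_mono nn_integral_mono)
      fix x
      show "g x * indicator A x \<le> f x * indicator A x" "g x * indicator C x \<le> f x * indicator C x"
        using gx[of x] by (auto simp: indicator_def)
    qed
    finally show ?thesis .
  qed
  then show ?thesis
    by (subst nn_integral_def) (auto intro: SUP_least)
qed

lemma has_vector_derivative_compose_frechet:
  assumes f: "(f has_vector_derivative v) (at t within S)" and F: "(F has_derivative T) (at (f t))"
  shows "((F \<circ> f) has_vector_derivative T v) (at t within S)"
proof -
  have "((\<lambda>x. F (f x)) has_derivative (\<lambda>h. T (h *\<^sub>R v))) (at t within S)"
    by (rule has_derivative_compose[OF f[unfolded has_vector_derivative_def] F])
  moreover have "T (h *\<^sub>R v) = h *\<^sub>R T v" for h
    using has_derivative_linear[OF F] by (rule linear_scale)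
  ultimately show ?thesis by (simp add: has_vector_derivative_def comp_def)
qed

lemma has_vector_derivative_transform_eventually:
  assumes "(f has_vector_derivative v) (at t within S)" "eventually (\<lambda>s. f s = g s) (nhds t)" "t \<in> S"
  shows "(g has_vector_derivative v) (at t within S)"
  unfolding has_vector_derivative_def
proof (rule has_derivative_transform_eventually)
  show "f t = g t" using assms(2) by (rule eventually_nhds_x_imp_x)
  show "eventually (\<lambda>s. f s = g s) (at t within S)"
    using assms(2) by (auto simp: eventually_at_filter elim: eventually_mono)
qed (use assms in \<open>auto simp: has_vector_derivative_def\<close>)

section \<open>Charts of a manifold with corners\<close>

locale corner_manifold =
  fixes X :: "'a topology" and \<A> :: "('a, 'e::euclidean_space) chart set" and B :: "'e set"
  assumes mwc: "manifold_with_corners X \<A> B"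
begin

lemma
  shows Hausdorff: "Hausdorff_space X" and B_Basis: "B \<subseteq> Basis"
    and charts_cover: "p \<in> topspace X \<Longrightarrow> \<exists>c\<in>\<A>. p \<in> cdom c"
  using mwc by (auto simp: manifold_with_corners_def)

lemma finite_B: "finite B" using B_Basis finite_Basis finite_subset by blast

lemma span_B: "span B = {x. \<forall>i\<in>Basis. i \<notin> B \<longrightarrow> x \<bullet> i = 0}"
  by (rule span_substd_basis[OF B_Basis])

lemma closed_corner: "closed (corner B S)"
proof -
  have "corner B S = span B \<inter> (\<Inter>b\<in>S. {x. 0 \<le> x \<bullet> b})"
    by (auto simp: corner_def)
  then show ?thesis
    by (simp add: closed_Int closed_INT closed_halfspace_component_ge closed_span closed_Collect_le continuous_intros)
qed

context
  fixes c assumes c: "c \<in> \<A>"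
begin

lemma chart: "corner_chart X B c" using mwc c by (simp add: manifold_with_corners_def)

lemma open_cdom: "openin X (cdom c)" and faces_B: "cfaces c \<subseteq> B"
  and open_image: "openin (top_of_set (corner B (cfaces c))) (cmap c ` cdom c)"
  and homeo: "homeomorphic_map (subtopology X (cdom c)) (top_of_set (cmap c ` cdom c)) (cmap c)"
  using chart by (auto simp: corner_chart_def)

lemma cdom_sub: "cdom c \<subseteq> topspace X" using open_cdom by (rule openin_subset)

lemma inj_cmap: "inj_on (cmap c) (cdom c)"
  using homeomorphic_imp_injective_map[OF homeo] cdom_sub by (simp add: Int_absorb1)

lemma cinv_cmap [simp]: "q \<in> cdom c \<Longrightarrow> cinv c (cmap c q) = q"
  unfolding cinv_def using inj_cmap by (rule inv_into_f_f)

lemma cmap_cinv: "x \<in> cmap c ` cdom c \<Longrightarrow> cmap c (cinv c x) = x"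
  unfolding cinv_def by (rule f_inv_into_f)

lemma cinv_in: "x \<in> cmap c ` cdom c \<Longrightarrow> cinv c x \<in> cdom c"
  unfolding cinv_def by (rule inv_into_into)

lemma image_corner: "cmap c ` cdom c \<subseteq> corner B (cfaces c)"
  using open_image openin_subset by fastforce

lemma cmap_span: "q \<in> cdom c \<Longrightarrow> cmap c q \<in> span B"
  using image_corner by (auto simp: corner_def)

lemma open_preimage:
  assumes "open W" shows "openin X {q \<in> cdom c. cmap c q \<in> W}"
proof -
  have "continuous_map (subtopology X (cdom c)) euclidean (cmap c)"
    using homeomorphic_imp_continuous_map[OF homeo] continuous_map_in_subtopology by blast
  then have "openin (subtopology X (cdom c)) {q \<in> topspace (subtopology X (cdom c)). cmap c q \<in> W}"
    using assms by (intro openin_continuous_map_preimage) auto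
  then show ?thesis
    using open_cdom cdom_sub by (simp add: openin_open_subtopology Int_absorb1)
qed

text \<open>The image of a chart is open only relative to the model corner, so balls are cut with
  the corner. Halving the radius gives a closed ball, whose intersection with the corner is
  compact.\<close>

lemma chart_ball:
  assumes p: "p \<in> cdom c" and U: "openin X U" "p \<in> U"
  shows "\<exists>r>0. \<forall>x\<in>corner B (cfaces c). dist x (cmap c p) \<le> r \<longrightarrow> x \<in> cmap c ` (cdom c \<inter> U)"
proof -
  have "open_map (subtopology X (cdom c)) (top_of_set (cmap c ` cdom c)) (cmap c)"
    using homeomorphic_imp_open_map[OF homeo] .
  moreover have "openin (subtopology X (cdom c)) (cdom c \<inter> U)"
    using U by (auto simp: openin_subtopology)
  ultimately have "openin (top_of_set (cmap c ` cdom c)) (cmap c ` (cdom c \<inter> U))"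
    by (simp add: open_map_def)
  then have "openin (top_of_set (corner B (cfaces c))) (cmap c ` (cdom c \<inter> U))"
    using open_image openin_trans by blast
  then obtain e where "e > 0" "ball (cmap c p) e \<inter> corner B (cfaces c) \<subseteq> cmap c ` (cdom c \<inter> U)"
    using p U unfolding openin_contains_ball by blast
  then show ?thesis
    by (intro exI[of _ "e/2"]) (auto simp: subset_iff dist_commute)
qed

lemma continuous_map_cinv: "continuous_map (top_of_set (cmap c ` cdom c)) (subtopology X (cdom c)) (cinv c)"
proof -
  obtain g where g: "homeomorphic_maps (subtopology X (cdom c)) (top_of_set (cmap c ` cdom c)) (cmap c) g"
    using homeo homeomorphic_map_maps by blast
  then have "g x = cinv c x" if "x \<in> cmap c ` cdom c" for x
    using that cdom_sub by (auto simp: homeomorphic_maps_def Int_absorb1)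
  moreover have "continuous_map (top_of_set (cmap c ` cdom c)) (subtopology X (cdom c)) g"
    using g by (simp add: homeomorphic_maps_def)
  ultimately show ?thesis
    by (auto intro: continuous_map_eq)
qed

end

end

text \<open>Continuity is spelled out with \<open>openin X\<close> since \<open>'a\<close> carries
  no type class topology. The derivatives are two-sided, so that \<open>vector_derivative\<close> in
  \<open>speed\<close> is the actual velocity. A piecewise C1 curve satisfies this at all but
  finitely many interior times.\<close>

definition regular_at :: "'a topology \<Rightarrow> ('a, 'e::euclidean_space) chart set \<Rightarrow> (real \<Rightarrow> 'a) \<Rightarrow> real \<Rightarrow> bool" where
  "regular_at X \<A> \<gamma> t \<longleftrightarrow> \<gamma> t \<in> topspace X \<and>
     (\<forall>U. openin X U \<and> \<gamma> t \<in> U \<longrightarrow> eventually (\<lambda>s. \<gamma> s \<in> U) (nhds t)) \<and>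
     (\<forall>c\<in>\<A>. \<gamma> t \<in> cdom c \<longrightarrow> (\<exists>v. ((cmap c \<circ> \<gamma>) has_vector_derivative v) (at t)))"

section \<open>Velocities and piecewise C1 curves\<close>

context corner_manifold
begin

text \<open>The chart maps into \<open>span B\<close>, so the coordinates outside \<open>B\<close>
  are constantly 0 along the curve near \<open>t\<close>. This matters because the metric is
  positive definite only on \<open>span B\<close>.\<close>

lemma velocity_in_span:
  assumes \<gamma>: "regular_at X \<A> \<gamma> t" and c: "c \<in> \<A>" "\<gamma> t \<in> cdom c"
    and v: "((cmap c \<circ> \<gamma>) has_vector_derivative v) (at t)"
  shows "v \<in> span B"
  unfolding span_B
proof (safe)
  fix b :: 'e assume b: "b \<in> Basis" "b \<notin> B"
  have "((\<lambda>s. (cmap c \<circ> \<gamma>) s \<bullet> b) has_vector_derivative v \<bullet> b) (at t)"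
    by (rule bounded_linear.has_vector_derivative[OF bounded_linear_inner_left v])
  moreover have "eventually (\<lambda>s. \<gamma> s \<in> cdom c) (nhds t)"
    using \<gamma> c open_cdom by (auto simp: regular_at_def)
  then have "eventually (\<lambda>s. 0 = (cmap c \<circ> \<gamma>) s \<bullet> b) (nhds t)"
    by eventually_elim (use cmap_span[OF c(1)] b in \<open>auto simp: span_B\<close>)
  then have "((\<lambda>s. (cmap c \<circ> \<gamma>) s \<bullet> b) has_vector_derivative 0) (at t)"
    by (rule has_vector_derivative_transform_eventually[OF has_vector_derivative_const]) auto
  ultimately show "v \<bullet> b = 0" by (rule vector_derivative_unique_at)
qed

lemma smooth_on_extension:
  assumes "smooth_on A f" "x \<in> A"
  obtains W F where "open W" "x \<in> W" "\<And>y. y \<in> A \<inter> W \<Longrightarrow> F y = f y"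
    "\<And>y. y \<in> W \<Longrightarrow> (F has_derivative frechet_derivative F (at y)) (at y)"
    "\<And>v. continuous_on W (\<lambda>y. frechet_derivative F (at y) v)"
proof -
  obtain W F where *: "open W" "x \<in> W" "\<forall>k. Ck_on k W F" "\<forall>y\<in>A \<inter> W. F y = f y"
    using assms unfolding smooth_on_def by blast
  from *(3) have "Ck_on (Suc 0) W F" by blast
  then have "\<forall>y\<in>W. F differentiable (at y)" "\<forall>v. continuous_on W (\<lambda>y. frechet_derivative F (at y) v)"
    by auto
  then show ?thesis using that * by (metis frechet_derivative_works)
qed

text \<open>One \<open>T\<close> serves both claims: the derivative of an ambient extension of the
  transition map. The first conjunct is the form demanded by the transformation law in
  \<open>riemannian_metric\<close>, the second is the chain rule.\<close>

lemma chart_transition_velocity: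
  assumes \<gamma>: "regular_at X \<A> \<gamma> t" and c: "c \<in> \<A>" "\<gamma> t \<in> cdom c" and c': "c' \<in> \<A>" "\<gamma> t \<in> cdom c'"
    and v: "((cmap c \<circ> \<gamma>) has_vector_derivative v) (at t)"
  shows "\<exists>T. ((cmap c' \<circ> cinv c) has_derivative T) (at (cmap c (\<gamma> t)) within cmap c ` (cdom c \<inter> cdom c')) \<and>
    ((cmap c' \<circ> \<gamma>) has_vector_derivative T v) (at t)"
proof -
  let ?A = "cmap c ` (cdom c \<inter> cdom c')" and ?x = "cmap c (\<gamma> t)"
  have x: "?x \<in> ?A" using c c' by auto
  have "smooth_on ?A (cmap c' \<circ> cinv c)"
    using mwc c c' by (simp add: manifold_with_corners_def)
  then obtain W F where W: "open W" "?x \<in> W"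
    and F: "\<And>y. y \<in> ?A \<inter> W \<Longrightarrow> F y = (cmap c' \<circ> cinv c) y"
    and dF: "\<And>y. y \<in> W \<Longrightarrow> (F has_derivative frechet_derivative F (at y)) (at y)"
    and "\<And>v. continuous_on W (\<lambda>y. frechet_derivative F (at y) v)"
    by (rule smooth_on_extension[OF _ x]) (rule that)
  let ?T = "frechet_derivative F (at ?x)"
  note T = dF[OF W(2)]
  have "((cmap c' \<circ> cinv c) has_derivative ?T) (at ?x within ?A)"
  proof (rule has_derivative_transform_eventually[OF has_derivative_at_withinI[OF T]])
    have "eventually (\<lambda>y. y \<in> W) (nhds ?x)" using W by (simp add: eventually_nhds_in_open)
    then show "\<forall>\<^sub>F y in at ?x within ?A. F y = (cmap c' \<circ> cinv c) y"
      unfolding eventually_at_filter by eventually_elim (use F in auto)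
  qed (use F x W in auto)
  moreover have "((cmap c' \<circ> \<gamma>) has_vector_derivative ?T v) (at t)"
  proof (rule has_vector_derivative_transform_eventually)
    show "((F \<circ> (cmap c \<circ> \<gamma>)) has_vector_derivative ?T v) (at t)"
      by (rule has_vector_derivative_compose_frechet[OF v]) (use T in simp)
    have "openin X ({q \<in> cdom c. cmap c q \<in> W} \<inter> cdom c')"
      using open_preimage[OF c(1) W(1)] open_cdom[OF c'(1)] by blast
    then have "eventually (\<lambda>s. \<gamma> s \<in> {q \<in> cdom c. cmap c q \<in> W} \<inter> cdom c') (nhds t)"
      using \<gamma> W c c' unfolding regular_at_def by blast
    then show "eventually (\<lambda>s. (F \<circ> (cmap c \<circ> \<gamma>)) s = (cmap c' \<circ> \<gamma>) s) (nhds t)"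
      by eventually_elim (use F cinv_cmap[OF c(1)] in auto)
  qed auto
  ultimately show ?thesis by blast
qed

lemma chart_at:
  assumes "p \<in> topspace X" shows "chart_at \<A> p \<in> \<A>" "p \<in> cdom (chart_at \<A> p)"
proof -
  have "\<exists>c. c \<in> \<A> \<and> p \<in> cdom c" using charts_cover[OF assms] by blast
  from someI_ex[OF this] show "chart_at \<A> p \<in> \<A>" "p \<in> cdom (chart_at \<A> p)"
    by (auto simp: chart_at_def)
qed

lemma C1_arc_mono:
  assumes "C1_arc \<A> s t \<gamma>" "{s'..t'} \<subseteq> {s..t}" shows "C1_arc \<A> s' t' \<gamma>"
  unfolding C1_arc_def
proof
  fix c assume "c \<in> \<A>"
  then obtain \<gamma>' where g: "continuous_on {u \<in> {s..t}. \<gamma> u \<in> cdom c} \<gamma>'"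
    "\<forall>u\<in>{s..t}. \<gamma> u \<in> cdom c \<longrightarrow> ((cmap c \<circ> \<gamma>) has_vector_derivative \<gamma>' u) (at u within {s..t})"
    using assms unfolding C1_arc_def by blast
  show "\<exists>\<gamma>'. continuous_on {u \<in> {s'..t'}. \<gamma> u \<in> cdom c} \<gamma>' \<and>
    (\<forall>u\<in>{s'..t'}. \<gamma> u \<in> cdom c \<longrightarrow> ((cmap c \<circ> \<gamma>) has_vector_derivative \<gamma>' u) (at u within {s'..t'}))"
  proof (intro exI conjI ballI impI)
    show "continuous_on {u \<in> {s'..t'}. \<gamma> u \<in> cdom c} \<gamma>'"
      by (rule continuous_on_subset[OF g(1)]) (use assms(2) in auto)
    fix u assume "u \<in> {s'..t'}" "\<gamma> u \<in> cdom c"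
    then show "((cmap c \<circ> \<gamma>) has_vector_derivative \<gamma>' u) (at u within {s'..t'})"
      using g(2) assms(2) has_vector_derivative_within_subset by blast
  qed
qed

text \<open>\<open>b = -1\<close> covers the reversal of a curve, \<open>b = 2\<close> the two
  halves of a concatenation.\<close>

lemma C1_arc_affine:
  assumes \<gamma>: "C1_arc \<A> s t \<gamma>" and ab: "(\<lambda>u. a + b * u) ` {s'..t'} \<subseteq> {s..t}"
    and \<sigma>: "\<And>u. u \<in> {s'..t'} \<Longrightarrow> \<sigma> u = \<gamma> (a + b * u)"
  shows "C1_arc \<A> s' t' \<sigma>"
  unfolding C1_arc_def
proof
  have ab': "s \<le> a + b * u" "a + b * u \<le> t" if "s' \<le> u" "u \<le> t'" for u
    using ab that by (force simp: image_subset_iff)+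
  fix c assume "c \<in> \<A>"
  then obtain \<gamma>' where g: "continuous_on {u \<in> {s..t}. \<gamma> u \<in> cdom c} \<gamma>'"
    "\<forall>u\<in>{s..t}. \<gamma> u \<in> cdom c \<longrightarrow> ((cmap c \<circ> \<gamma>) has_vector_derivative \<gamma>' u) (at u within {s..t})"
    using \<gamma> unfolding C1_arc_def by blast
  show "\<exists>\<gamma>'. continuous_on {u \<in> {s'..t'}. \<sigma> u \<in> cdom c} \<gamma>' \<and>
    (\<forall>u\<in>{s'..t'}. \<sigma> u \<in> cdom c \<longrightarrow> ((cmap c \<circ> \<sigma>) has_vector_derivative \<gamma>' u) (at u within {s'..t'}))"
  proof (intro exI[of _ "\<lambda>u. b *\<^sub>R \<gamma>' (a + b * u)"] conjI ballI impI)
    have "continuous_on {u \<in> {s'..t'}. \<sigma> u \<in> cdom c} (\<gamma>' \<circ> (\<lambda>u. a + b * u))"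
    proof (rule continuous_on_compose)
      show "continuous_on ((\<lambda>u. a + b * u) ` {u \<in> {s'..t'}. \<sigma> u \<in> cdom c}) \<gamma>'"
        by (rule continuous_on_subset[OF g(1)]) (use ab' \<sigma> in auto)
    qed (intro continuous_intros)
    then show "continuous_on {u \<in> {s'..t'}. \<sigma> u \<in> cdom c} (\<lambda>u. b *\<^sub>R \<gamma>' (a + b * u))"
      by (intro continuous_intros) (simp add: comp_def)
    fix u assume u: "u \<in> {s'..t'}" "\<sigma> u \<in> cdom c"
    have 1: "((\<lambda>u. a + b * u) has_vector_derivative b) (at u within {s'..t'})"
      by (auto intro!: derivative_eq_intros)
    have "((cmap c \<circ> \<gamma>) has_vector_derivative \<gamma>' (a + b * u)) (at (a + b * u) within (\<lambda>u. a + b * u) ` {s'..t'})"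
      by (rule has_vector_derivative_within_subset[OF _ ab]) (use g(2) u \<sigma>[OF u(1)] ab' in auto)
    from vector_diff_chain_within[OF 1 this]
    show "((cmap c \<circ> \<sigma>) has_vector_derivative b *\<^sub>R \<gamma>' (a + b * u)) (at u within {s'..t'})"
      using u \<sigma> by (auto intro: has_vector_derivative_transform[rotated 2])
  qed
qed

text \<open>The definition speaks of consecutive members of a subdivision containing 0 and 1. With
  any finite exceptional set, and all subintervals whose interior avoids it, such sets can be mapped
  and united freely when curves are reversed or joined.\<close>

lemma piecewise_C1_curve_iff:
  "piecewise_C1_curve X \<A> M \<gamma> \<longleftrightarrow> continuous_map (top_of_set {0..1}) (subtopology X M) \<gamma> \<and>
     (\<exists>F. finite F \<and> (\<forall>s t. 0 \<le> s \<and> s < t \<and> t \<le> 1 \<and> {s<..<t} \<inter> F = {} \<longrightarrow> C1_arc \<A> s t \<gamma>))"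
  (is "?L \<longleftrightarrow> ?C \<and> (\<exists>F. finite F \<and> ?R F)")
proof
  assume L: ?L
  then have ?C by (simp add: piecewise_C1_curve_def)
  from L obtain F where F: "finite F" "{0, 1} \<subseteq> F" "F \<subseteq> {0..1}"
    and arcs: "\<forall>s\<in>F. \<forall>t\<in>F. s < t \<and> {s<..<t} \<inter> F = {} \<longrightarrow> C1_arc \<A> s t \<gamma>"
    unfolding piecewise_C1_curve_def by (elim conjE exE) (rule that)
  have "C1_arc \<A> s t \<gamma>" if st: "0 \<le> s" "s < t" "t \<le> 1" "{s<..<t} \<inter> F = {}" for s t
  proof -
    \<comment> \<open>\<open>s0\<close> and \<open>t0\<close> are the consecutive subdivision points
      that enclose the interval; they exist because 0 and 1 belong to \<open>F\<close>.\<close>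
    define s0 where "s0 = Max {f\<in>F. f \<le> s}"
    define t0 where "t0 = Min {f\<in>F. t \<le> f}"
    have ne: "finite {f\<in>F. f \<le> s}" "0 \<in> {f\<in>F. f \<le> s}" "finite {f\<in>F. t \<le> f}" "1 \<in> {f\<in>F. t \<le> f}"
      using F st by auto
    have s0: "s0 \<in> F" "s0 \<le> s" using Max_in[OF ne(1)] ne(2) unfolding s0_def by blast+
    have t0: "t0 \<in> F" "t \<le> t0" using Min_in[OF ne(3)] ne(4) unfolding t0_def by blast+
    have "{s0<..<t0} \<inter> F = {}"
    proof safe
      fix f assume f: "f \<in> {s0<..<t0}" "f \<in> F"
      have "\<not> f \<le> s" using Max_ge[OF ne(1), of f] f by (auto simp: s0_def)
      moreover have "\<not> t \<le> f" using Min_le[OF ne(3), of f] f by (auto simp: t0_def)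
      ultimately have "f \<in> {s<..<t} \<inter> F" using f by simp
      then show "f \<in> {}" unfolding st(4) .
    qed
    moreover have "s0 < t0" using s0 t0 st by linarith
    ultimately have "C1_arc \<A> s0 t0 \<gamma>" using arcs s0(1) t0(1) by blast
    then show ?thesis
      by (rule C1_arc_mono) (use s0 t0 in auto)
  qed
  then show "?C \<and> (\<exists>F. finite F \<and> ?R F)" using F(1) \<open>?C\<close> by blast
next
  assume "?C \<and> (\<exists>F. finite F \<and> ?R F)"
  then obtain F where ?C and F: "finite F" "?R F" by blast
  let ?F = "insert 0 (insert 1 (F \<inter> {0..1}))"
  have "C1_arc \<A> s t \<gamma>" if st: "s \<in> ?F" "t \<in> ?F" "s < t" "{s<..<t} \<inter> ?F = {}" for s t
  proof -
    have "0 \<le> s" "t \<le> 1" "{s<..<t} \<inter> F = {}" using st by auto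
    then show ?thesis using F(2) st(3) by blast
  qed
  then show ?L
    unfolding piecewise_C1_curve_def using F(1) \<open>?C\<close> by (intro conjI exI[of _ ?F]) auto
qed

text \<open>Around an interior time outside \<open>F\<close> some closed interval lies within a
  single arc, and in its interior the derivative within the interval is two-sided.\<close>

lemma piecewise_regular:
  assumes "piecewise_C1_curve X \<A> M \<gamma>"
  shows "\<exists>F. finite F \<and> (\<forall>t\<in>{0<..<1} - F. regular_at X \<A> \<gamma> t)"
proof -
  obtain F where F: "finite F" "\<And>s t. 0 \<le> s \<Longrightarrow> s < t \<Longrightarrow> t \<le> 1 \<Longrightarrow> {s<..<t} \<inter> F = {} \<Longrightarrow> C1_arc \<A> s t \<gamma>"
    and cont: "continuous_map (top_of_set {0..1}) (subtopology X M) \<gamma>"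
    using assms unfolding piecewise_C1_curve_iff by blast
  have cont': "continuous_map (top_of_set {0..1}) X \<gamma>"
    using cont continuous_map_in_subtopology by blast
  have "regular_at X \<A> \<gamma> t" if t: "t \<in> {0<..<1} - F" for t
    unfolding regular_at_def
  proof (intro conjI allI impI ballI)
    show "\<gamma> t \<in> topspace X"
      using continuous_map_image_subset_topspace[OF cont'] t by (auto simp: image_subset_iff)
    fix U assume U: "openin X U \<and> \<gamma> t \<in> U"
    then have "openin (top_of_set {0..1}) {u \<in> {0..1}. \<gamma> u \<in> U}"
      using openin_continuous_map_preimage[OF cont', of U] by simp
    then obtain V where V: "open V" "{u \<in> {0..1}. \<gamma> u \<in> U} = {0..1} \<inter> V"
      unfolding openin_open by blast
    have VU: "\<gamma> u \<in> U \<longleftrightarrow> u \<in> V" if "u \<in> {0..1}" for u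
      using V(2) that by blast
    have "eventually (\<lambda>s. s \<in> V \<inter> {0<..<1}) (nhds t)"
      using V(1) U t VU[of t] by (intro eventually_nhds_in_open) (auto intro: open_Int)
    then show "eventually (\<lambda>s. \<gamma> s \<in> U) (nhds t)"
      by eventually_elim (simp add: VU)
  next
    fix c assume c: "c \<in> \<A>" "\<gamma> t \<in> cdom c"
    have "open ({0<..<1} - F)" using F(1) by (intro open_Diff finite_imp_closed) auto
    then obtain e where e: "e > 0" "cball t e \<subseteq> {0<..<1} - F"
      using t open_contains_cball by blast
    have sub: "{t-e..t+e} \<subseteq> {0<..<1} - F" using e by (simp add: cball_eq_atLeastAtMost)
    have "t - e \<in> {t-e..t+e}" "t + e \<in> {t-e..t+e}" using e(1) by auto
    with sub have "0 < t - e" "t + e < 1" by (meson DiffD1 greaterThanLessThan_iff subsetD)+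
    moreover have "{t-e<..<t+e} \<inter> F = {}"
      using sub greaterThanLessThan_subseteq_atLeastAtMost_iff[of "t-e" "t+e" "t-e" "t+e"] by blast
    ultimately have "C1_arc \<A> (t-e) (t+e) \<gamma>" using e(1) by (intro F) auto
    then obtain v where "((cmap c \<circ> \<gamma>) has_vector_derivative v) (at t within {t-e..t+e})"
      using c e(1) unfolding C1_arc_def by fastforce
    then show "\<exists>v. ((cmap c \<circ> \<gamma>) has_vector_derivative v) (at t)"
      using e(1) by (auto simp: at_within_Icc_at)
  qed
  then show ?thesis using F(1) by blast
qed

end


section \<open>Speed, length and the pseudometric axioms\<close>

locale riemannian_corner_manifold = corner_manifold X \<A> B
  for X :: "'a topology" and \<A> :: "('a, 'e::euclidean_space) chart set" and B :: "'e set" +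
  fixes g :: "('a, 'e) metric_comp"
  assumes metric: "riemannian_metric \<A> B g"
begin

abbreviation "M \<equiv> minterior X \<A>"

lemma M_sub: "M \<subseteq> topspace X" by (auto simp: minterior_def)

lemma bilinear_metric: "c \<in> \<A> \<Longrightarrow> p \<in> cdom c \<Longrightarrow> bilinear (g c p)"
  and metric_pos: "c \<in> \<A> \<Longrightarrow> p \<in> cdom c \<Longrightarrow> v \<in> span B \<Longrightarrow> v \<noteq> 0 \<Longrightarrow> 0 < g c p v v"
  using metric unfolding riemannian_metric_def by blast+

lemma metric_scale:
  assumes "c \<in> \<A>" "p \<in> cdom c"
  shows "g c p (b *\<^sub>R v) (b *\<^sub>R v) = b\<^sup>2 * g c p v v"
  using bilinear_metric[OF assms] by (simp add: bilinear_lmul bilinear_rmul power2_eq_square)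

lemma metric_zero: "c \<in> \<A> \<Longrightarrow> p \<in> cdom c \<Longrightarrow> g c p 0 0 = 0"
  using metric_scale[of c p 0 0] by simp

lemma metric_nonneg: "c \<in> \<A> \<Longrightarrow> p \<in> cdom c \<Longrightarrow> v \<in> span B \<Longrightarrow> 0 \<le> g c p v v"
  using metric_pos metric_zero by (cases "v = 0") (auto intro: less_imp_le)

text \<open>\<open>speed\<close> refers to the chart selected by \<open>SOME\<close>; the
  transformation law of \<open>g\<close> gives the same value in every chart around the
  point.\<close>

lemma speed_in_chart:
  assumes \<gamma>: "regular_at X \<A> \<gamma> t" and c: "c \<in> \<A>" "\<gamma> t \<in> cdom c"
    and v: "((cmap c \<circ> \<gamma>) has_vector_derivative v) (at t)"
  shows "speed \<A> (conformal f g) \<gamma> t = sqrt (f (\<gamma> t)) * sqrt (g c (\<gamma> t) v v)"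
proof -
  have "\<gamma> t \<in> topspace X" using \<gamma> by (simp add: regular_at_def)
  note c' = chart_at[OF this]
  let ?c = "chart_at \<A> (\<gamma> t)"
  obtain T where T: "((cmap ?c \<circ> cinv c) has_derivative T) (at (cmap c (\<gamma> t)) within cmap c ` (cdom c \<inter> cdom ?c))"
    "((cmap ?c \<circ> \<gamma>) has_vector_derivative T v) (at t)"
    using chart_transition_velocity[OF \<gamma> c c' v] by blast
  have vB: "v \<in> span B" by (rule velocity_in_span[OF \<gamma> c v])
  have "g c (\<gamma> t) v v = g ?c (\<gamma> t) (T v) (T v)"
    using metric c c' T(1) vB unfolding riemannian_metric_def by blast
  moreover have "vector_derivative (cmap ?c \<circ> \<gamma>) (at t) = T v"
    using T(2) by (rule vector_derivative_at)
  ultimately show ?thesis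
    by (simp add: speed_def Let_def conformal_def real_sqrt_mult)
qed

lemma speed_affine:
  assumes \<gamma>: "regular_at X \<A> \<gamma> (a + b * t)"
    and \<sigma>: "eventually (\<lambda>u. \<sigma> u = \<gamma> (a + b * u)) (nhds t)"
  shows "speed \<A> (conformal f g) \<sigma> t = \<bar>b\<bar> * speed \<A> (conformal f g) \<gamma> (a + b * t)"
proof -
  have \<sigma>t: "\<sigma> t = \<gamma> (a + b * t)" using \<sigma> by (rule eventually_nhds_x_imp_x)
  then have "\<sigma> t \<in> topspace X" using \<gamma> by (simp add: regular_at_def)
  define c where "c = chart_at \<A> (\<sigma> t)"
  have c: "c \<in> \<A>" "\<gamma> (a + b * t) \<in> cdom c"
    using chart_at[OF \<open>\<sigma> t \<in> topspace X\<close>] by (simp_all add: c_def flip: \<sigma>t)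
  obtain v where v: "((cmap c \<circ> \<gamma>) has_vector_derivative v) (at (a + b * t))"
    using \<gamma> c unfolding regular_at_def by auto
  have 1: "((\<lambda>u. a + b * u) has_vector_derivative b) (at t)"
    by (auto intro!: derivative_eq_intros)
  have "((cmap c \<circ> \<sigma>) has_vector_derivative b *\<^sub>R v) (at t)"
    by (rule has_vector_derivative_transform_eventually[OF vector_diff_chain_at[OF 1 v]])
      (use \<sigma> in \<open>auto elim: eventually_mono\<close>)
  then have "vector_derivative (cmap c \<circ> \<sigma>) (at t) = b *\<^sub>R v"
    by (rule vector_derivative_at)
  then have "speed \<A> (conformal f g) \<sigma> t = sqrt (f (\<sigma> t) * (b\<^sup>2 * g c (\<sigma> t) v v))"
    using c \<sigma>t unfolding speed_def Let_def conformal_def c_def[symmetric] by (simp add: metric_scale)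
  also have "\<dots> = \<bar>b\<bar> * (sqrt (f (\<gamma> (a + b * t))) * sqrt (g c (\<gamma> (a + b * t)) v v))"
    by (simp add: real_sqrt_mult \<sigma>t)
  also have "\<dots> = \<bar>b\<bar> * speed \<A> (conformal f g) \<gamma> (a + b * t)"
    using speed_in_chart[OF \<gamma> c v] by simp
  finally show ?thesis .
qed

text \<open>Distances are infima, so an upper bound for the length after reparametrisation is
  enough, and that is available without measurability of the speed. Agreement of the curves is asked
  only inside the interval, which accommodates the case distinction at the joint of two
  curves.\<close>

lemma length_affine_le:
  assumes \<gamma>: "piecewise_C1_curve X \<A> M' \<gamma>" and b: "b \<noteq> 0"
    and ab: "\<And>u. s < u \<Longrightarrow> u < t \<Longrightarrow> a + b * u \<in> {0<..<1}"
    and \<sigma>: "\<And>u. s < u \<Longrightarrow> u < t \<Longrightarrow> \<sigma> u = \<gamma> (a + b * u)"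
  shows "(\<integral>\<^sup>+u\<in>{s..t}. ennreal (speed \<A> (conformal f g) \<sigma> u) \<partial>lborel) \<le> curve_length \<A> (conformal f g) \<gamma>"
proof -
  let ?s = "\<lambda>u. ennreal (speed \<A> (conformal f g) \<gamma> u) * indicator {0..1} u"
  obtain F where F: "finite F" "\<And>t. t \<in> {0<..<1} - F \<Longrightarrow> regular_at X \<A> \<gamma> t"
    using piecewise_regular[OF \<gamma>] by blast
  \<comment> \<open>The end points, and the times that the affine map sends to possibly non-regular
    times of \<open>\<gamma>\<close>: a finite set, hence null.\<close>
  let ?N = "{s, t} \<union> (\<lambda>y. (y - a) / b) ` F"
  have "AE u in lborel. u \<notin> ?N"
    using F(1) by (intro AE_not_in finite_imp_null_set_lborel) auto
  then have "AE u in lborel. ennreal (speed \<A> (conformal f g) \<sigma> u) * indicator {s..t} u \<le> ennreal \<bar>b\<bar> * ?s (a + b * u)"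
  proof eventually_elim
    fix u assume u: "u \<notin> ?N"
    show "ennreal (speed \<A> (conformal f g) \<sigma> u) * indicator {s..t} u \<le> ennreal \<bar>b\<bar> * ?s (a + b * u)"
    proof (cases "u \<in> {s<..<t}")
      case True
      have "a + b * u \<notin> F"
      proof
        assume "a + b * u \<in> F"
        then have "(a + b * u - a) / b \<in> ?N" by blast
        then show False using b u by simp
      qed
      then have reg: "regular_at X \<A> \<gamma> (a + b * u)" using F(2) ab True by auto
      have "eventually (\<lambda>u. u \<in> {s<..<t}) (nhds u)"
        using True by (intro eventually_nhds_in_open) auto
      then have "eventually (\<lambda>u. \<sigma> u = \<gamma> (a + b * u)) (nhds u)"
        by eventually_elim (use \<sigma> in auto)
      from speed_affine[OF reg this, of f]
      have "ennreal (speed \<A> (conformal f g) \<sigma> u) = ennreal \<bar>b\<bar> * ennreal (speed \<A> (conformal f g) \<gamma> (a + b * u))"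
        by (simp add: ennreal_mult')
      then show ?thesis using ab[of u] True by (simp add: indicator_def)
    next
      case False
      then have "u \<notin> {s..t}" using u by auto
      then show ?thesis by simp
    qed
  qed
  then have "(\<integral>\<^sup>+u\<in>{s..t}. ennreal (speed \<A> (conformal f g) \<sigma> u) \<partial>lborel)
      \<le> (\<integral>\<^sup>+u. ennreal \<bar>b\<bar> * ?s (a + b * u) \<partial>lborel)"
    by (rule nn_integral_mono_AE)
  also have "\<dots> \<le> curve_length \<A> (conformal f g) \<gamma>"
    unfolding curve_length_def by (rule nn_integral_affine_le[OF b])
  finally show ?thesis .
qed

lemma riemannian_dist_refl:
  assumes p: "p \<in> M" shows "riemannian_dist X \<A> M (conformal f g) p p = 0"
proof -
  let ?\<gamma> = "\<lambda>t::real. p"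
  have "C1_arc \<A> s t ?\<gamma>" for s t
    unfolding C1_arc_def by (auto intro!: exI[of _ "\<lambda>_. 0"] simp: comp_def)
  moreover have "continuous_map (top_of_set {0..1::real}) (subtopology X M) ?\<gamma>"
    using p M_sub by auto
  ultimately have pc: "piecewise_C1_curve X \<A> M ?\<gamma>"
    unfolding piecewise_C1_curve_iff by blast
  have "speed \<A> (conformal f g) ?\<gamma> t = 0" for t
    using chart_at[of p] p M_sub by (auto simp: speed_def Let_def conformal_def comp_def metric_zero)
  then have "curve_length \<A> (conformal f g) ?\<gamma> = 0" by (simp add: curve_length_def)
  then have "riemannian_dist X \<A> M (conformal f g) p p \<le> 0"
    unfolding riemannian_dist_def using pc by (intro INF_lower2[of ?\<gamma>]) auto
  then show ?thesis by simp
qed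

lemma riemannian_dist_commute_le:
  "riemannian_dist X \<A> M (conformal f g) q p \<le> riemannian_dist X \<A> M (conformal f g) p q"
  unfolding riemannian_dist_def
proof (rule INF_mono, safe)
  fix \<gamma> assume \<gamma>: "piecewise_C1_curve X \<A> M \<gamma>"
  let ?\<sigma> = "\<lambda>u. \<gamma> (1 - u)"
  obtain F where F: "finite F" "\<And>s t. 0 \<le> s \<Longrightarrow> s < t \<Longrightarrow> t \<le> 1 \<Longrightarrow> {s<..<t} \<inter> F = {} \<Longrightarrow> C1_arc \<A> s t \<gamma>"
    and cont: "continuous_map (top_of_set {0..1}) (subtopology X M) \<gamma>"
    using \<gamma> unfolding piecewise_C1_curve_iff by blast
  have "piecewise_C1_curve X \<A> M ?\<sigma>"
    unfolding piecewise_C1_curve_iff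
  proof (intro conjI exI[of _ "(\<lambda>u. 1 - u) ` F"] allI impI)
    have "continuous_map (top_of_set {0..1::real}) (top_of_set {0..1}) (\<lambda>u. 1 - u)"
      by (auto intro!: continuous_intros)
    from continuous_map_compose[OF this cont]
    show "continuous_map (top_of_set {0..1}) (subtopology X M) ?\<sigma>" by (simp add: comp_def)
    fix s t :: real assume st: "0 \<le> s \<and> s < t \<and> t \<le> 1 \<and> {s<..<t} \<inter> (\<lambda>u. 1 - u) ` F = {}"
    have "{1-t<..<1-s} \<inter> F = {}"
    proof safe
      fix u assume "u \<in> {1-t<..<1-s}" "u \<in> F"
      then have "1 - u \<in> {s<..<t} \<inter> (\<lambda>u. 1 - u) ` F" by auto
      then show "u \<in> {}" using st by simp
    qed
    then have "C1_arc \<A> (1 - t) (1 - s) \<gamma>" using st by (intro F) auto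
    then show "C1_arc \<A> s t ?\<sigma>"
      by (rule C1_arc_affine[of _ _ _ 1 "-1"]) auto
  qed (use F in auto)
  moreover have "curve_length \<A> (conformal f g) ?\<sigma> \<le> curve_length \<A> (conformal f g) \<gamma>"
    unfolding curve_length_def[of _ _ ?\<sigma>]
    by (rule length_affine_le[OF \<gamma>, of "-1" _ _ 1]) auto
  ultimately show "\<exists>\<sigma>\<in>{\<sigma>. piecewise_C1_curve X \<A> M \<sigma> \<and> \<sigma> 0 = \<gamma> 1 \<and> \<sigma> 1 = \<gamma> 0}.
      curve_length \<A> (conformal f g) \<sigma> \<le> curve_length \<A> (conformal f g) \<gamma>"
    by (intro bexI[of _ ?\<sigma>]) auto
qed

lemma piecewise_C1_curve_join:
  assumes \<gamma>1: "piecewise_C1_curve X \<A> M \<gamma>1" and \<gamma>2: "piecewise_C1_curve X \<A> M \<gamma>2" and eq: "\<gamma>1 1 = \<gamma>2 0"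
  shows "piecewise_C1_curve X \<A> M (\<lambda>u. if u \<le> 1/2 then \<gamma>1 (2 * u) else \<gamma>2 (2 * u - 1))"
    (is "piecewise_C1_curve X \<A> M ?\<sigma>")
proof -
  obtain F1 where F1: "finite F1" "\<And>s t. 0 \<le> s \<Longrightarrow> s < t \<Longrightarrow> t \<le> 1 \<Longrightarrow> {s<..<t} \<inter> F1 = {} \<Longrightarrow> C1_arc \<A> s t \<gamma>1"
    and cont1: "continuous_map (top_of_set {0..1}) (subtopology X M) \<gamma>1"
    using \<gamma>1 unfolding piecewise_C1_curve_iff by blast
  obtain F2 where F2: "finite F2" "\<And>s t. 0 \<le> s \<Longrightarrow> s < t \<Longrightarrow> t \<le> 1 \<Longrightarrow> {s<..<t} \<inter> F2 = {} \<Longrightarrow> C1_arc \<A> s t \<gamma>2"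
    and cont2: "continuous_map (top_of_set {0..1}) (subtopology X M) \<gamma>2"
    using \<gamma>2 unfolding piecewise_C1_curve_iff by blast
  have half: "\<gamma>1 (2 * u) = \<gamma>2 (2 * u - 1)" if "u * 2 = 1" for u :: real
  proof -
    have "2 * u = 1" "2 * u - 1 = 0" using that by auto
    then show ?thesis using eq by metis
  qed
  \<comment> \<open>The joint, and the break points of both curves in the new parameter.\<close>
  let ?F = "{1/2} \<union> ((\<lambda>u. u / 2) ` F1 \<union> (\<lambda>u. (u + 1) / 2) ` F2)"
  show ?thesis
    unfolding piecewise_C1_curve_iff
  proof (intro conjI exI[of _ ?F] allI impI)
    show "continuous_map (top_of_set {0..1}) (subtopology X M) ?\<sigma>"
    proof (rule continuous_map_cases_le)
      have "continuous_map (subtopology (top_of_set {0..1::real}) {u \<in> topspace (top_of_set {0..1}). u \<le> 1/2}) (top_of_set {0..1}) (\<lambda>u. 2 * u)"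
        by (auto simp: subtopology_subtopology intro!: continuous_intros)
      from continuous_map_compose[OF this cont1]
      show "continuous_map (subtopology (top_of_set {0..1}) {u \<in> topspace (top_of_set {0..1}). u \<le> 1/2}) (subtopology X M) (\<lambda>u. \<gamma>1 (2 * u))"
        by (simp add: comp_def)
      have "continuous_map (subtopology (top_of_set {0..1::real}) {u \<in> topspace (top_of_set {0..1}). 1/2 \<le> u}) (top_of_set {0..1}) (\<lambda>u. 2 * u - 1)"
        by (auto simp: subtopology_subtopology intro!: continuous_intros)
      from continuous_map_compose[OF this cont2]
      show "continuous_map (subtopology (top_of_set {0..1}) {u \<in> topspace (top_of_set {0..1}). 1/2 \<le> u}) (subtopology X M) (\<lambda>u. \<gamma>2 (2 * u - 1))"
        by (simp add: comp_def)
    qed (auto intro!: continuous_map_into_fulltopology continuous_intros half)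
    fix s t :: real assume st: "0 \<le> s \<and> s < t \<and> t \<le> 1 \<and> {s<..<t} \<inter> ?F = {}"
    then have disj: "{s<..<t} \<inter> ?F = {}" by blast
    have "1/2 \<notin> {s<..<t}"
    proof
      assume "1/2 \<in> {s<..<t}"
      then have "1/2 \<in> {s<..<t} \<inter> ?F" by simp
      then show False unfolding disj by simp
    qed
    then consider "t \<le> 1/2" | "1/2 \<le> s" by fastforce
    then show "C1_arc \<A> s t ?\<sigma>"
    proof cases
      case 1
      have "{2 * s<..<2 * t} \<inter> F1 = {}"
      proof safe
        fix u assume "u \<in> {2 * s<..<2 * t}" "u \<in> F1"
        then have "u / 2 \<in> {s<..<t} \<inter> ?F" by auto
        then have False unfolding disj by simp
        then show "u \<in> {}" by simp
      qed
      then have "C1_arc \<A> (2 * s) (2 * t) \<gamma>1" using st 1 by (intro F1) auto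
      then show ?thesis
        by (rule C1_arc_affine[of _ _ _ 0 2]) (use 1 in auto)
    next
      case 2
      have "{2 * s - 1<..<2 * t - 1} \<inter> F2 = {}"
      proof safe
        fix u assume "u \<in> {2 * s - 1<..<2 * t - 1}" "u \<in> F2"
        then have "(u + 1) / 2 \<in> {s<..<t} \<inter> ?F" by auto
        then have False unfolding disj by simp
        then show "u \<in> {}" by simp
      qed
      then have "C1_arc \<A> (2 * s - 1) (2 * t - 1) \<gamma>2" using st 2 by (intro F2) auto
      then show ?thesis
        by (rule C1_arc_affine[of _ _ _ "-1" 2]) (use 2 in \<open>auto intro!: half\<close>)
    qed
  qed (use F1 F2 in auto)
qed

lemma riemannian_dist_triangle:
  "riemannian_dist X \<A> M (conformal f g) p r \<le>
    riemannian_dist X \<A> M (conformal f g) p q + riemannian_dist X \<A> M (conformal f g) q r"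
proof -
  let ?L = "curve_length \<A> (conformal f g)"
  let ?C = "\<lambda>p q. {\<gamma>. piecewise_C1_curve X \<A> M \<gamma> \<and> \<gamma> 0 = p \<and> \<gamma> 1 = q}"
  have *: "riemannian_dist X \<A> M (conformal f g) p r \<le> ?L \<gamma>1 + ?L \<gamma>2" if "\<gamma>1 \<in> ?C p q" "\<gamma>2 \<in> ?C q r" for \<gamma>1 \<gamma>2
  proof -
    let ?\<sigma> = "\<lambda>u. if u \<le> 1/2 then \<gamma>1 (2 * u) else \<gamma>2 (2 * u - 1)"
    have "?L ?\<sigma> = (\<integral>\<^sup>+u\<in>{0..1/2} \<union> {1/2..1}. ennreal (speed \<A> (conformal f g) ?\<sigma> u) \<partial>lborel)"
      unfolding curve_length_def by (simp add: ivl_disj_un_two_touch)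
    also have "\<dots> \<le> (\<integral>\<^sup>+u\<in>{0..1/2}. ennreal (speed \<A> (conformal f g) ?\<sigma> u) \<partial>lborel)
        + (\<integral>\<^sup>+u\<in>{1/2..1}. ennreal (speed \<A> (conformal f g) ?\<sigma> u) \<partial>lborel)"
      by (rule nn_integral_Un_le) auto
    also have "\<dots> \<le> ?L \<gamma>1 + ?L \<gamma>2"
      using that by (intro add_mono length_affine_le[of _ _ 2 _ _ 0] length_affine_le[of _ _ 2 _ _ "-1"]) auto
    finally have "?L ?\<sigma> \<le> ?L \<gamma>1 + ?L \<gamma>2" .
    moreover have "piecewise_C1_curve X \<A> M ?\<sigma>"
      using that by (intro piecewise_C1_curve_join) auto
    then have "?\<sigma> \<in> ?C p r" using that by auto
    ultimately show ?thesis
      unfolding riemannian_dist_def by (meson INF_lower order_trans)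
  qed
  show ?thesis
  proof (rule ennreal_le_epsilon)
    fix e :: real
    let ?D = "riemannian_dist X \<A> M (conformal f g)"
    assume fin: "?D p q + ?D q r < top" and e: "0 < e"
    \<comment> \<open>Finiteness is essential for this strict inequality; it is the assumption that
      \<open>ennreal_le_epsilon\<close> grants, and it makes nearly minimal curves
      available.\<close>
    have lt: "x < x + ennreal (e/2)" if "x < top" for x
      using that e by (cases x) (auto simp: ennreal_less_iff simp flip: ennreal_plus)
    have "?D p q < ?D p q + ennreal (e/2)" "?D q r < ?D q r + ennreal (e/2)"
      using fin e by (auto intro!: lt)
    then obtain \<gamma>1 \<gamma>2 where \<gamma>: "\<gamma>1 \<in> ?C p q" "?L \<gamma>1 < ?D p q + ennreal (e/2)"
      "\<gamma>2 \<in> ?C q r" "?L \<gamma>2 < ?D q r + ennreal (e/2)"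
      unfolding riemannian_dist_def INF_less_iff by blast
    have "?D p r \<le> ?L \<gamma>1 + ?L \<gamma>2" using * \<gamma> by blast
    also have "\<dots> \<le> (?D p q + ennreal (e/2)) + (?D q r + ennreal (e/2))"
      using \<gamma> by (intro add_mono less_imp_le)
    also have "\<dots> = ?D p q + ?D q r + (ennreal (e/2) + ennreal (e/2))" by (simp add: ac_simps)
    also have "ennreal (e/2) + ennreal (e/2) = ennreal e"
      using e by (subst ennreal_plus[symmetric]) auto
    finally show "?D p r \<le> ?D p q + ?D q r + ennreal e" .
  qed
qed

sublocale ext_pseudometric M "riemannian_dist X \<A> M (conformal f g)"
  by unfold_locales
    (auto simp: riemannian_dist_refl riemannian_dist_triangle intro: order_antisym riemannian_dist_commute_le)

end

section \<open>Lower bounds for the distance\<close>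

text \<open>Measurability of \<open>s\<close> is unknown, so the derivative is integrated instead:
  the fundamental theorem for the gauge integral asks for no continuity of \<open>D\<close> and
  yields its Lebesgue measurability. Then either \<open>D\<close> is absolutely integrable or the
  right-hand side is infinite.\<close>

lemma increment_le_nn_integral:
  fixes h :: "real \<Rightarrow> real"
  assumes cont: "continuous_on {0..1} h" and F: "finite F"
    and der: "\<And>t. t \<in> {0<..<1} - F \<Longrightarrow> \<exists>D. (h has_real_derivative D) (at t) \<and> \<bar>D\<bar> \<le> s t"
  shows "ennreal \<bar>h 1 - h 0\<bar> \<le> (\<integral>\<^sup>+t\<in>{0..1}. ennreal (s t) \<partial>lborel)"
proof -
  obtain D where D: "\<And>t. t \<in> {0<..<1} - F \<Longrightarrow> (h has_real_derivative D t) (at t)"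
    "\<And>t. t \<in> {0<..<1} - F \<Longrightarrow> \<bar>D t\<bar> \<le> s t"
    using der by metis
  have int: "(D has_integral (h 1 - h 0)) {0..1}"
    by (rule fundamental_theorem_of_calculus_interior_strong[OF F])
      (use D(1) cont in \<open>auto simp: has_real_derivative_iff_has_vector_derivative\<close>)
  let ?D = "\<lambda>t. D t * indicator {0..1} t"
  have meas: "?D \<in> borel_measurable lebesgue"
    using int by (rule has_integral_implies_lebesgue_measurable_real)
  have "AE t in lborel. t \<notin> {0, 1} \<union> F"
    using F by (intro AE_not_in finite_imp_null_set_lborel) auto
  then have "AE t in lborel. ennreal (norm (?D t)) \<le> ennreal (s t) * indicator {0..1} t"
    by eventually_elim (use D(2) in \<open>auto simp: indicator_def intro!: ennreal_leI\<close>)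
  then have le: "(\<integral>\<^sup>+t. ennreal (norm (?D t)) \<partial>lebesgue) \<le> (\<integral>\<^sup>+t\<in>{0..1}. ennreal (s t) \<partial>lborel)"
    unfolding nn_integral_completion by (rule nn_integral_mono_AE)
  show ?thesis
  proof (cases "(\<integral>\<^sup>+t. ennreal (norm (?D t)) \<partial>lebesgue) < \<infinity>")
    case True
    then have integrable: "integrable lebesgue ?D"
      using meas by (rule integrableI_bounded[rotated])
    have "(?D has_integral (h 1 - h 0)) UNIV"
    proof (rule has_integral_eq[rotated])
      show "((\<lambda>t. if t \<in> {0..1} then D t else 0) has_integral (h 1 - h 0)) UNIV"
        using int by (simp only: has_integral_restrict_UNIV)
    qed auto
    then have "integral\<^sup>L lebesgue ?D = h 1 - h 0"
      using has_integral_integral_lebesgue[OF integrable] has_integral_unique by blast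
    then have "ennreal \<bar>h 1 - h 0\<bar> \<le> (\<integral>\<^sup>+t. ennreal (norm (?D t)) \<partial>lebesgue)"
      using integral_norm_bound_ennreal[OF integrable] by simp
    then show ?thesis using le by simp
  next
    case False
    then have "(\<integral>\<^sup>+t\<in>{0..1}. ennreal (s t) \<partial>lborel) = \<infinity>"
      using le by (metis infinity_ennreal_def less_top top_unique)
    then show ?thesis by simp
  qed
qed

text \<open>Squaring makes the truncation differentiable at 0; this provides the bump function in
  \<open>riemannian_dist_finer\<close>.\<close>

lemma DERIV_max_0_power2: "((\<lambda>s::real. (max 0 s)\<^sup>2) has_real_derivative 2 * max 0 s) (at s)"
proof -
  consider "s < 0" | "s = 0" | "0 < s" by linarith
  then show ?thesis
  proof cases
    case 1
    have "((\<lambda>_. 0::real) has_real_derivative 0) (at s)" by simp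
    then show ?thesis
      by (rule has_field_derivative_transform_within_open[of _ _ _ "{..<0}", THEN DERIV_cong])
        (use 1 in auto)
  next
    case 2
    have "((\<lambda>h. (max 0 h)\<^sup>2 / h) \<longlongrightarrow> 0) (at (0::real))"
    proof (rule Lim_null_comparison)
      show "eventually (\<lambda>h. norm ((max 0 h)\<^sup>2 / h) \<le> \<bar>h\<bar>) (at (0::real))"
        by (rule always_eventually) (auto simp: max_def power2_eq_square)
      show "((\<lambda>h::real. \<bar>h\<bar>) \<longlongrightarrow> 0) (at 0)"
        by (rule tendsto_rabs_zero) (rule tendsto_ident_at)
    qed
    then show ?thesis using 2 by (simp add: DERIV_def)
  next
    case 3
    have "((\<lambda>s::real. s\<^sup>2) has_real_derivative 2 * s) (at s)"
      by (auto intro!: derivative_eq_intros)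
    then show ?thesis
      by (rule has_field_derivative_transform_within_open[of _ _ _ "{0<..}", THEN DERIV_cong])
        (use 3 in auto)
  qed
qed

section \<open>Continuity and boundedness of smooth functions\<close>

context corner_manifold
begin

lemma smooth_on_continuous: "smooth_on A f \<Longrightarrow> continuous_on A f"
  unfolding continuous_on_eq_continuous_within
proof
  fix x assume "smooth_on A f" "x \<in> A"
  then obtain W F where W: "open W" "x \<in> W" and F: "\<And>y. y \<in> A \<inter> W \<Longrightarrow> F y = f y"
    and dF: "\<And>y. y \<in> W \<Longrightarrow> (F has_derivative frechet_derivative F (at y)) (at y)"
    and "\<And>v. continuous_on W (\<lambda>y. frechet_derivative F (at y) v)"
    by (rule smooth_on_extension) (rule that)
  have "continuous (at x within A) F"
    using has_derivative_continuous[OF dF[OF W(2)]] continuous_at_imp_continuous_at_within by blast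
  moreover obtain d where "d > 0" "\<And>y. dist y x < d \<Longrightarrow> y \<in> W"
    using W open_dist by metis
  ultimately show "continuous (at x within A) f"
    using F \<open>x \<in> A\<close> by (intro continuous_transform_within[of x A F d f]) auto
qed

lemma compact_chart_ball: "compact (cball x r \<inter> corner B S)"
  by (intro compact_Int_closed compact_cball closed_corner)

lemma smooth_function_continuous:
  assumes r: "smooth_function \<A> r"
  shows "continuous_map X euclideanreal r"
  unfolding continuous_map
proof (intro conjI allI impI)
  fix V :: "real set" assume "openin euclideanreal V"
  then have V: "open V" by simp
  have "\<exists>T. openin X T \<and> p \<in> T \<and> T \<subseteq> {q \<in> topspace X. r q \<in> V}" if p: "p \<in> topspace X" "r p \<in> V" for p
  proof -
    obtain c where c: "c \<in> \<A>" "p \<in> cdom c" using charts_cover p by blast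
    have "continuous_on (cmap c ` cdom c) (r \<circ> cinv c)"
      using r c unfolding smooth_function_def by (intro smooth_on_continuous) blast
    then have "openin (top_of_set (cmap c ` cdom c)) ((cmap c ` cdom c) \<inter> (r \<circ> cinv c) -` V)"
      using V by (rule continuous_openin_preimage_gen)
    then obtain W where W: "open W" "(cmap c ` cdom c) \<inter> (r \<circ> cinv c) -` V = (cmap c ` cdom c) \<inter> W"
      unfolding openin_open by blast
    have "cmap c q \<in> W \<longleftrightarrow> r q \<in> V" if "q \<in> cdom c" for q
    proof -
      have "cmap c q \<in> (cmap c ` cdom c) \<inter> W \<longleftrightarrow> cmap c q \<in> (cmap c ` cdom c) \<inter> (r \<circ> cinv c) -` V"
        using W(2) by simp
      then show ?thesis using that cinv_cmap[OF c(1) that] by simp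
    qed
    then show ?thesis
      using open_preimage[OF c(1) W(1)] c p cdom_sub[OF c(1)]
      by (intro exI[of _ "{q \<in> cdom c. cmap c q \<in> W}"]) auto
  qed
  then show "openin X {q \<in> topspace X. r q \<in> V}"
    by (subst openin_subopen) blast
qed auto

lemma continuous_map_bounded:
  assumes "compact_space X" "continuous_map X euclideanreal r"
  shows "\<exists>R>0. \<forall>p\<in>topspace X. \<bar>r p\<bar> \<le> R"
proof -
  have "compact (r ` topspace X)"
    using image_compactin[of X "topspace X" euclideanreal r] assms by (simp add: compact_space_def)
  then obtain R where "R > 0" "\<forall>x\<in>r ` topspace X. norm x \<le> R"
    using compact_imp_bounded bounded_pos by metis
  then show ?thesis by auto
qed

end

section \<open>Lipschitz test functions\<close>

context riemannian_corner_manifold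
begin

lemma speed_conformal: "speed \<A> (conformal f g) \<gamma> t = sqrt (f (\<gamma> t)) * speed \<A> g \<gamma> t"
  by (simp add: speed_def Let_def conformal_def real_sqrt_mult)

lemma speed_chart:
  assumes "regular_at X \<A> \<gamma> t" "c \<in> \<A>" "\<gamma> t \<in> cdom c" "((cmap c \<circ> \<gamma>) has_vector_derivative v) (at t)"
  shows "speed \<A> g \<gamma> t = sqrt (g c (\<gamma> t) v v)"
proof -
  have "conformal (\<lambda>_. 1) g = g" by (simp add: conformal_def)
  then show ?thesis using speed_in_chart[OF assms, of "\<lambda>_. 1"] by simp
qed

lemma speed_nonneg:
  assumes \<gamma>: "regular_at X \<A> \<gamma> t" shows "0 \<le> speed \<A> g \<gamma> t"
proof -
  have "\<gamma> t \<in> topspace X" using \<gamma> by (simp add: regular_at_def)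
  then obtain c where c: "c \<in> \<A>" "\<gamma> t \<in> cdom c" using charts_cover by blast
  then obtain v where "((cmap c \<circ> \<gamma>) has_vector_derivative v) (at t)"
    using \<gamma> unfolding regular_at_def by blast
  then show ?thesis
    using speed_chart[OF \<gamma> c] metric_nonneg[OF c velocity_in_span[OF \<gamma> c]] by simp
qed

text \<open>Integrating the derivative bounds the increment of \<open>u\<close> along a curve by its
  length. All lower bounds arise in this way: \<open>u\<close> is a multiple of a bump function, or
  of the logarithm of a function vanishing at a boundary point.\<close>

lemma riemannian_dist_ge:
  assumes u: "continuous_map (subtopology X M) euclideanreal u"
    and der: "\<And>\<gamma> t. regular_at X \<A> \<gamma> t \<Longrightarrow> \<gamma> t \<in> M \<Longrightarrow>
      \<exists>D. ((u \<circ> \<gamma>) has_real_derivative D) (at t) \<and> \<bar>D\<bar> \<le> speed \<A> (conformal f g) \<gamma> t"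
  shows "ennreal \<bar>u q - u p\<bar> \<le> riemannian_dist X \<A> M (conformal f g) p q"
  unfolding riemannian_dist_def
proof (rule INF_greatest, safe)
  fix \<gamma> assume \<gamma>: "piecewise_C1_curve X \<A> M \<gamma>"
  obtain F where F: "finite F" "\<And>t. t \<in> {0<..<1} - F \<Longrightarrow> regular_at X \<A> \<gamma> t"
    using piecewise_regular[OF \<gamma>] by blast
  have cont: "continuous_map (top_of_set {0..1}) (subtopology X M) \<gamma>"
    using \<gamma> by (simp add: piecewise_C1_curve_def)
  have "continuous_on {0..1} (u \<circ> \<gamma>)"
    using continuous_map_compose[OF cont u] by simp
  moreover have "\<gamma> t \<in> M" if "t \<in> {0..1}" for t
    using continuous_map_image_subset_topspace[OF cont] that by auto
  ultimately have "ennreal \<bar>(u \<circ> \<gamma>) 1 - (u \<circ> \<gamma>) 0\<bar> \<le> curve_length \<A> (conformal f g) \<gamma>"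
    unfolding curve_length_def using F by (intro increment_le_nn_integral[of _ F] der) auto
  then show "ennreal \<bar>u (\<gamma> 1) - u (\<gamma> 0)\<bar> \<le> curve_length \<A> (conformal f g) \<gamma>" by simp
qed

text \<open>The quadratic form is continuous and positive on the compact product of \<open>K\<close>
  with the unit sphere of \<open>span B\<close>; homogeneity extends the bounds to all
  vectors.\<close>

lemma metric_bounds:
  assumes c: "c \<in> \<A>" and K: "compact K" "K \<subseteq> cmap c ` cdom c"
  shows "\<exists>m>0. \<exists>G>0. \<forall>x\<in>K. \<forall>v\<in>span B. m * norm v \<le> sqrt (g c (cinv c x) v v) \<and> sqrt (g c (cinv c x) v v) \<le> G * norm v"
proof -
  define S where "S = sphere 0 1 \<inter> span B"
  define Q where "Q = (\<lambda>(x, v). g c (cinv c x) v v)"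
  have S: "compact S" unfolding S_def by (intro compact_Int_closed compact_sphere closed_subspace subspace_span)
  have dom: "cinv c x \<in> cdom c" if "x \<in> K" for x
    using cinv_in[OF c] K that by blast
  have coeff: "continuous_on K (\<lambda>x. g c (cinv c x) b b')" if "b \<in> B" "b' \<in> B" for b b'
  proof (rule continuous_on_subset[OF smooth_on_continuous K(2)])
    show "smooth_on (cmap c ` cdom c) (\<lambda>x. g c (cinv c x) b b')"
      using metric c that span_base unfolding riemannian_metric_def by blast
  qed
  \<comment> \<open>Smoothness of the metric is given for fixed vectors only; expansion in the basis
    yields joint continuity in base point and vector.\<close>
  have Q: "Q (x, v) = (\<Sum>b\<in>B. \<Sum>b'\<in>B. (v \<bullet> b) * (v \<bullet> b') * g c (cinv c x) b b')"
    if x: "x \<in> K" and v: "v \<in> span B" for x v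
  proof -
    have "v = (\<Sum>b\<in>Basis. (v \<bullet> b) *\<^sub>R b)" by (simp add: euclidean_representation)
    also have "\<dots> = (\<Sum>b\<in>B. (v \<bullet> b) *\<^sub>R b)"
      using v B_Basis by (intro sum.mono_neutral_right) (auto simp: span_B)
    finally have "Q (x, v) = g c (cinv c x) (\<Sum>b\<in>B. (v \<bullet> b) *\<^sub>R b) (\<Sum>b\<in>B. (v \<bullet> b) *\<^sub>R b)"
      unfolding Q_def by simp
    also have "\<dots> = (\<Sum>b\<in>B. \<Sum>b'\<in>B. (v \<bullet> b) * (v \<bullet> b') * g c (cinv c x) b b')"
      using bilinear_metric[OF c dom[OF x]] finite_B
      by (simp add: bilinear_sum bilinear_lmul bilinear_rmul sum.cartesian_product mult.assoc)
    finally show ?thesis .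
  qed
  have "continuous_on (K \<times> S) (\<lambda>z. \<Sum>b\<in>B. \<Sum>b'\<in>B. (snd z \<bullet> b) * (snd z \<bullet> b') * g c (cinv c (fst z)) b b')"
    by (intro continuous_intros continuous_on_compose2[OF coeff]) auto
  then have contQ: "continuous_on (K \<times> S) Q"
    by (rule continuous_on_eq) (auto simp: Q S_def)
  have "\<exists>m>0. \<exists>G>0. \<forall>z\<in>K \<times> S. m \<le> Q z \<and> Q z \<le> G"
  proof (cases "K \<times> S = {}")
    \<comment> \<open>The unit sphere is empty in dimension 0; any positive constants then
      do.\<close>
    case True
    then show ?thesis by (metis empty_iff zero_less_one)
  next
    case False
    have cpt: "compact (K \<times> S)" using K S by (simp add: compact_Times)
    obtain z where z: "z \<in> K \<times> S" "\<forall>w\<in>K \<times> S. Q z \<le> Q w"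
      using continuous_attains_inf[OF cpt False contQ] by blast
    obtain z' where z': "z' \<in> K \<times> S" "\<forall>w\<in>K \<times> S. Q w \<le> Q z'"
      using continuous_attains_sup[OF cpt False contQ] by blast
    have "0 < Q z"
    proof -
      obtain x y where xy: "z = (x, y)" "x \<in> K" "y \<in> span B" "norm y = 1"
        using z(1) by (auto simp: S_def)
      then have "y \<noteq> 0" by auto
      then show ?thesis using metric_pos[OF c dom] xy by (simp add: Q_def)
    qed
    moreover then have "0 < Q z'" using z z' by fastforce
    ultimately show ?thesis using z z' by blast
  qed
  then obtain m G where mG: "m > 0" "G > 0" and bnd: "\<And>x v. x \<in> K \<Longrightarrow> v \<in> S \<Longrightarrow> m \<le> Q (x, v) \<and> Q (x, v) \<le> G"
    by blast
  have "\<forall>x\<in>K. \<forall>v\<in>span B. sqrt m * norm v \<le> sqrt (g c (cinv c x) v v) \<and> sqrt (g c (cinv c x) v v) \<le> sqrt G * norm v"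
  proof (intro ballI)
    fix x v assume x: "x \<in> K" and v: "v \<in> span B"
    show "sqrt m * norm v \<le> sqrt (g c (cinv c x) v v) \<and> sqrt (g c (cinv c x) v v) \<le> sqrt G * norm v"
    proof (cases "v = 0")
      case True
      then show ?thesis using metric_zero[OF c dom[OF x]] by simp
    next
      case False
      let ?w = "(1 / norm v) *\<^sub>R v"
      have w: "?w \<in> S" using False v by (simp add: S_def span_scale)
      have "v = norm v *\<^sub>R ?w" using False by simp
      then have "g c (cinv c x) v v = (norm v)\<^sup>2 * Q (x, ?w)"
        unfolding Q_def prod.case using metric_scale[OF c dom[OF x], of "norm v" ?w] by simp
      then have "sqrt (g c (cinv c x) v v) = norm v * sqrt (Q (x, ?w))"
        by (simp add: real_sqrt_mult)
      moreover have "norm v * sqrt m \<le> norm v * sqrt (Q (x, ?w)) \<and> norm v * sqrt (Q (x, ?w)) \<le> norm v * sqrt G"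
        using bnd[OF x w] by (auto intro!: mult_left_mono)
      ultimately show ?thesis by (simp add: mult.commute[of "norm v"])
    qed
  qed
  moreover have "0 < sqrt m" "0 < sqrt G" using mG by auto
  ultimately show ?thesis by blast
qed

text \<open>The derivative of an ambient extension is bounded on a compact chart ball, where the
  metric dominates a multiple of the Euclidean norm of the velocity.\<close>

lemma smooth_function_speed_local:
  assumes r: "smooth_function \<A> r" and p: "p \<in> topspace X"
  shows "\<exists>V C. openin X V \<and> p \<in> V \<and> 0 \<le> C \<and> (\<forall>\<gamma> t. regular_at X \<A> \<gamma> t \<and> \<gamma> t \<in> V \<longrightarrow>
    (\<exists>D. ((r \<circ> \<gamma>) has_real_derivative D) (at t) \<and> \<bar>D\<bar> \<le> C * speed \<A> g \<gamma> t))"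
proof -
  obtain c where c: "c \<in> \<A>" "p \<in> cdom c" using charts_cover p by blast
  let ?U = "cmap c ` cdom c" and ?x = "cmap c p"
  have "smooth_on ?U (r \<circ> cinv c)" "?x \<in> ?U"
    using r c by (auto simp: smooth_function_def)
  then obtain W F where W: "open W" "?x \<in> W" and F: "\<And>y. y \<in> ?U \<inter> W \<Longrightarrow> F y = (r \<circ> cinv c) y"
    and dF: "\<And>y. y \<in> W \<Longrightarrow> (F has_derivative frechet_derivative F (at y)) (at y)"
    and contF: "\<And>v. continuous_on W (\<lambda>y. frechet_derivative F (at y) v)"
    by (rule smooth_on_extension) (rule that)
  obtain r1 where r1: "r1 > 0" "\<forall>x\<in>corner B (cfaces c). dist x ?x \<le> r1 \<longrightarrow> x \<in> cmap c ` (cdom c \<inter> topspace X)"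
    using chart_ball[OF c openin_topspace p] by blast
  obtain r2 where r2: "r2 > 0" "cball ?x r2 \<subseteq> W" using W open_contains_cball by blast
  define s where "s = min r1 r2"
  have s: "s > 0" using r1 r2 by (simp add: s_def)
  let ?K = "cball ?x s \<inter> corner B (cfaces c)"
  have K: "compact ?K" by (rule compact_chart_ball)
  have KU: "?K \<subseteq> ?U" using r1(2) by (auto simp: s_def dist_commute)
  have KW: "?K \<subseteq> W" using r2(2) by (auto simp: s_def)
  obtain m where m: "m > 0" "\<And>x v. x \<in> ?K \<Longrightarrow> v \<in> span B \<Longrightarrow> m * norm v \<le> sqrt (g c (cinv c x) v v)"
    using metric_bounds[OF c(1) K KU] by blast
  have "\<exists>C. \<forall>x\<in>?K. \<bar>frechet_derivative F (at x) b\<bar> \<le> C" for b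
  proof -
    have "compact ((\<lambda>x. frechet_derivative F (at x) b) ` ?K)"
      by (intro compact_continuous_image continuous_on_subset[OF contF KW] K)
    then show ?thesis
      by (auto dest!: compact_imp_bounded simp: bounded_iff)
  qed
  then obtain C where C: "\<And>b x. x \<in> ?K \<Longrightarrow> \<bar>frechet_derivative F (at x) b\<bar> \<le> C b" by metis
  define L where "L = (\<Sum>b\<in>Basis. \<bar>C b\<bar>)"
  have L: "\<bar>frechet_derivative F (at x) v\<bar> \<le> L * norm v" if x: "x \<in> ?K" for x v
  proof -
    have lin: "linear (frechet_derivative F (at x))"
      using dF KW x has_derivative_linear by blast
    have "frechet_derivative F (at x) v = frechet_derivative F (at x) (\<Sum>b\<in>Basis. (v \<bullet> b) *\<^sub>R b)"
      by (simp add: euclidean_representation)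
    also have "\<dots> = (\<Sum>b\<in>Basis. (v \<bullet> b) * frechet_derivative F (at x) b)"
      by (simp add: linear_sum[OF lin] linear_scale[OF lin])
    also have "\<bar>\<dots>\<bar> \<le> (\<Sum>b\<in>Basis. \<bar>(v \<bullet> b) * frechet_derivative F (at x) b\<bar>)" by (rule sum_abs)
    also have "\<dots> \<le> (\<Sum>b\<in>Basis. norm v * \<bar>C b\<bar>)"
    proof (rule sum_mono)
      fix b :: 'e assume "b \<in> Basis"
      then show "\<bar>(v \<bullet> b) * frechet_derivative F (at x) b\<bar> \<le> norm v * \<bar>C b\<bar>"
        unfolding abs_mult using C[OF x, of b] Basis_le_norm[of b v]
        by (intro mult_mono) auto
    qed
    also have "\<dots> = L * norm v" by (simp add: L_def sum_distrib_left mult.commute)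
    finally show ?thesis .
  qed
  have L0: "0 \<le> L" by (simp add: L_def sum_nonneg)
  let ?V = "{q \<in> cdom c. cmap c q \<in> ball ?x s}"
  have "\<exists>D. ((r \<circ> \<gamma>) has_real_derivative D) (at t) \<and> \<bar>D\<bar> \<le> L / m * speed \<A> g \<gamma> t"
    if \<gamma>: "regular_at X \<A> \<gamma> t" and V: "\<gamma> t \<in> ?V" for \<gamma> t
  proof -
    have ct: "\<gamma> t \<in> cdom c" using V by simp
    have xK: "cmap c (\<gamma> t) \<in> ?K" using V image_corner[OF c(1)] by auto
    obtain v where v: "((cmap c \<circ> \<gamma>) has_vector_derivative v) (at t)"
      using \<gamma> c ct unfolding regular_at_def by blast
    let ?D = "frechet_derivative F (at (cmap c (\<gamma> t))) v"
    have "((F \<circ> (cmap c \<circ> \<gamma>)) has_vector_derivative ?D) (at t)"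
      by (rule has_vector_derivative_compose_frechet[OF v]) (use dF KW xK in auto)
    moreover have "eventually (\<lambda>s. (F \<circ> (cmap c \<circ> \<gamma>)) s = (r \<circ> \<gamma>) s) (nhds t)"
    proof -
      have "openin X ?V" by (rule open_preimage[OF c(1)]) simp
      then have "eventually (\<lambda>s. \<gamma> s \<in> ?V) (nhds t)"
        using \<gamma> V unfolding regular_at_def by blast
      then show ?thesis
      proof eventually_elim
        fix u assume u: "\<gamma> u \<in> ?V"
        then have "cmap c (\<gamma> u) \<in> ?K" using image_corner[OF c(1)] by auto
        then have "cmap c (\<gamma> u) \<in> ?U \<inter> W" using KU KW by blast
        then show "(F \<circ> (cmap c \<circ> \<gamma>)) u = (r \<circ> \<gamma>) u"
          using F cinv_cmap[OF c(1), of "\<gamma> u"] u by simp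
      qed
    qed
    ultimately have "((r \<circ> \<gamma>) has_vector_derivative ?D) (at t)"
      by (rule has_vector_derivative_transform_eventually) simp
    moreover have "\<bar>?D\<bar> \<le> L / m * speed \<A> g \<gamma> t"
    proof -
      have "m * norm v \<le> speed \<A> g \<gamma> t"
        using m(2)[OF xK velocity_in_span[OF \<gamma> c(1) ct v]] speed_chart[OF \<gamma> c(1) ct v] cinv_cmap[OF c(1) ct] by simp
      then have "L * norm v \<le> L * (speed \<A> g \<gamma> t / m)"
        using m(1) L0 by (intro mult_left_mono) (auto simp: field_simps)
      then show ?thesis using L[OF xK, of v] by simp
    qed
    ultimately show ?thesis by (auto simp: has_real_derivative_iff_has_vector_derivative)
  qed
  moreover have "openin X ?V" by (rule open_preimage[OF c(1)]) simp
  moreover have "p \<in> ?V" using c s by simp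
  ultimately show ?thesis
    using L0 m(1) by (intro exI[of _ ?V] exI[of _ "L / m"]) auto
qed

text \<open>Compactness leaves finitely many local constants, and their sum dominates each of
  them.\<close>

lemma smooth_function_speed:
  assumes X: "compact_space X" and r: "smooth_function \<A> r"
  shows "\<exists>C\<ge>0. \<forall>\<gamma> t. regular_at X \<A> \<gamma> t \<longrightarrow>
    (\<exists>D. ((r \<circ> \<gamma>) has_real_derivative D) (at t) \<and> \<bar>D\<bar> \<le> C * speed \<A> g \<gamma> t)"
proof -
  define P where "P V C \<longleftrightarrow> 0 \<le> C \<and> (\<forall>\<gamma> t. regular_at X \<A> \<gamma> t \<and> \<gamma> t \<in> V \<longrightarrow>
    (\<exists>D. ((r \<circ> \<gamma>) has_real_derivative D) (at t) \<and> \<bar>D\<bar> \<le> C * speed \<A> g \<gamma> t))" for V C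
  have "\<exists>V C. openin X V \<and> p \<in> V \<and> P V C" if "p \<in> topspace X" for p
    using smooth_function_speed_local[OF r that] unfolding P_def by blast
  then obtain V C where VC: "\<And>p. p \<in> topspace X \<Longrightarrow> openin X (V p) \<and> p \<in> V p \<and> P (V p) (C p)"
    by metis
  have "\<forall>U\<in>V ` topspace X. openin X U" "topspace X \<subseteq> \<Union> (V ` topspace X)"
    using VC by auto
  then obtain \<F> where \<F>: "finite \<F>" "\<F> \<subseteq> V ` topspace X" "topspace X \<subseteq> \<Union>\<F>"
    using X unfolding compact_space_alt by metis
  obtain T where T: "finite T" "T \<subseteq> topspace X" "\<F> = V ` T"
    using finite_subset_image[OF \<F>(1,2)] by blast
  define K where "K = (\<Sum>p\<in>T. C p)"
  have C0: "0 \<le> C p" if "p \<in> T" for p using VC that T unfolding P_def by blast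
  have K: "C p \<le> K" if "p \<in> T" for p
    unfolding K_def using C0 T that by (intro member_le_sum) auto
  have "\<exists>D. ((r \<circ> \<gamma>) has_real_derivative D) (at t) \<and> \<bar>D\<bar> \<le> K * speed \<A> g \<gamma> t"
    if \<gamma>: "regular_at X \<A> \<gamma> t" for \<gamma> t
  proof -
    have "\<gamma> t \<in> topspace X" using \<gamma> by (simp add: regular_at_def)
    then obtain p where p: "p \<in> T" "\<gamma> t \<in> V p" using \<F>(3) T by blast
    then have "P (V p) (C p)" using VC T by blast
    then obtain D where D: "((r \<circ> \<gamma>) has_real_derivative D) (at t)" "\<bar>D\<bar> \<le> C p * speed \<A> g \<gamma> t"
      using \<gamma> p unfolding P_def by blast
    have "C p * speed \<A> g \<gamma> t \<le> K * speed \<A> g \<gamma> t"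
      using K[OF p(1)] speed_nonneg[OF \<gamma>] by (rule mult_right_mono)
    then show ?thesis using D by (meson order_trans)
  qed
  moreover have "0 \<le> K" unfolding K_def using C0 by (rule sum_nonneg)
  ultimately show ?thesis by blast
qed

text \<open>The test function is a bump supported in a chart ball inside \<open>W\<close> and
  extended by 0. It equals \<open>r ^ 4\<close> at \<open>p\<close> and exceeds half of that on
  \<open>V\<close>; within distance \<open>r ^ 4 / 2 / L\<close> of a point of \<open>V\<close> it
  stays positive, which keeps the other point in the ball and hence in \<open>W\<close>.\<close>

lemma riemannian_dist_finer:
  assumes p: "p \<in> topspace X" and W: "openin X W" "p \<in> W"
    and \<kappa>: "0 < \<kappa>" "\<And>q. q \<in> M \<Longrightarrow> \<kappa> \<le> sqrt (f q)"
  shows "\<exists>\<epsilon>>0. \<exists>V. openin X V \<and> p \<in> V \<and>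
    (\<forall>x\<in>V \<inter> M. \<forall>y\<in>M. riemannian_dist X \<A> M (conformal f g) x y < \<epsilon> \<longrightarrow> y \<in> W)"
proof -
  obtain c where c: "c \<in> \<A>" "p \<in> cdom c" using charts_cover p by blast
  let ?U = "cmap c ` cdom c" and ?x = "cmap c p"
  obtain r where r: "r > 0" "\<And>x. x\<in>corner B (cfaces c) \<Longrightarrow> dist x ?x \<le> r \<Longrightarrow> x \<in> cmap c ` (cdom c \<inter> W)"
    using chart_ball[OF c W] by blast
  let ?K = "cball ?x r \<inter> corner B (cfaces c)"
  have K: "compact ?K" by (rule compact_chart_ball)
  have KU: "?K \<subseteq> ?U" using r(2) by (force simp: dist_commute)
  obtain m where m: "m > 0" "\<And>x v. x \<in> ?K \<Longrightarrow> v \<in> span B \<Longrightarrow> m * norm v \<le> sqrt (g c (cinv c x) v v)"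
    using metric_bounds[OF c(1) K KU] by blast
  define k where "k y = max 0 (r\<^sup>2 - (y - ?x) \<bullet> (y - ?x))" for y
  define u where "u q = (if q \<in> cdom c then (k (cmap c q))\<^sup>2 else 0)" for q
  have k0: "k y = 0 \<longleftrightarrow> r \<le> norm (y - ?x)" for y
    using r(1) by (simp add: k_def max_def dot_square_norm)
  have kr: "k y \<le> r\<^sup>2" "0 \<le> k y" for y using r(1) by (auto simp: k_def)
  have contk: "continuous_on UNIV k" unfolding k_def by (intro continuous_intros)
  let ?N = "cinv c ` ?K"
  \<comment> \<open>The closed chart ball is compact, hence closed in the Hausdorff space
    \<open>X\<close>. So the complement, on which \<open>u\<close> vanishes, is open, and the
    extension by 0 is continuous and differentiable along curves.\<close>
  have "compactin X ?N"
  proof -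
    have "compactin (top_of_set ?U) ?K" using K KU by (simp add: compactin_subtopology)
    from image_compactin[OF this continuous_map_cinv[OF c(1)]] show ?thesis
      by (simp add: compactin_subtopology)
  qed
  then have N: "closedin X ?N" using Hausdorff by (rule compactin_imp_closedin[rotated])
  have N_iff: "q \<in> ?N" if "q \<in> cdom c" "dist (cmap c q) ?x \<le> r" for q
    using that cinv_cmap[OF c(1) that(1)] image_corner[OF c(1)]
    by (intro image_eqI[of _ _ "cmap c q"]) (auto simp: dist_commute)
  have N_sub: "?N \<subseteq> cdom c" using KU cinv_in[OF c(1)] by blast
  have u0: "u q = 0" if "q \<notin> ?N" for q
    using N_iff[of q] that k0[of "cmap c q"] by (auto simp: u_def dist_norm)
  have contu: "continuous_map X euclideanreal u"
    unfolding continuous_map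
  proof (intro conjI allI impI)
    fix V :: "real set" assume "openin euclideanreal V"
    then have V: "open V" by simp
    have "open ((\<lambda>y. (k y)\<^sup>2) -` V)"
      by (intro open_vimage V continuous_intros contk)
    then have 1: "openin X {q \<in> cdom c. cmap c q \<in> (\<lambda>y. (k y)\<^sup>2) -` V}"
      by (rule open_preimage[OF c(1)])
    have 2: "openin X (if 0 \<in> V then topspace X - ?N else {})" using N by auto
    have "{q \<in> topspace X. u q \<in> V} = {q \<in> cdom c. cmap c q \<in> (\<lambda>y. (k y)\<^sup>2) -` V} \<union> (if 0 \<in> V then topspace X - ?N else {})"
    proof (intro set_eqI)
      fix q
      show "q \<in> {q \<in> topspace X. u q \<in> V} \<longleftrightarrow> q \<in> {q \<in> cdom c. cmap c q \<in> (\<lambda>y. (k y)\<^sup>2) -` V} \<union> (if 0 \<in> V then topspace X - ?N else {})"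
      proof (cases "q \<in> cdom c")
        case True
        then have "u q = (k (cmap c q))\<^sup>2" "q \<in> topspace X" using cdom_sub[OF c(1)] by (auto simp: u_def)
        then show ?thesis using True u0[of q] by (cases "q \<in> ?N") auto
      next
        case False
        then have "u q = 0" "q \<notin> ?N" using N_sub by (auto simp: u_def)
        then show ?thesis using False by simp
      qed
    qed
    then show "openin X {q \<in> topspace X. u q \<in> V}" using 1 2 by auto
  qed auto
  \<comment> \<open>Since \<open>k \<le> r\<^sup>2\<close> and the distance to the centre is below
    \<open>r\<close> where \<open>k\<close> is nonzero, the derivative of the bump is at most
    \<open>4 * r ^ 3 * norm v\<close>. Passing from \<open>norm v\<close> to the conformal speed
    costs the factors \<open>1 / m\<close> and \<open>1 / \<kappa>\<close>.\<close>
  define L where "L = 4 * r ^ 3 / (m * \<kappa>)"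
  have L: "L > 0" using r m \<kappa> by (simp add: L_def)
  have lower: "ennreal \<bar>u q / L - u q' / L\<bar> \<le> riemannian_dist X \<A> M (conformal f g) q' q" for q q'
  proof (rule riemannian_dist_ge[of "\<lambda>q. u q / L"])
    have "continuous_map X euclideanreal (\<lambda>q. u q / L)"
      using L by (intro continuous_map_real_divide contu) auto
    then show "continuous_map (subtopology X M) euclideanreal (\<lambda>q. u q / L)"
      by (rule continuous_map_from_subtopology)
    fix \<gamma> t assume \<gamma>: "regular_at X \<A> \<gamma> t" and M: "\<gamma> t \<in> M"
    have sp: "\<kappa> * speed \<A> g \<gamma> t \<le> speed \<A> (conformal f g) \<gamma> t"
      unfolding speed_conformal using \<kappa>(2)[OF M] speed_nonneg[OF \<gamma>] by (rule mult_right_mono)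
    have sp0: "0 \<le> speed \<A> (conformal f g) \<gamma> t"
      using sp \<kappa>(1) speed_nonneg[OF \<gamma>] by (meson mult_nonneg_nonneg less_imp_le order_trans)
    show "\<exists>D. ((\<lambda>q. u q / L) \<circ> \<gamma> has_real_derivative D) (at t) \<and> \<bar>D\<bar> \<le> speed \<A> (conformal f g) \<gamma> t"
    proof (cases "\<gamma> t \<in> cdom c")
      case True
      obtain v where v: "((cmap c \<circ> \<gamma>) has_vector_derivative v) (at t)"
        using \<gamma> c True unfolding regular_at_def by blast
      let ?z = "\<lambda>s. cmap c (\<gamma> s) - ?x"
      let ?D = "2 * k (cmap c (\<gamma> t)) * (- (2 * (?z t \<bullet> v)))"
      have z: "(?z has_vector_derivative v) (at t)"
        using v by (auto intro!: derivative_eq_intros simp: comp_def)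
      have "((\<lambda>s. r\<^sup>2 - ?z s \<bullet> ?z s) has_vector_derivative 0 - (?z t \<bullet> v + v \<bullet> ?z t)) (at t)"
        by (intro has_vector_derivative_diff has_vector_derivative_const
            bounded_bilinear.has_vector_derivative[OF bounded_bilinear_inner] z)
      then have "((\<lambda>s. r\<^sup>2 - ?z s \<bullet> ?z s) has_real_derivative - (2 * (?z t \<bullet> v))) (at t)"
        by (simp add: has_real_derivative_iff_has_vector_derivative inner_commute)
      from DERIV_chain2[OF DERIV_max_0_power2 this]
      have "((\<lambda>s. (k (cmap c (\<gamma> s)))\<^sup>2) has_real_derivative ?D) (at t)"
        by (simp add: k_def)
      moreover have "eventually (\<lambda>s. (k (cmap c (\<gamma> s)))\<^sup>2 = (u \<circ> \<gamma>) s) (nhds t)"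
      proof -
        have "eventually (\<lambda>s. \<gamma> s \<in> cdom c) (nhds t)"
          using \<gamma> True open_cdom[OF c(1)] unfolding regular_at_def by blast
        then show ?thesis by eventually_elim (simp add: u_def)
      qed
      ultimately have "((u \<circ> \<gamma>) has_real_derivative ?D) (at t)"
        unfolding has_real_derivative_iff_has_vector_derivative
        by (rule has_vector_derivative_transform_eventually) simp
      then have "((\<lambda>s. (u \<circ> \<gamma>) s / L) has_real_derivative ?D / L) (at t)"
        by (rule DERIV_cdivide)
      moreover have "\<bar>?D / L\<bar> \<le> speed \<A> (conformal f g) \<gamma> t"
      proof (cases "norm (?z t) < r")
        case small: True
        then have "cmap c (\<gamma> t) \<in> ?K"
          using True image_corner[OF c(1)] by (auto simp: dist_norm norm_minus_commute)
        from m(2)[OF this velocity_in_span[OF \<gamma> c(1) True v]]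
        have mv: "m * norm v \<le> speed \<A> g \<gamma> t"
          using speed_chart[OF \<gamma> c(1) True v] cinv_cmap[OF c(1) True] by simp
        have "\<bar>?D\<bar> = 4 * k (cmap c (\<gamma> t)) * \<bar>?z t \<bullet> v\<bar>"
          using kr(2) by (simp add: abs_mult)
        also have "\<dots> \<le> 4 * r\<^sup>2 * (r * norm v)"
        proof -
          have "norm (?z t) * norm v \<le> r * norm v"
            using small by (intro mult_right_mono) auto
          then have "\<bar>?z t \<bullet> v\<bar> \<le> r * norm v"
            using Cauchy_Schwarz_ineq2[of "?z t" v] by linarith
          then show ?thesis using kr by (intro mult_mono) auto
        qed
        also have "\<dots> = L * (\<kappa> * (m * norm v))"
          using m \<kappa> by (simp add: L_def power2_eq_square power3_eq_cube)
        also have "\<dots> \<le> L * speed \<A> (conformal f g) \<gamma> t"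
        proof -
          have "\<kappa> * (m * norm v) \<le> \<kappa> * speed \<A> g \<gamma> t"
            using mv \<kappa>(1) by simp
          then show ?thesis using sp L by simp
        qed
        finally show ?thesis using L by (simp add: abs_divide pos_divide_le_eq mult.commute)
      next
        case False
        then have "\<bar>?D / L\<bar> = 0" using k0[of "cmap c (\<gamma> t)"] by simp
        then show ?thesis using sp0 by linarith
      qed
      ultimately show ?thesis by (auto simp: comp_def)
    next
      case False
      then have "\<gamma> t \<in> topspace X - ?N" using N_sub \<gamma> by (auto simp: regular_at_def)
      then have "eventually (\<lambda>s. \<gamma> s \<in> topspace X - ?N) (nhds t)"
        using \<gamma> N unfolding regular_at_def by blast
      then have "eventually (\<lambda>s. 0 = ((\<lambda>q. u q / L) \<circ> \<gamma>) s) (nhds t)"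
        by eventually_elim (simp add: u0)
      then have "(((\<lambda>q. u q / L) \<circ> \<gamma>) has_vector_derivative 0) (at t)"
        by (rule has_vector_derivative_transform_eventually[OF has_vector_derivative_const]) simp
      then show ?thesis using sp0
        by (intro exI[of _ 0]) (simp add: has_real_derivative_iff_has_vector_derivative)
    qed
  qed
  let ?V = "{q \<in> topspace X. u q \<in> {r ^ 4 / 2<..}}"
  have "openin X ?V"
    by (rule openin_continuous_map_preimage[OF contu]) auto
  moreover have "p \<in> ?V"
    using p c r by (simp add: u_def k_def flip: power_mult)
  moreover have "y \<in> W" if x: "x \<in> ?V" and d: "riemannian_dist X \<A> M (conformal f g) x y < ennreal (r ^ 4 / 2 / L)" for x y
  proof -
    have "ennreal \<bar>u y / L - u x / L\<bar> < ennreal (r ^ 4 / 2 / L)"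
      using lower[of y x] d by (rule le_less_trans)
    then have "\<bar>u y / L - u x / L\<bar> < r ^ 4 / 2 / L"
      by (simp add: ennreal_less_iff)
    then have "\<bar>u y - u x\<bar> / L < r ^ 4 / 2 / L"
      using L by (simp add: abs_divide flip: diff_divide_distrib)
    then have "\<bar>u y - u x\<bar> < r ^ 4 / 2"
      using L divide_right_mono[of "r ^ 4 / 2" "\<bar>u y - u x\<bar>" L] by linarith
    moreover have "r ^ 4 / 2 < u x" using x by simp
    ultimately have "0 < u y" by linarith
    then have y: "y \<in> cdom c" "k (cmap c y) \<noteq> 0" by (auto simp: u_def split: if_splits)
    then have "cmap c y \<in> cmap c ` (cdom c \<inter> W)"
      using k0[of "cmap c y"] image_corner[OF c(1)] by (intro r(2)) (auto simp: dist_norm)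
    then show ?thesis
      using y(1) inj_cmap[OF c(1)] by (auto dest: inj_onD)
  qed
  moreover have "0 < ennreal (r ^ 4 / 2 / L)" using r L by simp
  ultimately show ?thesis by blast
qed

text \<open>By the assumption on \<open>\<kappa>\<close>, the conformal speed is at least
  \<open>\<kappa> / \<phi>\<close> times the speed for \<open>g\<close>, which is what bounds the
  logarithmic derivative of \<open>\<phi>\<close>. Along a Cauchy sequence \<open>\<phi>\<close> is
  then bounded away from 0.\<close>

lemma cauchy_limit_nonzero:
  assumes \<phi>: "continuous_map X euclideanreal \<phi>" "\<And>q. q \<in> M \<Longrightarrow> 0 < \<phi> q"
    and C: "\<And>\<gamma> t. regular_at X \<A> \<gamma> t \<Longrightarrow> \<gamma> t \<in> M \<Longrightarrow>
      \<exists>D. ((\<phi> \<circ> \<gamma>) has_real_derivative D) (at t) \<and> \<bar>D\<bar> \<le> C * speed \<A> g \<gamma> t"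
    and \<kappa>: "0 < \<kappa>" "\<And>q. q \<in> M \<Longrightarrow> \<kappa> \<le> \<phi> q * sqrt (f q)"
    and \<sigma>: "\<sigma> \<in> cauchy_seqs M (riemannian_dist X \<A> M (conformal f g))" "limitin X \<sigma> p sequentially"
  shows "\<phi> p \<noteq> 0"
proof
  assume p0: "\<phi> p = 0"
  \<comment> \<open>A Lipschitz constant for \<open>ln \<phi>\<close>; the added 1 keeps it positive
    when \<open>C = 0\<close>.\<close>
  define L where "L = (\<bar>C\<bar> + 1) / \<kappa>"
  have L: "L > 0" using \<kappa>(1) by (simp add: L_def)
  have lower: "ennreal \<bar>ln (\<phi> q) / L - ln (\<phi> q') / L\<bar> \<le> riemannian_dist X \<A> M (conformal f g) q' q" for q q'
  proof (rule riemannian_dist_ge[of "\<lambda>q. ln (\<phi> q) / L"])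
    have 1: "continuous_map (subtopology X M) (top_of_set {0<..}) \<phi>"
      using \<phi> by (auto simp: continuous_map_in_subtopology continuous_map_from_subtopology)
    have 2: "continuous_map (top_of_set {0<..}) euclideanreal (\<lambda>x. ln x / L)"
      using L by (auto intro!: continuous_intros)
    show "continuous_map (subtopology X M) euclideanreal (\<lambda>q. ln (\<phi> q) / L)"
      using continuous_map_compose[OF 1 2] by (simp add: comp_def)
    fix \<gamma> t assume \<gamma>: "regular_at X \<A> \<gamma> t" and M: "\<gamma> t \<in> M"
    obtain D where D: "((\<phi> \<circ> \<gamma>) has_real_derivative D) (at t)" "\<bar>D\<bar> \<le> C * speed \<A> g \<gamma> t"
      using C[OF \<gamma> M] by blast
    note pos = \<phi>(2)[OF M]
    have "((\<lambda>s. ln ((\<phi> \<circ> \<gamma>) s)) has_real_derivative inverse (\<phi> (\<gamma> t)) * D) (at t)"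
      using DERIV_chain2[OF DERIV_ln D(1)] pos by simp
    then have "((\<lambda>s. ln ((\<phi> \<circ> \<gamma>) s) / L) has_real_derivative inverse (\<phi> (\<gamma> t)) * D / L) (at t)"
      by (rule DERIV_cdivide)
    moreover have "\<bar>inverse (\<phi> (\<gamma> t)) * D / L\<bar> \<le> speed \<A> (conformal f g) \<gamma> t"
    proof -
      let ?s = "speed \<A> g \<gamma> t"
      have s0: "0 \<le> ?s" by (rule speed_nonneg[OF \<gamma>])
      have "\<bar>D\<bar> \<le> (\<bar>C\<bar> + 1) * ?s"
        using D(2) s0 by (meson abs_ge_self add_increasing2 mult_right_mono order_trans zero_le_one)
      also have "\<dots> = L * (\<kappa> * ?s)" using \<kappa>(1) by (simp add: L_def)
      also have "\<dots> \<le> L * (\<phi> (\<gamma> t) * sqrt (f (\<gamma> t)) * ?s)"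
        using L \<kappa>(2)[OF M] s0 by (intro mult_left_mono mult_right_mono) auto
      finally have "\<bar>D\<bar> \<le> L * \<phi> (\<gamma> t) * speed \<A> (conformal f g) \<gamma> t"
        by (simp add: speed_conformal mult.assoc)
      then show ?thesis using L pos
        by (simp add: abs_mult abs_divide divide_simps mult.commute mult.left_commute)
    qed
    ultimately show "\<exists>D. ((\<lambda>q. ln (\<phi> q) / L) \<circ> \<gamma> has_real_derivative D) (at t) \<and>
        \<bar>D\<bar> \<le> speed \<A> (conformal f g) \<gamma> t"
      by (auto simp: comp_def)
  qed
  have \<sigma>M: "\<sigma> n \<in> M" for n using \<sigma>(1) by (rule cauchy_seqs_mem)
  obtain K where K: "\<forall>m\<ge>K. \<forall>n\<ge>K. riemannian_dist X \<A> M (conformal f g) (\<sigma> m) (\<sigma> n) < 1"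
    using cauchy_seqsD[OF \<sigma>(1), of 1] by auto
  have bound: "ln (\<phi> (\<sigma> K)) - L \<le> ln (\<phi> (\<sigma> n))" if "n \<ge> K" for n
  proof -
    have "riemannian_dist X \<A> M (conformal f g) (\<sigma> K) (\<sigma> n) < ennreal 1"
      using K that by simp
    with lower have "ennreal \<bar>ln (\<phi> (\<sigma> n)) / L - ln (\<phi> (\<sigma> K)) / L\<bar> < ennreal 1"
      by (rule le_less_trans)
    then have "\<bar>ln (\<phi> (\<sigma> n)) / L - ln (\<phi> (\<sigma> K)) / L\<bar> < 1"
      using ennreal_less_iff abs_ge_zero by blast
    then have "\<bar>ln (\<phi> (\<sigma> n)) - ln (\<phi> (\<sigma> K))\<bar> < L"
      using L by (simp add: abs_divide flip: diff_divide_distrib)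
    then show ?thesis by linarith
  qed
  have ev: "eventually (\<lambda>n. exp (ln (\<phi> (\<sigma> K)) - L) \<le> \<phi> (\<sigma> n)) sequentially"
    unfolding eventually_sequentially
  proof (intro exI allI impI)
    fix n assume "K \<le> n"
    then show "exp (ln (\<phi> (\<sigma> K)) - L) \<le> \<phi> (\<sigma> n)"
      using bound[of n] \<phi>(2)[OF \<sigma>M[of n]] by (metis exp_le_cancel_iff exp_ln)
  qed
  have "limitin euclideanreal (\<phi> \<circ> \<sigma>) (\<phi> p) sequentially"
    using \<phi>(1) \<sigma>(2) by (rule continuous_map_limit)
  then have "(\<lambda>n. \<phi> (\<sigma> n)) \<longlonglongrightarrow> \<phi> p" by (simp add: comp_def)
  then have "exp (ln (\<phi> (\<sigma> K)) - L) \<le> \<phi> p"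
    using ev by (rule tendsto_lowerbound) simp
  then show False using p0 exp_gt_zero[of "ln (\<phi> (\<sigma> K)) - L"] by linarith
qed

end

section \<open>Upper bounds for the distance\<close>

context riemannian_corner_manifold
begin

text \<open>A segment is smooth in its own chart, but \<open>C1_arc\<close> demands in every other
  chart one derivative that is continuous on all times spent there, while smoothness of the
  transition map gives only local extensions. The local derivatives are glued by uniqueness.\<close>

lemma C1_arc_segment:
  assumes c: "c \<in> \<A>" and seg: "\<And>t. t \<in> {0..1} \<Longrightarrow> z + t *\<^sub>R w \<in> cmap c ` cdom c"
  shows "C1_arc \<A> 0 1 (\<lambda>t. cinv c (z + t *\<^sub>R w))"
  unfolding C1_arc_def
proof
  let ?z = "\<lambda>t. z + t *\<^sub>R w" and ?\<gamma> = "\<lambda>t. cinv c (z + t *\<^sub>R w)"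
  fix c' assume c': "c' \<in> \<A>"
  let ?D = "{u \<in> {0..1}. ?\<gamma> u \<in> cdom c'}" and ?A = "cmap c ` (cdom c \<inter> cdom c')"
  define \<gamma>' where "\<gamma>' u = vector_derivative (cmap c' \<circ> ?\<gamma>) (at u within {0..1})" for u :: real
  have zc: "cmap c (?\<gamma> u) = ?z u" "?\<gamma> u \<in> cdom c" if "u \<in> {0..1}" for u
    using seg[OF that] cmap_cinv[OF c] cinv_in[OF c] by auto
  have zA: "?z u \<in> ?A" if "u \<in> ?D" for u
    using zc[of u] that by (metis (mono_tags, lifting) Int_iff image_eqI mem_Collect_eq)
  have cont\<gamma>: "continuous_map (top_of_set {0..1}) X ?\<gamma>"
  proof -
    have "continuous_map (top_of_set {0..1}) (top_of_set (cmap c ` cdom c)) ?z"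
      using seg by (auto intro!: continuous_intros)
    from continuous_map_compose[OF this continuous_map_cinv[OF c]] show ?thesis
      using continuous_map_in_subtopology by (auto simp: comp_def)
  qed
  have "openin (top_of_set {0..1}) ?D"
    using openin_continuous_map_preimage[OF cont\<gamma> open_cdom[OF c']] by simp
  then obtain O1 where O1: "open O1" "?D = {0..1} \<inter> O1" unfolding openin_open by blast
  have main: "\<exists>W F'. open W \<and> u \<in> W \<and> continuous_on W F' \<and>
      (\<forall>s\<in>{0..1} \<inter> W. ((cmap c' \<circ> ?\<gamma>) has_vector_derivative F' s) (at s within {0..1}))"
    if u: "u \<in> ?D" for u
  proof -
    have "smooth_on ?A (cmap c' \<circ> cinv c)"
      using mwc c c' by (simp add: manifold_with_corners_def)
    then obtain W F where W: "open W" "?z u \<in> W"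
      and F: "\<And>y. y \<in> ?A \<inter> W \<Longrightarrow> F y = (cmap c' \<circ> cinv c) y"
      and dF: "\<And>y. y \<in> W \<Longrightarrow> (F has_derivative frechet_derivative F (at y)) (at y)"
      and cF: "\<And>v. continuous_on W (\<lambda>y. frechet_derivative F (at y) v)"
      using zA[OF u] by (rule smooth_on_extension) (rule that)
    let ?W = "O1 \<inter> ?z -` W" and ?F' = "\<lambda>s. frechet_derivative F (at (?z s)) w"
    have contz: "continuous_on UNIV ?z" by (intro continuous_intros)
    have oW: "open ?W" by (intro open_Int O1 open_vimage[OF W(1)] contz)
    have "continuous_on ?W ?F'"
      by (rule continuous_on_compose2[OF cF continuous_on_subset[OF contz]]) auto
    moreover have "((cmap c' \<circ> ?\<gamma>) has_vector_derivative ?F' s) (at s within {0..1})"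
      if s: "s \<in> {0..1} \<inter> ?W" for s
    proof -
      have "(?z has_vector_derivative w) (at s within {0..1})"
        by (auto intro!: derivative_eq_intros)
      then have d: "((F \<circ> ?z) has_vector_derivative ?F' s) (at s within {0..1})"
        by (rule has_vector_derivative_compose_frechet) (use dF s in auto)
      obtain e where e: "e > 0" "\<And>s'. dist s' s < e \<Longrightarrow> s' \<in> ?W"
        using oW s unfolding open_dist by blast
      show ?thesis
      proof (rule has_vector_derivative_transform_within[OF d e(1)])
        fix s' assume s': "s' \<in> {0..1}" "dist s' s < e"
        then have "s' \<in> ?D" "?z s' \<in> W" using e(2) O1(2) by blast+
        then show "(F \<circ> ?z) s' = (cmap c' \<circ> ?\<gamma>) s'"
          using F[of "?z s'"] zA by simp
      qed (use s in simp)
    qed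
    moreover have "u \<in> ?W" using u O1(2) W(2) by blast
    ultimately show ?thesis using oW by blast
  qed
  \<comment> \<open>Each local extension therefore reproduces the globally defined
    \<open>\<gamma>'\<close>, which inherits continuity from it.\<close>
  have unique: "\<gamma>' s = v" if "s \<in> {0..1}" "((cmap c' \<circ> ?\<gamma>) has_vector_derivative v) (at s within {0..1})" for s v
    unfolding \<gamma>'_def by (rule vector_derivative_within_closed_interval[OF _ that]) simp
  show "\<exists>\<gamma>'. continuous_on ?D \<gamma>' \<and> (\<forall>u\<in>{0..1}. ?\<gamma> u \<in> cdom c' \<longrightarrow>
      ((cmap c' \<circ> ?\<gamma>) has_vector_derivative \<gamma>' u) (at u within {0..1}))"
  proof (intro exI[of _ \<gamma>'] conjI ballI impI)
    show "continuous_on ?D \<gamma>'"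
      unfolding continuous_on_eq_continuous_within
    proof
      fix u assume u: "u \<in> ?D"
      obtain W F' where W: "open W" "u \<in> W" "continuous_on W F'"
        and d: "\<forall>s\<in>{0..1} \<inter> W. ((cmap c' \<circ> ?\<gamma>) has_vector_derivative F' s) (at s within {0..1})"
        using main[OF u] by blast
      have eq: "\<gamma>' s = F' s" if "s \<in> {0..1} \<inter> W" for s
        using unique d that by blast
      have "continuous (at u within ?D) F'"
        using W continuous_on_eq_continuous_at continuous_at_imp_continuous_at_within by blast
      moreover obtain e where "e > 0" "\<And>s. dist s u < e \<Longrightarrow> s \<in> W"
        using W(1,2) unfolding open_dist by blast
      ultimately show "continuous (at u within ?D) \<gamma>'"
        using u eq by (intro continuous_transform_within[of u ?D F' e \<gamma>']) auto
    qed
    fix u assume "u \<in> {0..1}" "?\<gamma> u \<in> cdom c'"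
    then have u: "u \<in> ?D" by simp
    obtain W F' where W: "u \<in> W"
      and d: "\<forall>s\<in>{0..1} \<inter> W. ((cmap c' \<circ> ?\<gamma>) has_vector_derivative F' s) (at s within {0..1})"
      using main[OF u] by blast
    have "((cmap c' \<circ> ?\<gamma>) has_vector_derivative F' u) (at u within {0..1})" using d W u by blast
    then show "((cmap c' \<circ> ?\<gamma>) has_vector_derivative \<gamma>' u) (at u within {0..1})"
      using unique u by simp
  qed
qed

text \<open>The bound is asked on the open interval because \<open>h\<close> will be a multiple of
  \<open>t powr (- a)\<close>, which evaluates to 0 at \<open>t = 0\<close>.\<close>

lemma riemannian_dist_segment_le:
  assumes c: "c \<in> \<A>" and seg: "\<And>t. t \<in> {0..1} \<Longrightarrow> z + t *\<^sub>R w \<in> cmap c ` cdom c"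
    and M: "\<And>t. t \<in> {0..1} \<Longrightarrow> cinv c (z + t *\<^sub>R w) \<in> M"
    and h: "\<And>t. t \<in> {0<..<1} \<Longrightarrow>
      sqrt (f (cinv c (z + t *\<^sub>R w))) * sqrt (g c (cinv c (z + t *\<^sub>R w)) w w) \<le> h t"
  shows "riemannian_dist X \<A> M (conformal f g) (cinv c z) (cinv c (z + w)) \<le> (\<integral>\<^sup>+t\<in>{0..1}. ennreal (h t) \<partial>lborel)"
proof -
  let ?z = "\<lambda>t. z + t *\<^sub>R w" and ?\<gamma> = "\<lambda>t. cinv c (z + t *\<^sub>R w)"
  have arc: "C1_arc \<A> 0 1 ?\<gamma>" using c seg by (rule C1_arc_segment)
  have "continuous_map (top_of_set {0..1}) (top_of_set (cmap c ` cdom c)) ?z"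
    using seg by (auto intro!: continuous_intros)
  from continuous_map_compose[OF this continuous_map_cinv[OF c]]
  have cont: "continuous_map (top_of_set {0..1}) (subtopology X M) ?\<gamma>"
    using M by (auto simp: comp_def continuous_map_in_subtopology)
  have pc: "piecewise_C1_curve X \<A> M ?\<gamma>"
    unfolding piecewise_C1_curve_iff
  proof (intro conjI cont exI[of _ "{}"] allI impI)
    fix s t :: real assume "0 \<le> s \<and> s < t \<and> t \<le> 1 \<and> {s<..<t} \<inter> {} = {}"
    then show "C1_arc \<A> s t ?\<gamma>" by (intro C1_arc_mono[OF arc]) auto
  qed simp
  obtain F where F: "finite F" "\<And>t. t \<in> {0<..<1} - F \<Longrightarrow> regular_at X \<A> ?\<gamma> t"
    using piecewise_regular[OF pc] by blast
  have sp: "speed \<A> (conformal f g) ?\<gamma> t \<le> h t" if t: "t \<in> {0<..<1} - F" for t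
  proof -
    have "(?z has_vector_derivative w) (at t)" by (auto intro!: derivative_eq_intros)
    moreover have "eventually (\<lambda>s. s \<in> {0<..<1}) (nhds t)"
      using t by (intro eventually_nhds_in_open) auto
    then have "eventually (\<lambda>s. ?z s = (cmap c \<circ> ?\<gamma>) s) (nhds t)"
      by eventually_elim (use seg cmap_cinv[OF c] in auto)
    ultimately have "((cmap c \<circ> ?\<gamma>) has_vector_derivative w) (at t)"
      by (rule has_vector_derivative_transform_eventually) simp
    then show ?thesis
      using speed_in_chart[OF F(2)[OF t] c, of w f] cinv_in[OF c seg, of t] h[of t] t by simp
  qed
  have "AE t in lborel. t \<notin> {0, 1} \<union> F"
    using F(1) by (intro AE_not_in finite_imp_null_set_lborel) auto
  then have "AE t in lborel. ennreal (speed \<A> (conformal f g) ?\<gamma> t) * indicator {0..1} t \<le> ennreal (h t) * indicator {0..1} t"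
    by eventually_elim (use sp in \<open>auto simp: indicator_def intro!: ennreal_leI\<close>)
  then have "curve_length \<A> (conformal f g) ?\<gamma> \<le> (\<integral>\<^sup>+t\<in>{0..1}. ennreal (h t) \<partial>lborel)"
    unfolding curve_length_def by (rule nn_integral_mono_AE)
  moreover have "riemannian_dist X \<A> M (conformal f g) (cinv c z) (cinv c (z + w)) \<le> curve_length \<A> (conformal f g) ?\<gamma>"
    unfolding riemannian_dist_def using pc by (intro INF_lower) auto
  ultimately show ?thesis by (rule order_trans[rotated])
qed

text \<open>The case \<open>a = 0\<close> serves segments whose speed is bounded by a
  constant.\<close>

lemma nn_integral_powr_unit:
  assumes "a < (1::real)" "0 \<le> K"
  shows "(\<integral>\<^sup>+t\<in>{0..1}. ennreal (K * t powr (- a)) \<partial>lborel) = ennreal (K / (1 - a))"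
proof -
  have "((\<lambda>t. t powr (- a)) has_integral (1 powr (- a + 1) / (- a + 1))) {0..1::real}"
    using assms by (intro has_integral_powr_from_0) auto
  from has_integral_mult_right[OF this, of K]
  have "((\<lambda>t. K * t powr (- a)) has_integral K / (1 - a)) {0..1}"
    by (simp add: algebra_simps)
  from nn_integral_has_integral_lebesgue'[OF _ this] show ?thesis using assms by simp
qed

text \<open>Two points at distance less than \<open>\<delta>\<close> from the corner point \<open>cmap c p\<close> are joined by pushing both
  inwards by \<open>\<delta>\<close> along the diagonal \<open>e\<close> of the faces through that point, where all the
  vanishing coordinates are at least \<open>\<delta>\<close>. The total length is of order \<open>\<delta> powr (1 - s / 2)\<close>.\<close>

lemma riemannian_dist_coarser:
  fixes s C r :: real
  assumes c: "c \<in> \<A>" and p: "p \<in> cdom c" and s: "0 \<le> s" "s < 2" and C: "0 \<le> C" and r: "0 < r"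
    and ball: "\<And>y. y \<in> corner B (cfaces c) \<Longrightarrow> dist y (cmap c p) \<le> r \<Longrightarrow> y \<in> cmap c ` cdom c"
    and bound: "\<And>y t. y \<in> corner B (cfaces c) \<Longrightarrow> dist y (cmap c p) \<le> r \<Longrightarrow> 0 < t \<Longrightarrow> t \<le> 1 \<Longrightarrow>
      (\<forall>b\<in>cfaces c. cmap c p \<bullet> b = 0 \<longrightarrow> t \<le> y \<bullet> b) \<Longrightarrow>
      cinv c y \<in> M \<and> f (cinv c y) \<le> C * t powr (- s)"
    and \<epsilon>: "0 < (\<epsilon>::ennreal)"
  shows "\<exists>V. openin X V \<and> p \<in> V \<and> (\<forall>x\<in>V \<inter> M. \<forall>y\<in>V \<inter> M. riemannian_dist X \<A> M (conformal f g) x y < \<epsilon>)"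
proof -
  let ?x = "cmap c p" and ?d = "riemannian_dist X \<A> M (conformal f g)"
  let ?Co = "corner B (cfaces c)"
  let ?S = "{b \<in> cfaces c. ?x \<bullet> b = 0}"
  \<comment> \<open>If no face passes through the point, then \<open>e = 0\<close> and the pushes
    are constant curves.\<close>
  define e where "e = (\<Sum>b\<in>?S. b)"
  define a where "a = s / 2"
  have a: "0 \<le> a" "a < 1" using s by (auto simp: a_def)
  have SB: "?S \<subseteq> B" using faces_B[OF c] by blast
  then have S: "finite ?S" "?S \<subseteq> Basis" using finite_B finite_subset B_Basis by blast+
  have e_in: "e \<bullet> b = (if b \<in> ?S then 1 else 0)" if "b \<in> Basis" for b
  proof -
    have "e \<bullet> b = (\<Sum>b'\<in>?S. if b' = b then 1 else 0)"
      unfolding e_def inner_sum_left using S(2) that by (intro sum.cong) (auto simp: inner_Basis)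
    then show ?thesis using S(1) by simp
  qed
  have eB: "e \<in> span B" unfolding e_def using SB by (intro span_sum span_base) auto
  have faces: "b \<in> Basis" if "b \<in> cfaces c" for b using that faces_B[OF c] B_Basis by blast
  have e0: "0 \<le> e \<bullet> b" if "b \<in> cfaces c" for b using e_in faces that by simp
  let ?K = "cball ?x r \<inter> ?Co"
  have K: "compact ?K" by (rule compact_chart_ball)
  have KU: "?K \<subseteq> cmap c ` cdom c" using ball by (auto simp: dist_commute)
  obtain G where G: "G > 0" "\<And>y v. y \<in> ?K \<Longrightarrow> v \<in> span B \<Longrightarrow> sqrt (g c (cinv c y) v v) \<le> G * norm v"
    using metric_bounds[OF c K KU] by blast
  \<comment> \<open>The two pushes contribute \<open>norm e / (1 - a)\<close> each, the segment
    between the pushed points contributes 2.\<close>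
  define k where "k = sqrt C * G * (2 * norm e / (1 - a) + 2)"
  have k: "0 \<le> k" unfolding k_def using C G a by (intro mult_nonneg_nonneg add_nonneg_nonneg divide_nonneg_nonneg) auto
  \<comment> \<open>\<open>\<epsilon>\<close> may be infinite, so a real number below it is
    chosen.\<close>
  obtain \<epsilon>' where \<epsilon>': "0 < \<epsilon>'" "ennreal \<epsilon>' < \<epsilon>"
  proof (cases \<epsilon>)
    case (real x)
    then show ?thesis using \<epsilon> by (intro that[of "x/2"]) (auto simp: ennreal_less_iff)
  next
    case top
    then show ?thesis by (intro that[of 1]) auto
  qed
  \<comment> \<open>The first two bounds keep the depth in \<open>(0, 1]\<close> and the pushed
    points within radius \<open>r\<close>. The last one gives
    \<open>k * \<delta> powr (1 - a) < \<epsilon>'\<close>, where \<open>k + 1\<close> avoids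
    division by 0 and makes the inequality strict.\<close>
  define \<delta> where "\<delta> = min (min 1 (r / (1 + norm e))) ((\<epsilon>' / (k + 1)) powr (1 / (1 - a)))"
  have e1: "0 < 1 + norm e" using norm_ge_zero[of e] by linarith
  have \<delta>: "0 < \<delta>" "\<delta> \<le> 1" using r \<epsilon>' k e1 by (auto simp: \<delta>_def)
  have \<delta>r: "\<delta> + \<delta> * norm e \<le> r"
  proof -
    have "\<delta> \<le> r / (1 + norm e)" by (simp add: \<delta>_def)
    then have "\<delta> * (1 + norm e) \<le> r" using e1 by (simp add: pos_le_divide_eq)
    then show ?thesis by (simp add: algebra_simps)
  qed
  have k\<delta>: "k * \<delta> powr (1 - a) < \<epsilon>'"
  proof -
    have "\<delta> powr (1 - a) \<le> ((\<epsilon>' / (k + 1)) powr (1 / (1 - a))) powr (1 - a)"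
      using \<delta> a by (intro powr_mono2) (auto simp: \<delta>_def)
    also have "\<dots> = \<epsilon>' / (k + 1)" using a \<epsilon>' k by (simp add: powr_powr)
    finally have "k * \<delta> powr (1 - a) \<le> k * (\<epsilon>' / (k + 1))" using k by (rule mult_left_mono)
    also have "\<dots> < \<epsilon>'" using k \<epsilon>'(1) by (simp add: field_simps)
    finally show ?thesis .
  qed
  have \<delta>pow: "\<delta> * \<delta> powr (- a) = \<delta> powr (1 - a)"
    using \<delta>(1) by (simp add: powr_diff powr_minus divide_inverse)
  have sqrt_bound: "sqrt (f (cinv c y)) \<le> sqrt C * t powr (- a)"
    if "y \<in> ?K" "0 < t" "t \<le> 1" "\<forall>b\<in>cfaces c. ?x \<bullet> b = 0 \<longrightarrow> t \<le> y \<bullet> b" for y t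
  proof -
    have "f (cinv c y) \<le> C * t powr (- s)" using bound[of y t] that by (auto simp: dist_commute)
    then have "sqrt (f (cinv c y)) \<le> sqrt (C * t powr (- s))" by simp
    also have "t powr (- s) = (t powr (- a))\<^sup>2"
      using that by (simp add: a_def power2_eq_square flip: powr_add)
    then have "sqrt (C * t powr (- s)) = sqrt C * t powr (- a)"
      by (simp add: real_sqrt_mult)
    finally show ?thesis .
  qed
  have inside: "z + t *\<^sub>R e \<in> ?K" "\<forall>b\<in>cfaces c. ?x \<bullet> b = 0 \<longrightarrow> t \<le> (z + t *\<^sub>R e) \<bullet> b"
    if z: "z \<in> ?Co" "dist z ?x \<le> \<delta>" and t: "0 \<le> t" "t \<le> \<delta>" for z t
  proof -
    have "norm (z + t *\<^sub>R e - ?x) \<le> norm (z - ?x) + norm (t *\<^sub>R e)"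
      by (metis add_diff_eq add.commute diff_add_eq norm_triangle_ineq)
    also have "\<dots> \<le> \<delta> + \<delta> * norm e"
      using z(2) t by (intro add_mono) (auto simp: dist_norm mult_right_mono)
    finally have "norm (z + t *\<^sub>R e - ?x) \<le> r" using \<delta>r by linarith
    moreover have "z + t *\<^sub>R e \<in> ?Co"
      using z(1) eB e0 t by (auto simp: corner_def inner_add_left intro!: span_add span_scale)
    ultimately show "z + t *\<^sub>R e \<in> ?K" by (simp add: dist_norm norm_minus_commute)
    show "\<forall>b\<in>cfaces c. ?x \<bullet> b = 0 \<longrightarrow> t \<le> (z + t *\<^sub>R e) \<bullet> b"
      using z(1) e_in faces by (auto simp: corner_def inner_add_left)
  qed
  have push: "?d (cinv c z) (cinv c (z + \<delta> *\<^sub>R e)) \<le> ennreal (sqrt C * G * norm e / (1 - a) * \<delta> powr (1 - a))"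
    if z: "z \<in> ?Co" "dist z ?x \<le> \<delta>" "cinv c z \<in> M" for z
  proof -
    \<comment> \<open>At time \<open>t\<close> all vanishing coordinates are at least
      \<open>t * \<delta>\<close>. Splitting \<open>\<delta> powr (- a)\<close> off the bound leaves
      an integrable power of \<open>t\<close>.\<close>
    let ?k = "sqrt C * \<delta> powr (- a) * (G * (\<delta> * norm e))"
    have pt: "z + t *\<^sub>R \<delta> *\<^sub>R e \<in> ?K" "\<forall>b\<in>cfaces c. ?x \<bullet> b = 0 \<longrightarrow> t * \<delta> \<le> (z + t *\<^sub>R \<delta> *\<^sub>R e) \<bullet> b"
      if "t \<in> {0..1}" for t
      using inside[OF z(1,2), of "t * \<delta>"] that \<delta> by (auto simp: mult_le_cancel_right2)
    have "?d (cinv c z) (cinv c (z + \<delta> *\<^sub>R e)) \<le> (\<integral>\<^sup>+t\<in>{0..1}. ennreal (?k * t powr (- a)) \<partial>lborel)"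
    proof (rule riemannian_dist_segment_le[OF c])
      fix t :: real assume t: "t \<in> {0..1}"
      show "z + t *\<^sub>R \<delta> *\<^sub>R e \<in> cmap c ` cdom c" using pt(1)[OF t] KU by blast
      \<comment> \<open>\<open>bound\<close> asks for a positive depth, so at time 0 the assumption
        on \<open>z\<close> takes over.\<close>
      show "cinv c (z + t *\<^sub>R \<delta> *\<^sub>R e) \<in> M"
      proof (cases "t = 0")
        case False
        then have "0 < t * \<delta>" "t * \<delta> \<le> 1" using t \<delta> by (auto intro: mult_le_one)
        then show ?thesis using bound[of _ "t * \<delta>"] pt[OF t] by (auto simp: dist_commute)
      qed (use z in simp)
    next
      fix t :: real assume t: "t \<in> {0<..<1}"
      then have t': "t \<in> {0..1}" "0 < t * \<delta>" "t * \<delta> \<le> 1" using \<delta> by (auto intro: mult_le_one)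
      have "sqrt (f (cinv c (z + t *\<^sub>R \<delta> *\<^sub>R e))) * sqrt (g c (cinv c (z + t *\<^sub>R \<delta> *\<^sub>R e)) (\<delta> *\<^sub>R e) (\<delta> *\<^sub>R e))
          \<le> (sqrt C * (t * \<delta>) powr (- a)) * (G * norm (\<delta> *\<^sub>R e))"
      proof (rule mult_mono)
        show "sqrt (f (cinv c (z + t *\<^sub>R \<delta> *\<^sub>R e))) \<le> sqrt C * (t * \<delta>) powr (- a)"
          using sqrt_bound[OF pt(1)[OF t'(1)] t'(2,3) pt(2)[OF t'(1)]] .
        show "sqrt (g c (cinv c (z + t *\<^sub>R \<delta> *\<^sub>R e)) (\<delta> *\<^sub>R e) (\<delta> *\<^sub>R e)) \<le> G * norm (\<delta> *\<^sub>R e)"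
          by (intro G pt t' span_scale eB)
        show "0 \<le> sqrt (g c (cinv c (z + t *\<^sub>R \<delta> *\<^sub>R e)) (\<delta> *\<^sub>R e) (\<delta> *\<^sub>R e))"
          using metric_nonneg[OF c cinv_in[OF c] span_scale[OF eB]] KU pt(1)[OF t'(1)] by auto
      qed (use C in auto)
      also have "\<dots> = ?k * t powr (- a)"
        using \<delta> t by (simp add: powr_mult)
      finally show "sqrt (f (cinv c (z + t *\<^sub>R \<delta> *\<^sub>R e))) * sqrt (g c (cinv c (z + t *\<^sub>R \<delta> *\<^sub>R e)) (\<delta> *\<^sub>R e) (\<delta> *\<^sub>R e))
          \<le> ?k * t powr (- a)" .
    qed
    also have "\<dots> = ennreal (?k / (1 - a))"
      using a C G \<delta> by (intro nn_integral_powr_unit) auto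
    also have "?k / (1 - a) = sqrt C * G * norm e / (1 - a) * \<delta> powr (1 - a)"
      by (simp flip: \<delta>pow)
    finally show ?thesis .
  qed
  \<comment> \<open>After the push all vanishing coordinates stay at least \<open>\<delta>\<close>
    along a straight segment, by convexity of corner and ball. The conformal factor is thus bounded
    there, and the segment has length at most \<open>2 * \<delta>\<close> in the chart.\<close>
  have across: "?d (cinv c (x + \<delta> *\<^sub>R e)) (cinv c (y + \<delta> *\<^sub>R e)) \<le> ennreal (sqrt C * G * 2 * \<delta> powr (1 - a))"
    if x: "x \<in> ?Co" "dist x ?x \<le> \<delta>" and y: "y \<in> ?Co" "dist y ?x \<le> \<delta>" for x y
  proof -
    let ?w = "y - x" and ?z = "x + \<delta> *\<^sub>R e"
    have wB: "?w \<in> span B" using x y by (auto simp: corner_def intro: span_diff)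
    have pt: "?z + t *\<^sub>R ?w \<in> ?K" "\<forall>b\<in>cfaces c. ?x \<bullet> b = 0 \<longrightarrow> \<delta> \<le> (?z + t *\<^sub>R ?w) \<bullet> b"
      if t: "t \<in> {0..1}" for t
    proof -
      let ?u = "(1 - t) *\<^sub>R x + t *\<^sub>R y"
      have u: "?u \<in> ?Co"
        using x y t by (auto simp: corner_def inner_add_left intro!: span_add span_scale add_nonneg_nonneg)
      have "?u \<in> cball ?x \<delta>"
        using convexD[OF convex_cball, of x ?x \<delta> y "1 - t" t] x y t by (simp add: dist_commute)
      then have d: "dist ?u ?x \<le> \<delta>" by (simp add: dist_commute)
      have eq: "?z + t *\<^sub>R ?w = ?u + \<delta> *\<^sub>R e" by (simp add: algebra_simps)
      show "?z + t *\<^sub>R ?w \<in> ?K" "\<forall>b\<in>cfaces c. ?x \<bullet> b = 0 \<longrightarrow> \<delta> \<le> (?z + t *\<^sub>R ?w) \<bullet> b"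
        unfolding eq by (rule inside[OF u d]; use \<delta> in simp)+
    qed
    \<comment> \<open>The factor \<open>t powr (- 0)\<close> is 1 for positive \<open>t\<close>; it
      brings the constant bound into the form of \<open>nn_integral_powr_unit\<close>.\<close>
    have "?d (cinv c ?z) (cinv c (?z + ?w)) \<le> (\<integral>\<^sup>+t\<in>{0..1}. ennreal (sqrt C * \<delta> powr (- a) * (G * (2 * \<delta>)) * t powr (- 0)) \<partial>lborel)"
    proof (rule riemannian_dist_segment_le[OF c])
      fix t :: real assume t: "t \<in> {0..1}"
      show "?z + t *\<^sub>R ?w \<in> cmap c ` cdom c" using pt(1)[OF t] KU by blast
      show "cinv c (?z + t *\<^sub>R ?w) \<in> M"
        using bound[of _ \<delta>] pt[OF t] \<delta> by (auto simp: dist_commute)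
    next
      fix t :: real assume t: "t \<in> {0<..<1}"
      then have t': "t \<in> {0..1}" by auto
      have "dist x y \<le> dist x ?x + dist y ?x" by (rule dist_triangle2)
      then have w: "norm ?w \<le> 2 * \<delta>" using x y by (simp add: dist_norm norm_minus_commute)
      have "sqrt (f (cinv c (?z + t *\<^sub>R ?w))) * sqrt (g c (cinv c (?z + t *\<^sub>R ?w)) ?w ?w)
          \<le> (sqrt C * \<delta> powr (- a)) * (G * (2 * \<delta>))"
      proof (rule mult_mono)
        show "sqrt (f (cinv c (?z + t *\<^sub>R ?w))) \<le> sqrt C * \<delta> powr (- a)"
          using sqrt_bound[OF pt(1)[OF t'] \<delta> pt(2)[OF t']] .
        have "sqrt (g c (cinv c (?z + t *\<^sub>R ?w)) ?w ?w) \<le> G * norm ?w"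
          by (intro G pt t' wB)
        also have "\<dots> \<le> G * (2 * \<delta>)" using w G(1) by (intro mult_left_mono) auto
        finally show "sqrt (g c (cinv c (?z + t *\<^sub>R ?w)) ?w ?w) \<le> G * (2 * \<delta>)" .
        show "0 \<le> sqrt (g c (cinv c (?z + t *\<^sub>R ?w)) ?w ?w)"
          using metric_nonneg[OF c cinv_in[OF c] wB] KU pt(1)[OF t'] by auto
      qed (use C in auto)
      then show "sqrt (f (cinv c (?z + t *\<^sub>R ?w))) * sqrt (g c (cinv c (?z + t *\<^sub>R ?w)) ?w ?w)
          \<le> sqrt C * \<delta> powr (- a) * (G * (2 * \<delta>)) * t powr (- 0)"
        using t by simp
    qed
    also have "\<dots> = ennreal (sqrt C * \<delta> powr (- a) * (G * (2 * \<delta>)) / (1 - 0))"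
      using C G \<delta> by (intro nn_integral_powr_unit) auto
    also have "sqrt C * \<delta> powr (- a) * (G * (2 * \<delta>)) / (1 - 0) = sqrt C * G * 2 * \<delta> powr (1 - a)"
      by (simp flip: \<delta>pow)
    finally show ?thesis by (simp add: add.commute[of y])
  qed
  let ?V = "{q \<in> cdom c. cmap c q \<in> ball ?x \<delta>}"
  have "?d x y < \<epsilon>" if x: "x \<in> ?V \<inter> M" and y: "y \<in> ?V \<inter> M" for x y
  proof -
    let ?p = "sqrt C * G * norm e / (1 - a) * \<delta> powr (1 - a)" and ?q = "sqrt C * G * 2 * \<delta> powr (1 - a)"
    have pq: "0 \<le> ?p" "0 \<le> ?q" using C G a by auto
    have X: "cmap c x \<in> ?Co" "dist (cmap c x) ?x \<le> \<delta>" "cinv c (cmap c x) = x"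
      and Y: "cmap c y \<in> ?Co" "dist (cmap c y) ?x \<le> \<delta>" "cinv c (cmap c y) = y"
      using x y image_corner[OF c] cinv_cmap[OF c] by (auto simp: dist_commute)
    let ?x' = "cinv c (cmap c x + \<delta> *\<^sub>R e)" and ?y' = "cinv c (cmap c y + \<delta> *\<^sub>R e)"
    have M': "?x' \<in> M" "?y' \<in> M"
      using bound[of _ \<delta>] inside[OF X(1,2), of \<delta>] inside[OF Y(1,2), of \<delta>] \<delta> by (auto simp: dist_commute)
    have "?d x y \<le> ?d x ?x' + (?d ?x' ?y' + ?d ?y' y)"
      by (meson riemannian_dist_triangle add_left_mono order_trans)
    also have "?d ?y' y = ?d y ?y'" using commute M' y by blast
    also have "?d x ?x' + (?d ?x' ?y' + ?d y ?y') \<le> ennreal ?p + (ennreal ?q + ennreal ?p)"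
      using push[OF X(1,2)] push[OF Y(1,2)] across[OF X(1,2) Y(1,2)] X(3) Y(3) x y
      by (intro add_mono) auto
    also have "\<dots> = ennreal (?p + (?q + ?p))" using pq by (simp flip: ennreal_plus)
    also have "?p + (?q + ?p) = k * \<delta> powr (1 - a)" by (simp add: k_def field_simps)
    also have "ennreal \<dots> \<le> ennreal \<epsilon>'" using k\<delta> by (intro ennreal_leI) auto
    finally show ?thesis using \<epsilon>'(2) by (rule le_less_trans)
  qed
  moreover have "openin X ?V" by (rule open_preimage[OF c]) simp
  moreover have "p \<in> ?V" using p \<delta> by simp
  ultimately show ?thesis by blast
qed

end

section \<open>Interaction metrics\<close>

locale weighted_corner_manifold = riemannian_corner_manifold X \<A> B g
  for X :: "'a topology" and \<A> :: "('a, 'e::euclidean_space) chart set" and B :: "'e set"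
    and g :: "('a, 'e) metric_comp" +
  fixes N :: nat and H :: "nat \<Rightarrow> 'a set" and \<rho> :: "nat \<Rightarrow> 'a \<Rightarrow> real" and \<alpha> :: "nat \<Rightarrow> real"
  assumes compact: "compact_space X"
    and hypersurfaces: "boundary_hypersurfaces X \<A> N H"
    and defining: "\<And>i. i \<in> {1..N} \<Longrightarrow> boundary_defining_function X \<A> B (H i) (\<rho> i)"
    and weights: "\<And>i. i \<in> {1..N} \<Longrightarrow> 0 \<le> \<alpha> i"
begin

section \<open>Boundary hypersurfaces and defining functions in charts\<close>

lemma rho_smooth: "i \<in> {1..N} \<Longrightarrow> smooth_function \<A> (\<rho> i)"
  and rho_nonneg: "i \<in> {1..N} \<Longrightarrow> p \<in> topspace X \<Longrightarrow> 0 \<le> \<rho> i p"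
  and rho_zero: "i \<in> {1..N} \<Longrightarrow> p \<in> topspace X \<Longrightarrow> \<rho> i p = 0 \<longleftrightarrow> p \<in> H i"
  using defining unfolding boundary_defining_function_def by blast+

lemma rho_continuous: "i \<in> {1..N} \<Longrightarrow> continuous_map X euclideanreal (\<rho> i)"
  using rho_smooth smooth_function_continuous by blast

lemma hypersurface_chart:
  assumes "c \<in> \<A>" "p \<in> cdom c"
  obtains W \<beta> where "openin X W" "p \<in> W" "W \<subseteq> cdom c"
    "bij_betw \<beta> (hyp_index N H p) {b \<in> cfaces c. cmap c p \<bullet> b = 0}"
    "\<forall>i\<in>hyp_index N H p. H i \<inter> W = {q \<in> W. cmap c q \<bullet> \<beta> i = 0}"
  using hypersurfaces assms unfolding boundary_hypersurfaces_def by meson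

text \<open>The boundary is defined through some chart. Independence of the chart holds because in
  each one the vanishing face coordinates are in bijection with the hypersurfaces through
  \<open>p\<close>, an index set that does not refer to charts.\<close>

lemma mboundary_chart:
  assumes c: "c \<in> \<A>" "p \<in> cdom c"
  shows "p \<in> mboundary X \<A> \<longleftrightarrow> (\<exists>b\<in>cfaces c. cmap c p \<bullet> b = 0)"
    and "p \<in> mboundary X \<A> \<longleftrightarrow> hyp_index N H p \<noteq> {}"
proof -
  have *: "(\<exists>b\<in>cfaces c. cmap c p \<bullet> b = 0) \<longleftrightarrow> hyp_index N H p \<noteq> {}" if c: "c \<in> \<A>" "p \<in> cdom c" for c
  proof -
    obtain W \<beta> where "bij_betw \<beta> (hyp_index N H p) {b \<in> cfaces c. cmap c p \<bullet> b = 0}"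
      by (rule hypersurface_chart[OF c])
    then have "\<beta> ` hyp_index N H p = {b \<in> cfaces c. cmap c p \<bullet> b = 0}"
      by (simp add: bij_betw_def)
    then show ?thesis by blast
  qed
  show 1: "p \<in> mboundary X \<A> \<longleftrightarrow> (\<exists>b\<in>cfaces c. cmap c p \<bullet> b = 0)"
    using * c cdom_sub[OF c(1)] unfolding mboundary_def by blast
  show "p \<in> mboundary X \<A> \<longleftrightarrow> hyp_index N H p \<noteq> {}"
    unfolding 1 using * c by blast
qed

lemma mboundary_iff: "p \<in> topspace X \<Longrightarrow> p \<in> mboundary X \<A> \<longleftrightarrow> hyp_index N H p \<noteq> {}"
  using mboundary_chart(2) charts_cover by blast

lemma minterior_chart:
  assumes c: "c \<in> \<A>" "q \<in> cdom c" and pos: "\<And>b. b \<in> cfaces c \<Longrightarrow> 0 < cmap c q \<bullet> b"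
  shows "q \<in> M"
  using mboundary_chart(1)[OF c] pos cdom_sub[OF c(1)] c(2) unfolding minterior_def by force

lemma rho_pos:
  assumes i: "i \<in> {1..N}" and q: "q \<in> M"
  shows "0 < \<rho> i q"
proof -
  have "q \<in> topspace X" "hyp_index N H q = {}"
    using q mboundary_iff[of q] by (auto simp: minterior_def)
  then have "\<rho> i q \<noteq> 0" using rho_zero[OF i] i by (auto simp: hyp_index_def)
  then show ?thesis using rho_nonneg[OF i, of q] \<open>q \<in> topspace X\<close> by simp
qed

lemma rho_lower_away:
  assumes c: "c \<in> \<A>" "p \<in> cdom c" and i: "i \<in> {1..N}" "i \<notin> hyp_index N H p"
  shows "\<exists>\<kappa>>0. \<exists>r>0. \<forall>y\<in>corner B (cfaces c). dist y (cmap c p) \<le> r \<longrightarrow> \<kappa> \<le> \<rho> i (cinv c y)"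
proof -
  have p: "p \<in> topspace X" using c cdom_sub by blast
  have pos: "0 < \<rho> i p"
    using rho_nonneg[OF i(1) p] rho_zero[OF i(1) p] i by (auto simp: hyp_index_def less_le)
  let ?U = "{q \<in> topspace X. \<rho> i q \<in> {\<rho> i p / 2<..}}"
  have U: "openin X ?U" by (rule openin_continuous_map_preimage[OF rho_continuous[OF i(1)]]) auto
  have pU: "p \<in> ?U" using p pos by simp
  obtain r where r: "r > 0" "\<And>y. y\<in>corner B (cfaces c) \<Longrightarrow> dist y (cmap c p) \<le> r \<Longrightarrow> y \<in> cmap c ` (cdom c \<inter> ?U)"
    using chart_ball[OF c U pU] by blast
  have "\<rho> i p / 2 \<le> \<rho> i (cinv c y)" if "y \<in> corner B (cfaces c)" "dist y (cmap c p) \<le> r" for y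
    using r(2)[OF that] cinv_cmap[OF c(1)] by (auto intro: less_imp_le)
  then show ?thesis using r(1) pos by (intro exI[of _ "\<rho> i p / 2"]) auto
qed

text \<open>The derivative of \<open>\<rho> i\<close> at \<open>p\<close> is nonzero and vanishes along the face \<open>H i\<close>, so it is positive in
  the normal direction \<open>b\<close>. Integrating along \<open>b\<close> from the face gives the linear lower bound.\<close>

lemma rho_lower_face:
  assumes c: "c \<in> \<A>" "p \<in> cdom c" and i: "i \<in> hyp_index N H p"
  shows "\<exists>b\<in>cfaces c. cmap c p \<bullet> b = 0 \<and> (\<exists>\<kappa>>0. \<exists>r>0. \<forall>y\<in>corner B (cfaces c).
    dist y (cmap c p) \<le> r \<longrightarrow> \<kappa> * (y \<bullet> b) \<le> \<rho> i (cinv c y))"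
proof -
  let ?x = "cmap c p" and ?Co = "corner B (cfaces c)"
  have iN: "i \<in> {1..N}" "p \<in> H i" using i by (auto simp: hyp_index_def)
  obtain W \<beta> where W: "openin X W" "p \<in> W" "W \<subseteq> cdom c"
    and \<beta>: "bij_betw \<beta> (hyp_index N H p) {b \<in> cfaces c. ?x \<bullet> b = 0}"
    and HW: "\<forall>i\<in>hyp_index N H p. H i \<inter> W = {q \<in> W. cmap c q \<bullet> \<beta> i = 0}"
    by (rule hypersurface_chart[OF c])
  define b where "b = \<beta> i"
  have b: "b \<in> cfaces c" "?x \<bullet> b = 0" using \<beta> i by (auto simp: b_def bij_betw_def)
  have bB: "b \<in> B" using b faces_B[OF c(1)] by blast
  have HW': "q \<in> H i \<longleftrightarrow> cmap c q \<bullet> b = 0" if "q \<in> W" for q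
    using HW i that unfolding b_def by blast
  have "smooth_on (cmap c ` cdom c) (\<rho> i \<circ> cinv c)" "?x \<in> cmap c ` cdom c"
    using rho_smooth[OF iN(1)] c by (auto simp: smooth_function_def)
  then obtain O1 F where O1: "open O1" "?x \<in> O1" and F: "\<And>y. y \<in> cmap c ` cdom c \<inter> O1 \<Longrightarrow> F y = (\<rho> i \<circ> cinv c) y"
    and dF: "\<And>y. y \<in> O1 \<Longrightarrow> (F has_derivative frechet_derivative F (at y)) (at y)"
    and cF: "\<And>v. continuous_on O1 (\<lambda>y. frechet_derivative F (at y) v)"
    by (rule smooth_on_extension) (rule that)
  define T where "T = frechet_derivative F (at ?x)"
  have dT: "(F has_derivative T) (at ?x)" using dF[OF O1(2)] by (simp add: T_def)
  have linT: "linear T" using dT by (rule has_derivative_linear)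
  obtain r0 where r0: "r0 > 0" "\<And>y. y \<in> ?Co \<Longrightarrow> dist y ?x \<le> r0 \<Longrightarrow> y \<in> cmap c ` (cdom c \<inter> W)"
    using chart_ball[OF c W(1,2)] by blast
  obtain r1 where r1: "r1 > 0" "cball ?x r1 \<subseteq> O1" using O1 open_contains_cball by blast
  define r where "r = min r0 r1"
  have r: "r > 0" using r0 r1 by (simp add: r_def)
  have inU: "y \<in> cmap c ` cdom c \<inter> O1" "cinv c y \<in> W" "cmap c (cinv c y) = y" "cinv c y \<in> topspace X" "F y = \<rho> i (cinv c y)"
    if y: "y \<in> ?Co" "dist y ?x \<le> r" for y
  proof -
    have 1: "y \<in> cmap c ` (cdom c \<inter> W)" using y by (intro r0) (auto simp: r_def)
    have 2: "y \<in> O1" using y r1(2) by (auto simp: r_def dist_commute)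
    show 3: "y \<in> cmap c ` cdom c \<inter> O1" using 1 2 by blast
    show "cinv c y \<in> W" using 1 cinv_cmap[OF c(1)] by auto
    show "cmap c (cinv c y) = y" using 3 cmap_cinv[OF c(1)] by blast
    show "cinv c y \<in> topspace X" using 3 cinv_in[OF c(1)] cdom_sub[OF c(1)] by blast
    show "F y = \<rho> i (cinv c y)" using F[OF 3] by simp
  qed
  have F0: "0 \<le> F y" if "y \<in> ?Co" "dist y ?x \<le> r" for y
    using inU[OF that] rho_nonneg[OF iN(1)] by simp
  have Fz: "F y = 0" if "y \<in> ?Co" "dist y ?x \<le> r" "y \<bullet> b = 0" for y
    using inU[OF that(1,2)] rho_zero[OF iN(1)] HW' that(3) by simp
  have xCo: "?x \<in> ?Co" using image_corner[OF c(1)] c by blast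
  have Fx: "F ?x = 0" using Fz[OF xCo] b r by simp
  \<comment> \<open>Increasing a coordinate in \<open>B\<close> never leaves the corner, so each
    basis direction admits a one-sided test of the derivative, even at boundary points.\<close>
  have step: "?x + s *\<^sub>R b' \<in> ?Co" "dist (?x + s *\<^sub>R b') ?x \<le> r" if "b' \<in> B" "0 \<le> s" "s \<le> r" for s b'
  proof -
    have b': "b' \<in> Basis" using that B_Basis by blast
    have "0 \<le> (?x + s *\<^sub>R b') \<bullet> a" if "a \<in> cfaces c" for a
    proof -
      have "a \<in> Basis" "0 \<le> ?x \<bullet> a" using that xCo faces_B[OF c(1)] B_Basis by (auto simp: corner_def)
      then show ?thesis using b' \<open>0 \<le> s\<close> by (simp add: inner_add_left inner_Basis)
    qed
    then show "?x + s *\<^sub>R b' \<in> ?Co"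
      using xCo span_add[OF _ span_scale[OF span_base[OF \<open>b' \<in> B\<close>]]] by (simp add: corner_def)
    show "dist (?x + s *\<^sub>R b') ?x \<le> r" using that b' by (simp add: dist_norm)
  qed
  have dir: "((\<lambda>s. F (y + s *\<^sub>R b')) has_real_derivative frechet_derivative F (at (y + s *\<^sub>R b')) b') (at s)"
    if "y + s *\<^sub>R b' \<in> O1" for y s b'
  proof -
    have "((\<lambda>s. y + s *\<^sub>R b') has_vector_derivative b') (at s)" by (auto intro!: derivative_eq_intros)
    from has_vector_derivative_compose_frechet[OF this dF[OF that]] show ?thesis
      by (simp add: has_real_derivative_iff_has_vector_derivative comp_def)
  qed
  have dir0: "((\<lambda>s. F (?x + s *\<^sub>R b')) has_real_derivative T b') (at 0)" for b'
    using dir[of ?x 0 b'] O1 by (simp add: T_def)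
  \<comment> \<open>\<open>F\<close> is nonnegative on the corner near the point and 0 at it, so it
    cannot decrease along such a direction.\<close>
  have T_ge: "0 \<le> T b'" if b': "b' \<in> B" for b'
  proof (rule ccontr)
    assume "\<not> 0 \<le> T b'"
    then obtain d where d: "d > 0" "\<And>h. 0 < h \<Longrightarrow> h < d \<Longrightarrow> F (?x + (0 + h) *\<^sub>R b') < F (?x + 0 *\<^sub>R b')"
      using DERIV_neg_dec_right[OF dir0, of b'] by auto
    define h where "h = min (d/2) r"
    have "F (?x + h *\<^sub>R b') < 0" using d(2)[of h] d(1) r Fx by (simp add: h_def)
    moreover have "0 \<le> F (?x + h *\<^sub>R b')" using d(1) r step[OF b', of h] F0 by (simp add: h_def)
    ultimately show False by simp
  qed
  \<comment> \<open>Moving along another coordinate stays inside the face \<open>H i\<close>, where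
    \<open>F\<close> is 0.\<close>
  have T_zero: "T b' = 0" if b': "b' \<in> B" "b' \<noteq> b" for b'
  proof (rule ccontr)
    assume "T b' \<noteq> 0"
    then have "0 < T b'" using T_ge[OF b'(1)] by simp
    then obtain d where d: "d > 0" "\<And>h. 0 < h \<Longrightarrow> h < d \<Longrightarrow> F (?x + 0 *\<^sub>R b') < F (?x + (0 + h) *\<^sub>R b')"
      using DERIV_pos_inc_right[OF dir0, of b'] by auto
    define h where "h = min (d/2) r"
    have h: "0 < h" "h \<le> r" "h < d" using d(1) r by (auto simp: h_def)
    have "0 < F (?x + h *\<^sub>R b')" using d(2)[of h] h Fx by simp
    moreover have "(?x + h *\<^sub>R b') \<bullet> b = 0"
      using b(2) b'(2) subsetD[OF B_Basis bB] subsetD[OF B_Basis b'(1)]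
      by (simp add: inner_add_left inner_Basis)
    then have "F (?x + h *\<^sub>R b') = 0" using Fz step[OF b'(1)] h by simp
    ultimately show False by simp
  qed
  \<comment> \<open>\<open>T\<close> is also a derivative within the chart image, the form in which
    nondegeneracy of a defining function is stated.\<close>
  have "((\<rho> i \<circ> cinv c) has_derivative T) (at ?x within cmap c ` cdom c)"
  proof (rule has_derivative_transform_eventually[OF has_derivative_at_withinI[OF dT]])
    have "eventually (\<lambda>y. y \<in> O1) (nhds ?x)" using O1 by (simp add: eventually_nhds_in_open)
    then show "\<forall>\<^sub>F y in at ?x within cmap c ` cdom c. F y = (\<rho> i \<circ> cinv c) y"
      unfolding eventually_at_filter by eventually_elim (use F in auto)
  qed (use F O1 c in auto)
  then obtain v where v: "v \<in> span B" "T v \<noteq> 0"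
    using defining[OF iN(1)] c iN(2) unfolding boundary_defining_function_def by blast
  have "T v = (v \<bullet> b) * T b"
  proof -
    have "v = (\<Sum>b\<in>Basis. (v \<bullet> b) *\<^sub>R b)" by (simp add: euclidean_representation)
    also have "\<dots> = (\<Sum>b\<in>B. (v \<bullet> b) *\<^sub>R b)"
      using v(1) B_Basis by (intro sum.mono_neutral_right) (auto simp: span_B)
    finally have "T v = T (\<Sum>b\<in>B. (v \<bullet> b) *\<^sub>R b)" by simp
    also have "\<dots> = (\<Sum>b'\<in>B. (v \<bullet> b') * T b')"
      by (simp add: linear_sum[OF linT] linear_scale[OF linT])
    also have "\<dots> = (\<Sum>b'\<in>{b}. (v \<bullet> b') * T b')"
      using bB finite_B T_zero by (intro sum.mono_neutral_right) auto
    finally show ?thesis by simp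
  qed
  then have Tb: "0 < T b" using v(2) T_ge[OF bB] by (cases "T b = 0") auto
  have "isCont (\<lambda>y. frechet_derivative F (at y) b) ?x"
    using cF O1 continuous_on_eq_continuous_at by blast
  then have "((\<lambda>y. frechet_derivative F (at y) b) \<longlongrightarrow> T b) (at ?x)"
    by (simp add: isCont_def T_def)
  then have "eventually (\<lambda>y. T b / 2 < frechet_derivative F (at y) b) (at ?x)"
    using Tb by (intro order_tendstoD) auto
  then obtain d where d: "d > 0" "\<And>y. y \<noteq> ?x \<Longrightarrow> dist y ?x < d \<Longrightarrow> T b / 2 < frechet_derivative F (at y) b"
    unfolding eventually_at by blast
  have d': "T b / 2 < frechet_derivative F (at y) b" if "dist y ?x < d" for y
    using d(2)[of y] that Tb by (cases "y = ?x") (auto simp: T_def)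
  \<comment> \<open>Sliding \<open>y\<close> down to the face moves it by
    \<open>y \<bullet> b\<close>, which is at most \<open>r2\<close>; the whole segment therefore
    stays within \<open>2 * r2\<close>.\<close>
  define r2 where "r2 = min (d / 4) (r / 2)"
  have r2: "r2 > 0" "2 * r2 < d" "2 * r2 \<le> r" using d(1) r by (auto simp: r2_def)
  have "T b / 2 * (y \<bullet> b) \<le> \<rho> i (cinv c y)" if y: "y \<in> ?Co" "dist y ?x \<le> r2" for y
  proof (cases "y \<bullet> b = 0")
    case True
    then show ?thesis using F0[OF y(1)] inU(5)[OF y(1)] y(2) r2 by auto
  next
    case False
    let ?h = "y \<bullet> b" and ?y = "y - (y \<bullet> b) *\<^sub>R b"
    have bBasis: "b \<in> Basis" using bB B_Basis by blast
    have h: "0 < ?h" using False y b(1) by (auto simp: corner_def less_le)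
    have "?h = (y - ?x) \<bullet> b" using b(2) by (simp add: inner_diff_left)
    then have h2: "?h \<le> r2"
      using Basis_le_norm[OF bBasis, of "y - ?x"] y(2) by (simp add: dist_norm)
    have near: "?y + s *\<^sub>R b \<in> ?Co" "dist (?y + s *\<^sub>R b) ?x \<le> 2 * r2" if s: "0 \<le> s" "s \<le> ?h" for s
    proof -
      have eq: "?y + s *\<^sub>R b = y - (?h - s) *\<^sub>R b" by (simp add: algebra_simps)
      have "0 \<le> (y - (?h - s) *\<^sub>R b) \<bullet> a" if a: "a \<in> cfaces c" for a
      proof -
        have "a \<in> Basis" "0 \<le> y \<bullet> a" using a y(1) faces_B[OF c(1)] B_Basis by (auto simp: corner_def)
        then show ?thesis using bBasis s by (auto simp: inner_diff_left inner_Basis)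
      qed
      then show "?y + s *\<^sub>R b \<in> ?Co"
        unfolding eq using y(1) span_diff[OF _ span_scale[OF span_base[OF bB]]] by (simp add: corner_def)
      have "norm ((y - ?x) - (?h - s) *\<^sub>R b) \<le> norm (y - ?x) + norm ((?h - s) *\<^sub>R b)"
        by (rule norm_triangle_ineq4)
      also have "\<dots> \<le> r2 + r2" using y(2) h2 s bBasis by (intro add_mono) (auto simp: dist_norm)
      finally show "dist (?y + s *\<^sub>R b) ?x \<le> 2 * r2"
        unfolding eq by (simp add: dist_norm algebra_simps)
    qed
    have "\<exists>z. 0 < z \<and> z < ?h \<and> F (?y + ?h *\<^sub>R b) - F (?y + 0 *\<^sub>R b) = (?h - 0) * frechet_derivative F (at (?y + z *\<^sub>R b)) b"
    proof (rule MVT2[OF h])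
      fix s assume "0 \<le> s" "s \<le> ?h"
      then have "dist (?y + s *\<^sub>R b) ?x \<le> r" "?y + s *\<^sub>R b \<in> ?Co" using near r2 by (auto intro: order_trans)
      then have "?y + s *\<^sub>R b \<in> O1" using inU(1) by blast
      then show "((\<lambda>s. F (?y + s *\<^sub>R b)) has_real_derivative frechet_derivative F (at (?y + s *\<^sub>R b)) b) (at s)"
        by (rule dir)
    qed
    then obtain z where z: "0 < z" "z < ?h" "F y - F ?y = ?h * frechet_derivative F (at (?y + z *\<^sub>R b)) b"
      by auto
    have "F ?y = 0"
      using near[of 0] h r2 bBasis by (intro Fz) (auto simp: inner_diff_left)
    moreover have "T b / 2 < frechet_derivative F (at (?y + z *\<^sub>R b)) b"
      using near(2)[of z] z r2 by (intro d') auto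
    ultimately have "?h * (T b / 2) \<le> F y" using z(3) h by (simp add: mult_left_mono)
    moreover have "F y = \<rho> i (cinv c y)" using inU(5)[OF y(1)] y(2) r2 by simp
    ultimately show ?thesis by (simp add: mult.commute)
  qed
  then show ?thesis using b Tb r2(1) by (intro bexI[of _ b] conjI exI[of _ "T b / 2"] exI[of _ r2]) auto
qed

text \<open>The exponent with which \<open>\<rho> i powr (- \<alpha> i)\<close> may blow up in terms
  of the depth near \<open>p\<close>: it is 0 for hypersurfaces missing \<open>p\<close>, whose
  factors stay bounded.\<close>

definition local_weight :: "'a \<Rightarrow> nat \<Rightarrow> real" where
  "local_weight p i = (if i \<in> hyp_index N H p then \<alpha> i else 0)"

text \<open>The interface between geometry and weights: both metrics are estimated from above
  through these bounds on single factors. For a hypersurface through \<open>p\<close> the bound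
  comes from the linear growth of \<open>\<rho> i\<close> in its face coordinate, for the others
  from continuity.\<close>

lemma corner_neighbourhood:
  assumes c: "c \<in> \<A>" "p \<in> cdom c"
  shows "\<exists>r>0. \<exists>\<kappa>. (\<forall>i\<in>{1..N}. 0 < \<kappa> i) \<and> (\<forall>y\<in>corner B (cfaces c). dist y (cmap c p) \<le> r \<longrightarrow>
    y \<in> cmap c ` cdom c \<and> (\<forall>t>0. (\<forall>b\<in>cfaces c. cmap c p \<bullet> b = 0 \<longrightarrow> t \<le> y \<bullet> b) \<longrightarrow>
      cinv c y \<in> M \<and> (\<forall>i\<in>{1..N}. \<rho> i (cinv c y) powr (- \<alpha> i) \<le> \<kappa> i * t powr (- local_weight p i))))"
proof -
  let ?x = "cmap c p" and ?Co = "corner B (cfaces c)"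
  define good where "good i \<kappa> r \<longleftrightarrow> 0 < \<kappa> \<and> 0 < r \<and> (\<forall>y\<in>?Co. dist y ?x \<le> r \<longrightarrow>
    (\<forall>t>0. (\<forall>b\<in>cfaces c. ?x \<bullet> b = 0 \<longrightarrow> t \<le> y \<bullet> b) \<longrightarrow>
      (if i \<in> hyp_index N H p then \<kappa> * t else \<kappa>) \<le> \<rho> i (cinv c y)))" for i and \<kappa> r :: real
  have "\<exists>\<kappa> r. good i \<kappa> r" if i: "i \<in> {1..N}" for i
  proof (cases "i \<in> hyp_index N H p")
    case True
    obtain b \<kappa> r where b: "b \<in> cfaces c" "?x \<bullet> b = 0" "0 < \<kappa>" "0 < r"
      and le: "\<And>y. y \<in> ?Co \<Longrightarrow> dist y ?x \<le> r \<Longrightarrow> \<kappa> * (y \<bullet> b) \<le> \<rho> i (cinv c y)"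
      using rho_lower_face[OF c True] by blast
    have "\<kappa> * t \<le> \<rho> i (cinv c y)"
      if "y \<in> ?Co" "dist y ?x \<le> r" "\<forall>b\<in>cfaces c. ?x \<bullet> b = 0 \<longrightarrow> t \<le> y \<bullet> b" for y t
    proof -
      have "\<kappa> * t \<le> \<kappa> * (y \<bullet> b)" using that(3) b by (intro mult_left_mono) auto
      then show ?thesis using le[OF that(1,2)] by linarith
    qed
    then show ?thesis using True b unfolding good_def by (intro exI[of _ \<kappa>] exI[of _ r]) auto
  next
    case False
    obtain \<kappa> r where "0 < \<kappa>" "0 < r" "\<And>y. y \<in> ?Co \<Longrightarrow> dist y ?x \<le> r \<Longrightarrow> \<kappa> \<le> \<rho> i (cinv c y)"
      using rho_lower_away[OF c i False] by blast
    then show ?thesis using False unfolding good_def by (intro exI[of _ \<kappa>] exI[of _ r]) auto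
  qed
  then obtain \<kappa> R where good: "\<And>i. i \<in> {1..N} \<Longrightarrow> good i (\<kappa> i) (R i)" by metis
  obtain r0 where r0: "r0 > 0" "\<And>y. y \<in> ?Co \<Longrightarrow> dist y ?x \<le> r0 \<Longrightarrow> y \<in> cmap c ` (cdom c \<inter> topspace X)"
    using chart_ball[OF c openin_topspace] cdom_sub[OF c(1)] c(2) by blast
  define P where "P = {b \<in> cfaces c. ?x \<bullet> b \<noteq> 0}"
  have P: "finite P" "\<And>b. b \<in> P \<Longrightarrow> b \<in> Basis" "\<And>b. b \<in> P \<Longrightarrow> 0 < ?x \<bullet> b"
    using faces_B[OF c(1)] finite_B finite_subset[of P B] B_Basis image_corner[OF c(1)] c(2)
    by (auto simp: P_def corner_def less_le)
  \<comment> \<open>One radius for all requirements: the chart image, every \<open>\<rho> i\<close>,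
    and half of each nonzero face coordinate at \<open>p\<close>, so that these coordinates stay
    positive.\<close>
  define r where "r = Min ({r0} \<union> R ` {1..N} \<union> (\<lambda>b. (?x \<bullet> b) / 2) ` P)"
  have fin: "finite ({r0} \<union> R ` {1..N} \<union> (\<lambda>b. (?x \<bullet> b) / 2) ` P)" using P(1) by simp
  note r_le = Min_le[OF fin, folded r_def]
  have r: "0 < r" "r \<le> r0" "\<And>i. i \<in> {1..N} \<Longrightarrow> r \<le> R i" "\<And>b. b \<in> P \<Longrightarrow> r \<le> (?x \<bullet> b) / 2"
  proof -
    show "0 < r"
      unfolding r_def using fin r0(1) P(3) good by (subst Min_gr_iff) (auto simp: good_def)
  qed (rule r_le, blast)+
  have "y \<in> cmap c ` cdom c \<and> (\<forall>t>0. (\<forall>b\<in>cfaces c. ?x \<bullet> b = 0 \<longrightarrow> t \<le> y \<bullet> b) \<longrightarrow>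
      cinv c y \<in> M \<and> (\<forall>i\<in>{1..N}. \<rho> i (cinv c y) powr (- \<alpha> i) \<le> \<kappa> i powr (- \<alpha> i) * t powr (- local_weight p i)))"
    if y: "y \<in> ?Co" "dist y ?x \<le> r" for y
  proof (intro conjI allI impI ballI)
    show yU: "y \<in> cmap c ` cdom c" using r0(2)[OF y(1)] y(2) r(2) by fastforce
    fix t :: real assume t: "0 < t" "\<forall>b\<in>cfaces c. ?x \<bullet> b = 0 \<longrightarrow> t \<le> y \<bullet> b"
    have "0 < y \<bullet> b" if b: "b \<in> cfaces c" for b
    proof (cases "?x \<bullet> b = 0")
      case False
      then have bP: "b \<in> P" using b by (simp add: P_def)
      have "\<bar>(y - ?x) \<bullet> b\<bar> \<le> r"
        using Basis_le_norm[OF P(2)[OF bP], of "y - ?x"] y(2) by (simp add: dist_norm)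
      then have "?x \<bullet> b - y \<bullet> b \<le> ?x \<bullet> b / 2" using r(4)[OF bP] by (simp add: inner_diff_left abs_le_iff)
      then show ?thesis using P(3)[OF bP] by linarith
    qed (use t b in force)
    then show "cinv c y \<in> M"
      using cinv_in[OF c(1) yU] cmap_cinv[OF c(1) yU] by (intro minterior_chart[OF c(1)]) auto
    fix i assume i: "i \<in> {1..N}"
    have \<kappa>: "0 < \<kappa> i" using good[OF i] by (simp add: good_def)
    have le: "(if i \<in> hyp_index N H p then \<kappa> i * t else \<kappa> i) \<le> \<rho> i (cinv c y)"
      using good[OF i] y r(3)[OF i] t unfolding good_def by fastforce
    \<comment> \<open>The exponent is nonpositive, so the lower bound for \<open>\<rho> i\<close>
      becomes an upper bound for its power.\<close>
    have "\<rho> i (cinv c y) powr (- \<alpha> i) \<le> (if i \<in> hyp_index N H p then \<kappa> i * t else \<kappa> i) powr (- \<alpha> i)"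
      using weights[OF i] \<kappa> t le by (intro powr_mono2') auto
    also have "\<dots> = \<kappa> i powr (- \<alpha> i) * t powr (- local_weight p i)"
      using \<kappa> t by (auto simp: local_weight_def powr_mult)
    finally show "\<rho> i (cinv c y) powr (- \<alpha> i) \<le> \<kappa> i powr (- \<alpha> i) * t powr (- local_weight p i)" .
  qed
  moreover have "0 < \<kappa> i powr (- \<alpha> i)" if "i \<in> {1..N}" for i
    using good[OF that] by (simp add: good_def)
  ultimately show ?thesis using r(1)
    by (intro exI[of _ r] conjI exI[of _ "\<lambda>i. \<kappa> i powr (- \<alpha> i)"]) auto
qed

text \<open>\<open>p\<close> is approached along the sum of all face directions of the chart; after
  a step of size \<open>k n\<close> every face coordinate vanishing at \<open>p\<close> is at least
  \<open>k n\<close>.\<close>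

lemma minterior_dense:
  assumes p: "p \<in> topspace X"
  shows "\<exists>\<sigma>. range \<sigma> \<subseteq> M \<and> limitin X \<sigma> p sequentially"
proof -
  obtain c where c: "c \<in> \<A>" "p \<in> cdom c" using charts_cover p by blast
  let ?x = "cmap c p" and ?Co = "corner B (cfaces c)"
  obtain r where r: "r > 0" "\<And>y t. y \<in> ?Co \<Longrightarrow> dist y ?x \<le> r \<Longrightarrow> 0 < t \<Longrightarrow>
      (\<forall>b\<in>cfaces c. ?x \<bullet> b = 0 \<longrightarrow> t \<le> y \<bullet> b) \<Longrightarrow> cinv c y \<in> M"
    using corner_neighbourhood[OF c] by meson
  define e where "e = (\<Sum>b\<in>cfaces c. b)"
  have S: "finite (cfaces c)" "cfaces c \<subseteq> Basis"
    using faces_B[OF c(1)] finite_B finite_subset B_Basis by blast+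
  have e_in: "e \<bullet> b = 1" if "b \<in> cfaces c" for b
  proof -
    have "e \<bullet> b = (\<Sum>b'\<in>cfaces c. if b' = b then 1 else 0)"
      unfolding e_def inner_sum_left using S(2) that by (intro sum.cong) (auto simp: inner_Basis subset_eq)
    then show ?thesis using S(1) that by simp
  qed
  have eB: "e \<in> span B" unfolding e_def using faces_B[OF c(1)] by (intro span_sum span_base) auto
  have xCo: "?x \<in> ?Co" using image_corner[OF c(1)] c by blast
  \<comment> \<open>The divisor \<open>1 + norm e\<close> keeps the points within radius
    \<open>r\<close>, and \<open>Suc n\<close> makes them converge to \<open>p\<close>.\<close>
  define k where "k n = r / (1 + norm e) / real (Suc n)" for n
  have e1: "0 < 1 + norm e" using norm_ge_zero[of e] by linarith
  have k: "0 < k n" "norm (k n *\<^sub>R e) \<le> r" for n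
  proof -
    show k0: "0 < k n" using r(1) e1 by (simp add: k_def)
    have "k n \<le> r / (1 + norm e)"
      using divide_left_mono[of 1 "real (Suc n)" "r / (1 + norm e)"] r(1) e1 by (simp add: k_def)
    then have "k n * (1 + norm e) \<le> r" using e1 by (simp add: pos_le_divide_eq)
    then show "norm (k n *\<^sub>R e) \<le> r" using k0 by (simp add: algebra_simps)
  qed
  let ?y = "\<lambda>n. ?x + k n *\<^sub>R e"
  have y: "?y n \<in> ?Co" "\<forall>b\<in>cfaces c. ?x \<bullet> b = 0 \<longrightarrow> k n \<le> ?y n \<bullet> b" for n
    using xCo eB e_in k(1)[of n] by (auto simp: corner_def inner_add_left intro!: span_add span_scale)
  have M: "cinv c (?y n) \<in> M" for n
    using r(2)[OF y(1) _ k(1)[of n] y(2)] k(2)[of n] by (simp add: dist_norm)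
  have "k \<longlonglongrightarrow> 0"
    unfolding k_def by (rule LIMSEQ_Suc[OF lim_const_over_n])
  then have "(\<lambda>n. ?x + k n *\<^sub>R e) \<longlonglongrightarrow> ?x + 0 *\<^sub>R e" by (intro tendsto_intros)
  then have lim: "?y \<longlonglongrightarrow> ?x" by simp
  have "limitin X (\<lambda>n. cinv c (?y n)) p sequentially"
    unfolding limitin_def
  proof (intro conjI p allI impI)
    fix U assume U: "openin X U \<and> p \<in> U"
    obtain d where d: "d > 0" "\<And>y. y \<in> ?Co \<Longrightarrow> dist y ?x \<le> d \<Longrightarrow> y \<in> cmap c ` (cdom c \<inter> U)"
      using chart_ball[OF c conjunct1[OF U] conjunct2[OF U]] by blast
    have "eventually (\<lambda>n. dist (?y n) ?x < d) sequentially"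
      using lim d(1) by (rule tendstoD)
    then show "eventually (\<lambda>n. cinv c (?y n) \<in> U) sequentially"
    proof eventually_elim
      fix n assume "dist (?y n) ?x < d"
      then have "?y n \<in> cmap c ` (cdom c \<inter> U)" using d(2)[OF y(1)] by simp
      then show "cinv c (?y n) \<in> U" using cinv_cmap[OF c(1)] by auto
    qed
  qed
  then show ?thesis using M by (intro exI[of _ "\<lambda>n. cinv c (?y n)"]) auto
qed

text \<open>\<open>P\<close> stands for the weight condition. In \<open>upper\<close>,
  \<open>C\<close> is a function of \<open>\<kappa>\<close> because those constants come from a
  chart ball around \<open>p\<close> and are known only after \<open>s\<close> and \<open>C\<close>.
  Interior points are included in \<open>upper\<close>, so they need no separate curve construction.
  \<open>far\<close> supplies the function whose logarithm tends to minus infinity.\<close>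

theorem conformal_completion:
  assumes lower: "0 < \<kappa>" "\<And>q. q \<in> M \<Longrightarrow> \<kappa> \<le> sqrt (f q)"
    and upper: "\<And>p. p \<in> M \<or> p \<in> mboundary X \<A> \<and> P p \<Longrightarrow>
      \<exists>s C. 0 \<le> s \<and> s < 2 \<and> (\<forall>\<kappa>. (\<forall>i\<in>{1..N}. 0 < \<kappa> i) \<longrightarrow> 0 \<le> C \<kappa> \<and>
        (\<forall>q\<in>M. \<forall>t. 0 < t \<and> t \<le> 1 \<and> (\<forall>i\<in>{1..N}. \<rho> i q powr (- \<alpha> i) \<le> \<kappa> i * t powr (- local_weight p i)) \<longrightarrow>
          f q \<le> C \<kappa> * t powr (- s)))"
    and far: "\<And>p. p \<in> mboundary X \<A> \<Longrightarrow> \<not> P p \<Longrightarrow>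
      \<exists>I \<kappa>. I \<subseteq> hyp_index N H p \<and> I \<noteq> {} \<and> 0 < \<kappa> \<and> (\<forall>q\<in>M. \<kappa> \<le> (\<Sum>i\<in>I. \<rho> i q) * sqrt (f q))"
  defines "d \<equiv> riemannian_dist X \<A> M (conformal f g)"
  shows "X_acc X \<A> d = M \<union> {p \<in> mboundary X \<A>. P p}" and "canonically_homeomorphic X M d (X_acc X \<A> d)"
proof -
  let ?Y = "M \<union> {p \<in> mboundary X \<A>. P p}"
  have bX: "mboundary X \<A> \<subseteq> topspace X" by (auto simp: mboundary_def)
  have not_far: "p \<in> ?Y" if \<sigma>: "\<sigma> \<in> cauchy_seqs M d" "limitin X \<sigma> p sequentially" for \<sigma> p
  proof (rule ccontr)
    assume "p \<notin> ?Y"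
    moreover have pX: "p \<in> topspace X" using \<sigma>(2) by (simp add: limitin_def)
    ultimately have pb: "p \<in> mboundary X \<A>" "\<not> P p" by (auto simp: minterior_def)
    obtain I \<kappa>' where I: "I \<subseteq> hyp_index N H p" "I \<noteq> {}" and \<kappa>': "0 < \<kappa>'"
      and bnd: "\<forall>q\<in>M. \<kappa>' \<le> (\<Sum>i\<in>I. \<rho> i q) * sqrt (f q)"
      using far[OF pb] by (elim exE conjE) (rule that)
    have IN: "I \<subseteq> {1..N}" using I by (auto simp: hyp_index_def)
    then have finI: "finite I" using finite_subset by blast
    let ?\<phi> = "\<lambda>q. \<Sum>i\<in>I. \<rho> i q"
    have "\<forall>i\<in>I. \<exists>C\<ge>0. \<forall>\<gamma> t. regular_at X \<A> \<gamma> t \<longrightarrow>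
        (\<exists>D. ((\<rho> i \<circ> \<gamma>) has_real_derivative D) (at t) \<and> \<bar>D\<bar> \<le> C * speed \<A> g \<gamma> t)"
      using smooth_function_speed[OF compact rho_smooth] IN by blast
    then obtain C where C: "\<And>i \<gamma> t. i \<in> I \<Longrightarrow> regular_at X \<A> \<gamma> t \<Longrightarrow>
        \<exists>D. ((\<rho> i \<circ> \<gamma>) has_real_derivative D) (at t) \<and> \<bar>D\<bar> \<le> C i * speed \<A> g \<gamma> t"
      by metis
    have "?\<phi> p \<noteq> 0"
    proof (rule cauchy_limit_nonzero[OF _ _ _ \<kappa>' bspec[OF bnd] \<sigma>[unfolded d_def]])
      show "continuous_map X euclideanreal ?\<phi>"
        using IN by (intro continuous_map_sum finI rho_continuous) auto
      show "0 < ?\<phi> q" if "q \<in> M" for q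
        using IN I(2) rho_pos[OF _ that] by (intro sum_pos finI) auto
      fix \<gamma> t assume \<gamma>: "regular_at X \<A> \<gamma> t" "\<gamma> t \<in> M"
      obtain D where D: "\<And>i. i \<in> I \<Longrightarrow> ((\<rho> i \<circ> \<gamma>) has_real_derivative D i) (at t)"
        "\<And>i. i \<in> I \<Longrightarrow> \<bar>D i\<bar> \<le> C i * speed \<A> g \<gamma> t"
        using C[OF _ \<gamma>(1)] by metis
      have "((\<lambda>s. \<Sum>i\<in>I. (\<rho> i \<circ> \<gamma>) s) has_real_derivative (\<Sum>i\<in>I. D i)) (at t)"
        by (rule DERIV_sum) (rule D(1))
      moreover have "\<bar>\<Sum>i\<in>I. D i\<bar> \<le> (\<Sum>i\<in>I. C i * speed \<A> g \<gamma> t)"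
        using D(2) by (intro order_trans[OF sum_abs] sum_mono) auto
      ultimately show "\<exists>D. ((?\<phi> \<circ> \<gamma>) has_real_derivative D) (at t) \<and> \<bar>D\<bar> \<le> (\<Sum>i\<in>I. C i) * speed \<A> g \<gamma> t"
        by (auto simp: comp_def sum_distrib_right)
    qed
    moreover have "\<rho> i p = 0" if "i \<in> I" for i
      using rho_zero[OF _ pX] IN I(1) that by (auto simp: hyp_index_def)
    ultimately show False by simp
  qed
  interpret limit_completion M d X ?Y
  proof
    show "d x x = 0" if "x \<in> M" for x unfolding d_def using that by (rule refl)
    show "d x y = d y x" if "x \<in> M" "y \<in> M" for x y unfolding d_def using that by (rule commute)
    show "d x z \<le> d x y + d y z" for x y z unfolding d_def by (rule riemannian_dist_triangle)
    show "compact_space X" "Hausdorff_space X" by (rule compact, rule Hausdorff)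
    show "M \<subseteq> ?Y" by blast
    show Y: "?Y \<subseteq> topspace X" using M_sub bX by blast
    show "\<exists>\<epsilon>>0. \<exists>V. openin X V \<and> p \<in> V \<and> (\<forall>x\<in>V \<inter> M. \<forall>y\<in>M. d x y < \<epsilon> \<longrightarrow> y \<in> W)"
      if "p \<in> topspace X" "openin X W" "p \<in> W" for p W
      unfolding d_def by (rule riemannian_dist_finer[OF that lower])
    show "\<exists>\<sigma>. range \<sigma> \<subseteq> M \<and> limitin X \<sigma> p sequentially" if "p \<in> ?Y" for p
      using minterior_dense Y that by blast
    show "p \<in> ?Y" if "\<sigma> \<in> cauchy_seqs M d" "limitin X \<sigma> p sequentially" for \<sigma> p
      using that by (rule not_far)
    fix p and \<epsilon> :: ennreal assume p: "p \<in> ?Y" and \<epsilon>: "0 < \<epsilon>"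
    obtain c where c: "c \<in> \<A>" "p \<in> cdom c" using charts_cover p Y by blast
    have "p \<in> M \<or> p \<in> mboundary X \<A> \<and> P p" using p by blast
    from upper[OF this] obtain s C where s: "0 \<le> s" "s < 2" and C: "\<forall>\<kappa>. (\<forall>i\<in>{1..N}. 0 < \<kappa> i) \<longrightarrow> 0 \<le> C \<kappa> \<and>
        (\<forall>q\<in>M. \<forall>t. 0 < t \<and> t \<le> 1 \<and> (\<forall>i\<in>{1..N}. \<rho> i q powr (- \<alpha> i) \<le> \<kappa> i * t powr (- local_weight p i)) \<longrightarrow>
          f q \<le> C \<kappa> * t powr (- s))"
      by (elim exE conjE) (rule that)
    obtain r \<kappa>' where r: "r > 0" and \<kappa>': "\<forall>i\<in>{1..N}. 0 < \<kappa>' i"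
      and nbhd: "\<forall>y\<in>corner B (cfaces c). dist y (cmap c p) \<le> r \<longrightarrow>
        y \<in> cmap c ` cdom c \<and> (\<forall>t>0. (\<forall>b\<in>cfaces c. cmap c p \<bullet> b = 0 \<longrightarrow> t \<le> y \<bullet> b) \<longrightarrow>
        cinv c y \<in> M \<and> (\<forall>i\<in>{1..N}. \<rho> i (cinv c y) powr (- \<alpha> i) \<le> \<kappa>' i * t powr (- local_weight p i)))"
      using corner_neighbourhood[OF c] by (elim exE conjE) (rule that)
    note C\<kappa> = mp[OF spec[OF C] \<kappa>']
    have C': "0 \<le> C \<kappa>'" using C\<kappa> by blast
    show "\<exists>V. openin X V \<and> p \<in> V \<and> (\<forall>x\<in>V \<inter> M. \<forall>y\<in>V \<inter> M. d x y < \<epsilon>)"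
      unfolding d_def
    proof (rule riemannian_dist_coarser[OF c s C' r])
      show "y \<in> cmap c ` cdom c" if "y \<in> corner B (cfaces c)" "dist y (cmap c p) \<le> r" for y
        using nbhd that by blast
      show "cinv c y \<in> M \<and> f (cinv c y) \<le> C \<kappa>' * t powr (- s)"
        if "y \<in> corner B (cfaces c)" "dist y (cmap c p) \<le> r" "0 < t" "t \<le> 1"
          "\<forall>b\<in>cfaces c. cmap c p \<bullet> b = 0 \<longrightarrow> t \<le> y \<bullet> b" for y t
      proof -
        have "cinv c y \<in> M" "\<forall>i\<in>{1..N}. \<rho> i (cinv c y) powr (- \<alpha> i) \<le> \<kappa>' i * t powr (- local_weight p i)"
          using nbhd[rule_format, OF that(1,2)] that(3,5) by blast+
        then show ?thesis using C\<kappa> that(3,4) by blast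
      qed
    qed (rule \<epsilon>)
  qed
  show eq: "X_acc X \<A> d = ?Y"
  proof
    show "X_acc X \<A> d \<subseteq> ?Y" using not_far by (auto simp: X_acc_def accessible_def)
    have "accessible X \<A> d p" if p: "p \<in> mboundary X \<A>" "P p" for p
    proof -
      obtain \<sigma> where \<sigma>: "range \<sigma> \<subseteq> M" "limitin X \<sigma> p sequentially"
        using minterior_dense p bX by blast
      \<comment> \<open>Every interior sequence converging to a point of the claimed set is Cauchy,
        so density of the interior is all that accessibility needs.\<close>
      then have "\<sigma> \<in> cauchy_seqs M d"
        using limit_cauchy_rel[OF \<sigma>(1,1,2,2)] p by (auto simp: cauchy_rel_def)
      then show ?thesis using p \<sigma> by (auto simp: accessible_def)
    qed
    then show "?Y \<subseteq> X_acc X \<A> d" by (auto simp: X_acc_def)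
  qed
  show "canonically_homeomorphic X M d (X_acc X \<A> d)"
    unfolding eq by (rule canonically_homeomorphic)
qed

section \<open>Weight conditions for the product and the sum metric\<close>

lemma rho_bounded: "\<exists>R\<ge>1. \<forall>i\<in>{1..N}. \<forall>q\<in>M. \<rho> i q \<le> R"
proof -
  have "\<exists>R>0. \<forall>q\<in>topspace X. \<bar>\<rho> i q\<bar> \<le> R" if "i \<in> {1..N}" for i
    using continuous_map_bounded[OF compact rho_continuous[OF that]] .
  then obtain R where R: "\<And>i q. i \<in> {1..N} \<Longrightarrow> q \<in> topspace X \<Longrightarrow> \<bar>\<rho> i q\<bar> \<le> R i" "\<And>i. i \<in> {1..N} \<Longrightarrow> 0 < R i"
    by metis
  have "\<rho> i q \<le> 1 + (\<Sum>i\<in>{1..N}. R i)" if i: "i \<in> {1..N}" and q: "q \<in> M" for i q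
  proof -
    have "R i \<le> (\<Sum>i\<in>{1..N}. R i)" using R(2) i by (intro member_le_sum) (auto intro: less_imp_le)
    then show ?thesis using R(1)[OF i, of q] q M_sub by fastforce
  qed
  moreover have "0 \<le> (\<Sum>i\<in>{1..N}. R i)" using R(2) by (intro sum_nonneg) (auto intro: less_imp_le)
  ultimately show ?thesis by (intro exI[of _ "1 + (\<Sum>i\<in>{1..N}. R i)"]) auto
qed

lemma A_weight_local: "A_weight N H \<alpha> p = (\<Sum>i\<in>{1..N}. local_weight p i)"
  unfolding A_weight_def local_weight_def
  by (intro sum.mono_neutral_cong_left) (auto simp: hyp_index_def)

lemma local_weight_nonneg: "i \<in> {1..N} \<Longrightarrow> 0 \<le> local_weight p i"
  using weights by (simp add: local_weight_def)

lemma local_weight_minterior: "p \<in> M \<Longrightarrow> local_weight p i = 0"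
  using mboundary_iff[of p] by (auto simp: local_weight_def minterior_def)

lemma product_completion:
  defines "d \<equiv> riemannian_dist X \<A> M (product_metric N \<rho> \<alpha> g)"
  shows "X_acc X \<A> d = M \<union> {p \<in> mboundary X \<A>. A_weight N H \<alpha> p < 2}"
    and "canonically_homeomorphic X M d (X_acc X \<A> d)"
proof -
  let ?f = "\<lambda>q. \<Prod>i\<in>{1..N}. \<rho> i q powr (- \<alpha> i)"
  obtain R where R: "R \<ge> 1" "\<And>i q. i \<in> {1..N} \<Longrightarrow> q \<in> M \<Longrightarrow> \<rho> i q \<le> R"
    using rho_bounded by blast
  have fac: "R powr (- \<alpha> i) \<le> \<rho> i q powr (- \<alpha> i)" if "i \<in> {1..N}" "q \<in> M" for i q
    using rho_pos[OF that] R(2)[OF that] weights[OF that(1)] by (intro powr_mono2') auto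
  define \<kappa> where "\<kappa> = sqrt (\<Prod>i\<in>{1..N}. R powr (- \<alpha> i))"
  have 1: "0 < \<kappa>" using R(1) by (auto simp: \<kappa>_def intro!: prod_pos)
  have 2: "\<kappa> \<le> sqrt (?f q)" if "q \<in> M" for q
    unfolding \<kappa>_def using fac that by (intro real_sqrt_le_mono prod_mono) auto
  \<comment> \<open>Multiplying the bounds on the factors adds their exponents up to
    \<open>A_weight\<close> and multiplies the constants. In the interior all local weights are 0,
    so the condition below 2 is automatic.\<close>
  have 3: "\<exists>s C. 0 \<le> s \<and> s < 2 \<and> (\<forall>\<kappa>. (\<forall>i\<in>{1..N}. 0 < \<kappa> i) \<longrightarrow> 0 \<le> C \<kappa> \<and>
        (\<forall>q\<in>M. \<forall>t. 0 < t \<and> t \<le> 1 \<and> (\<forall>i\<in>{1..N}. \<rho> i q powr (- \<alpha> i) \<le> \<kappa> i * t powr (- local_weight p i)) \<longrightarrow>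
          ?f q \<le> C \<kappa> * t powr (- s)))"
    if p: "p \<in> M \<or> p \<in> mboundary X \<A> \<and> A_weight N H \<alpha> p < 2" for p
  proof (intro exI[of _ "A_weight N H \<alpha> p"] exI[of _ "\<lambda>\<kappa>. \<Prod>i\<in>{1..N}. \<kappa> i"] conjI allI impI ballI)
    show "0 \<le> A_weight N H \<alpha> p" unfolding A_weight_local using local_weight_nonneg by (rule sum_nonneg)
    show "A_weight N H \<alpha> p < 2"
      using p by (auto simp: A_weight_local local_weight_minterior)
    fix \<kappa> :: "nat \<Rightarrow> real" assume \<kappa>: "\<forall>i\<in>{1..N}. 0 < \<kappa> i"
    show "0 \<le> prod \<kappa> {1..N}" using \<kappa> by (intro prod_nonneg) (auto intro: less_imp_le)
    fix q t assume t: "0 < t \<and> t \<le> 1 \<and> (\<forall>i\<in>{1..N}. \<rho> i q powr (- \<alpha> i) \<le> \<kappa> i * t powr (- local_weight p i))"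
    have "?f q \<le> (\<Prod>i\<in>{1..N}. \<kappa> i * t powr (- local_weight p i))"
      using t by (intro prod_mono) auto
    also have "\<dots> = prod \<kappa> {1..N} * t powr (\<Sum>i\<in>{1..N}. - local_weight p i)"
      using t by (subst powr_sum) (auto simp: prod.distrib)
    finally show "?f q \<le> prod \<kappa> {1..N} * t powr (- A_weight N H \<alpha> p)"
      by (simp add: A_weight_local sum_negf)
  qed
  have 4: "\<exists>I \<kappa>. I \<subseteq> hyp_index N H p \<and> I \<noteq> {} \<and> 0 < \<kappa> \<and> (\<forall>q\<in>M. \<kappa> \<le> (\<Sum>i\<in>I. \<rho> i q) * sqrt (?f q))"
    if p: "p \<in> mboundary X \<A>" "\<not> A_weight N H \<alpha> p < 2" for p
  proof -
    let ?I = "hyp_index N H p" and ?A = "A_weight N H \<alpha> p"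
    have I: "finite ?I" "?I \<subseteq> {1..N}" "?I \<noteq> {}"
      using p mboundary_iff[of p] by (auto simp: hyp_index_def mboundary_def)
    \<comment> \<open>\<open>R'\<close> bounds the sum of the defining functions through
      \<open>p\<close> from above; \<open>K\<close> bounds the remaining factors from below.\<close>
    define R' where "R' = R * card ?I"
    have R': "0 < R'" using R(1) I by (simp add: R'_def card_gt_0_iff)
    define K where "K = (\<Prod>i\<in>{1..N} - ?I. R powr (- \<alpha> i))"
    have K: "0 < K" unfolding K_def using R(1) by (intro prod_pos) auto
    \<comment> \<open>For \<open>i\<close> through \<open>p\<close>,
      \<open>\<rho> i \<le> \<phi>\<close> makes the product at least
      \<open>K * \<phi> powr (- ?A)\<close>. After multiplication by \<open>\<phi>\<^sup>2\<close>
      the exponent \<open>2 - ?A\<close> is nonpositive, and \<open>\<phi> \<le> R'\<close> leaves a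
      positive constant.\<close>
    have "sqrt (K * R' powr (2 - ?A)) \<le> (\<Sum>i\<in>?I. \<rho> i q) * sqrt (?f q)" if q: "q \<in> M" for q
    proof -
      let ?\<phi> = "\<Sum>i\<in>?I. \<rho> i q"
      have \<rho>: "0 < \<rho> i q" "\<rho> i q \<le> R" if "i \<in> ?I" for i using that I rho_pos q R(2) by blast+
      have \<phi>: "0 < ?\<phi>" using \<rho> I by (intro sum_pos) auto
      have "?\<phi> \<le> (\<Sum>i\<in>?I. R)" using \<rho> by (intro sum_mono) auto
      then have \<phi>R: "?\<phi> \<le> R'" by (simp add: R'_def mult.commute)
      have "K * (\<Prod>i\<in>?I. ?\<phi> powr (- \<alpha> i)) \<le> (\<Prod>i\<in>{1..N} - ?I. \<rho> i q powr (- \<alpha> i)) * (\<Prod>i\<in>?I. \<rho> i q powr (- \<alpha> i))"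
        unfolding K_def
      proof (intro mult_mono prod_mono)
        show "0 \<le> R powr - \<alpha> i \<and> R powr - \<alpha> i \<le> \<rho> i q powr - \<alpha> i" if "i \<in> {1..N} - ?I" for i
          using fac q that by simp
        show "0 \<le> ?\<phi> powr - \<alpha> i \<and> ?\<phi> powr - \<alpha> i \<le> \<rho> i q powr - \<alpha> i" if i: "i \<in> ?I" for i
        proof -
          have "\<rho> i q \<le> ?\<phi>" using \<rho> i I by (intro member_le_sum) (auto intro: less_imp_le)
          then have "?\<phi> powr - \<alpha> i \<le> \<rho> i q powr - \<alpha> i"
            using \<rho>[OF i] weights I i by (intro powr_mono2') auto
          then show ?thesis by simp
        qed
      qed (auto intro!: prod_nonneg)
      also have "\<dots> = ?f q" using I by (subst prod.subset_diff[of ?I "{1..N}"]) auto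
      also have "(\<Prod>i\<in>?I. ?\<phi> powr (- \<alpha> i)) = ?\<phi> powr (- ?A)"
        using \<phi> I unfolding A_weight_def sum_negf[symmetric] by (subst powr_sum) auto
      finally have "?\<phi>\<^sup>2 * (K * ?\<phi> powr (- ?A)) \<le> ?\<phi>\<^sup>2 * ?f q" by (rule mult_left_mono) simp
      moreover have "?\<phi>\<^sup>2 * (K * ?\<phi> powr (- ?A)) = K * ?\<phi> powr (2 - ?A)"
        using \<phi> by (simp add: powr_diff powr_minus powr_numeral divide_inverse)
      moreover have "K * R' powr (2 - ?A) \<le> K * ?\<phi> powr (2 - ?A)"
        using K \<phi> \<phi>R p(2) by (intro mult_left_mono powr_mono2') auto
      ultimately have "K * R' powr (2 - ?A) \<le> ?\<phi>\<^sup>2 * ?f q" by linarith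
      then have "sqrt (K * R' powr (2 - ?A)) \<le> sqrt (?\<phi>\<^sup>2 * ?f q)" by simp
      also have "\<dots> = ?\<phi> * sqrt (?f q)" using \<phi> by (simp add: real_sqrt_mult)
      finally show ?thesis .
    qed
    then show ?thesis
      using I K R' by (intro exI[of _ ?I] exI[of _ "sqrt (K * R' powr (2 - ?A))"]) auto
  qed
  show "X_acc X \<A> d = M \<union> {p \<in> mboundary X \<A>. A_weight N H \<alpha> p < 2}"
    unfolding d_def product_metric_def by (rule conformal_completion(1)[OF 1 2 3 4])
  show "canonically_homeomorphic X M d (X_acc X \<A> d)"
    unfolding d_def product_metric_def by (rule conformal_completion(2)[OF 1 2 3 4])
qed

text \<open>An empty sum would give the zero form instead of a metric; with \<open>1 \<le> N\<close>
  the term of index 1 bounds the conformal factor from below.\<close>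

lemma sum_completion:
  assumes N: "1 \<le> N"
  defines "d \<equiv> riemannian_dist X \<A> M (sum_metric N \<rho> \<alpha> g)"
  shows "X_acc X \<A> d = M \<union> {p \<in> mboundary X \<A>. M_weight N H \<alpha> p < 2}"
    and "canonically_homeomorphic X M d (X_acc X \<A> d)"
proof -
  let ?f = "\<lambda>q. \<Sum>i\<in>{1..N}. \<rho> i q powr (- \<alpha> i)"
  obtain R where R: "R \<ge> 1" "\<And>i q. i \<in> {1..N} \<Longrightarrow> q \<in> M \<Longrightarrow> \<rho> i q \<le> R"
    using rho_bounded by blast
  have term_le: "\<rho> i q powr (- \<alpha> i) \<le> ?f q" if "i \<in> {1..N}" for i q
    using that by (intro member_le_sum) auto
  define \<kappa> where "\<kappa> = sqrt (R powr (- \<alpha> 1))"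
  have 1: "0 < \<kappa>" using R(1) by (simp add: \<kappa>_def)
  have 2: "\<kappa> \<le> sqrt (?f q)" if "q \<in> M" for q
  proof -
    have "R powr (- \<alpha> 1) \<le> \<rho> 1 q powr (- \<alpha> 1)"
      using rho_pos[of 1 q] R(2)[of 1 q] weights[of 1] N that by (intro powr_mono2') auto
    then show ?thesis using term_le[of 1 q] N unfolding \<kappa>_def by (intro real_sqrt_le_mono) auto
  qed
  have hyp: "finite (hyp_index N H p)" "p \<in> mboundary X \<A> \<Longrightarrow> hyp_index N H p \<noteq> {}" for p
    using mboundary_iff[of p] by (auto simp: hyp_index_def mboundary_def)
  have 3: "\<exists>s C. 0 \<le> s \<and> s < 2 \<and> (\<forall>\<kappa>. (\<forall>i\<in>{1..N}. 0 < \<kappa> i) \<longrightarrow> 0 \<le> C \<kappa> \<and>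
        (\<forall>q\<in>M. \<forall>t. 0 < t \<and> t \<le> 1 \<and> (\<forall>i\<in>{1..N}. \<rho> i q powr (- \<alpha> i) \<le> \<kappa> i * t powr (- local_weight p i)) \<longrightarrow>
          ?f q \<le> C \<kappa> * t powr (- s)))"
    if p: "p \<in> M \<or> p \<in> mboundary X \<A> \<and> M_weight N H \<alpha> p < 2" for p
  proof -
    \<comment> \<open>At an interior point \<open>M_weight\<close> is a \<open>Max\<close> over the
      empty set, about which nothing is known, so the exponent 0 is taken there.\<close>
    have "\<exists>s. 0 \<le> s \<and> s < 2 \<and> (\<forall>i\<in>{1..N}. local_weight p i \<le> s)"
    proof (cases "p \<in> M")
      case True
      then show ?thesis by (intro exI[of _ 0]) (simp add: local_weight_minterior)
    next
      case False
      then have p: "p \<in> mboundary X \<A>" "M_weight N H \<alpha> p < 2" using p by auto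
      have le: "\<alpha> i \<le> M_weight N H \<alpha> p" if "i \<in> hyp_index N H p" for i
        unfolding M_weight_def using hyp(1) that by (intro Max_ge) auto
      moreover obtain j where "j \<in> hyp_index N H p" using hyp(2)[OF p(1)] by blast
      ultimately have "0 \<le> M_weight N H \<alpha> p"
        using weights[of j] by (force simp: hyp_index_def)
      then show ?thesis using le p(2) by (intro exI[of _ "M_weight N H \<alpha> p"]) (auto simp: local_weight_def)
    qed
    then obtain s where s: "0 \<le> s" "s < 2" "\<And>i. i \<in> {1..N} \<Longrightarrow> local_weight p i \<le> s" by blast
    show ?thesis
    proof (intro exI[of _ s] exI[of _ "\<lambda>\<kappa>. \<Sum>i\<in>{1..N}. \<kappa> i"] conjI allI impI ballI s)
      fix \<kappa> :: "nat \<Rightarrow> real" assume \<kappa>: "\<forall>i\<in>{1..N}. 0 < \<kappa> i"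
      show "0 \<le> sum \<kappa> {1..N}" using \<kappa> by (intro sum_nonneg) (auto intro: less_imp_le)
      fix q t assume t: "0 < t \<and> t \<le> 1 \<and> (\<forall>i\<in>{1..N}. \<rho> i q powr (- \<alpha> i) \<le> \<kappa> i * t powr (- local_weight p i))"
      have "\<rho> i q powr (- \<alpha> i) \<le> \<kappa> i * t powr (- s)" if i: "i \<in> {1..N}" for i
      proof -
        have "\<rho> i q powr (- \<alpha> i) \<le> \<kappa> i * t powr (- local_weight p i)" using t i by blast
        \<comment> \<open>Here \<open>t \<le> 1\<close> matters: replacing each local weight by the
          larger common exponent \<open>s\<close> only increases the power.\<close>
        also have "\<dots> \<le> \<kappa> i * t powr (- s)"
          using t s(3)[OF i] \<kappa> i by (intro mult_left_mono powr_mono') (auto intro: less_imp_le)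
        finally show ?thesis .
      qed
      then show "?f q \<le> sum \<kappa> {1..N} * t powr (- s)"
        unfolding sum_distrib_right by (rule sum_mono)
    qed
  qed
  have 4: "\<exists>I \<kappa>. I \<subseteq> hyp_index N H p \<and> I \<noteq> {} \<and> 0 < \<kappa> \<and> (\<forall>q\<in>M. \<kappa> \<le> (\<Sum>i\<in>I. \<rho> i q) * sqrt (?f q))"
    if p: "p \<in> mboundary X \<A>" "\<not> M_weight N H \<alpha> p < 2" for p
  proof -
    have "Max (\<alpha> ` hyp_index N H p) \<in> \<alpha> ` hyp_index N H p"
      using hyp p by (intro Max_in) auto
    \<comment> \<open>A hypersurface of maximal weight is enough: the sum dominates its term, and as
      \<open>2 - \<alpha> i\<close> is nonpositive, the upper bound \<open>R\<close> for
      \<open>\<rho> i\<close> gives the constant.\<close>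
    then obtain i where i: "i \<in> hyp_index N H p" "2 \<le> \<alpha> i"
      using p(2) by (auto simp: M_weight_def)
    have iN: "i \<in> {1..N}" using i by (simp add: hyp_index_def)
    have "sqrt (R powr (2 - \<alpha> i)) \<le> \<rho> i q * sqrt (?f q)" if q: "q \<in> M" for q
    proof -
      note \<rho> = rho_pos[OF iN q]
      have "R powr (2 - \<alpha> i) \<le> \<rho> i q powr (2 - \<alpha> i)"
        using \<rho> R(2)[OF iN q] i by (intro powr_mono2') auto
      also have "\<dots> = (\<rho> i q)\<^sup>2 * \<rho> i q powr (- \<alpha> i)"
        using \<rho> by (simp add: powr_diff powr_minus powr_numeral divide_inverse)
      also have "\<dots> \<le> (\<rho> i q)\<^sup>2 * ?f q" using term_le[OF iN] by (rule mult_left_mono) simp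
      finally have "sqrt (R powr (2 - \<alpha> i)) \<le> sqrt ((\<rho> i q)\<^sup>2 * ?f q)" by simp
      also have "\<dots> = \<rho> i q * sqrt (?f q)" using \<rho> by (simp add: real_sqrt_mult)
      finally show ?thesis .
    qed
    then show ?thesis
      using i R(1) by (intro exI[of _ "{i}"] exI[of _ "sqrt (R powr (2 - \<alpha> i))"]) auto
  qed
  show "X_acc X \<A> d = M \<union> {p \<in> mboundary X \<A>. M_weight N H \<alpha> p < 2}"
    unfolding d_def sum_metric_def by (rule conformal_completion(1)[OF 1 2 3 4])
  show "canonically_homeomorphic X M d (X_acc X \<A> d)"
    unfolding d_def sum_metric_def by (rule conformal_completion(2)[OF 1 2 3 4])
qed

end

theorem theorem5p10:
  fixes X :: "'a topology" and \<A> :: "('a, 'e::euclidean_space) chart set" and B :: "'e set"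
    and N :: nat and H :: "nat \<Rightarrow> 'a set" and \<rho> :: "nat \<Rightarrow> 'a \<Rightarrow> real" and \<alpha> :: "nat \<Rightarrow> real"
    and g0 :: "('a, 'e) metric_comp"
  defines "X0 \<equiv> minterior X \<A>"
    and "d_prod \<equiv> riemannian_dist X \<A> (minterior X \<A>) (product_metric N \<rho> \<alpha> g0)"
    and "d_sum \<equiv> riemannian_dist X \<A> (minterior X \<A>) (sum_metric N \<rho> \<alpha> g0)"
  assumes "manifold_with_corners X \<A> B"
    and "compact_space X"
    and "boundary_hypersurfaces X \<A> N H"
    and "\<And>i. i \<in> {1..N} \<Longrightarrow> boundary_defining_function X \<A> B (H i) (\<rho> i)"
    and "\<And>i. i \<in> {1..N} \<Longrightarrow> 0 \<le> \<alpha> i"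
    and "riemannian_metric \<A> B g0"
  shows "X_acc X \<A> d_prod = X0 \<union> {p \<in> mboundary X \<A>. A_weight N H \<alpha> p < 2} \<and>
         canonically_homeomorphic X X0 d_prod (X_acc X \<A> d_prod) \<and>
         (1 \<le> N \<longrightarrow>
            X_acc X \<A> d_sum = X0 \<union> {p \<in> mboundary X \<A>. M_weight N H \<alpha> p < 2} \<and>
            canonically_homeomorphic X X0 d_sum (X_acc X \<A> d_sum))"
proof -
  interpret weighted_corner_manifold X \<A> B g0 N H \<rho> \<alpha>
    by unfold_locales (fact assms)+
  show ?thesis
    unfolding X0_def d_prod_def d_sum_def using product_completion sum_completion by blast
qed

end
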